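(* Let $m\in\mathbb{N}$, $c>0$, and let $(Y_t(x))_{(t,x)\in\mathbb{R}\times\mathbb{R}^m}$ be a $c$-class MSTOU process with $(\gamma,\Sigma,\nu,\pi)$ the characteristic quadruplet of its driving Lévy basis, where the mean reversion parameter is $Gamma(\alpha,\beta)$ distributed, i.e. $\pi$ has density $f(\lambda)=\frac{\beta^\alpha}{\Gamma(\alpha)}\lambda^{\alpha-1}e^{-\beta\lambda}$ on $(0,\infty)$, with $\alpha>m+1$ and $\beta>0$. Put $\psi(h)=\frac{1}{\sqrt{c^2+1}}\frac{h}{\sqrt{m+1}}$, let $V_m(c)$ be the volume of the $m$-dimensional ball of radius $c$, and $\Sigma_\Lambda=\Sigma+\int_{\mathbb{R}}x^2\nu(dx)$. The following hold for all $h>0$. (i) If $\int_{|x|>1}x^2\nu(dx)<\infty$ and $\gamma+\int_{|x|>1}x\,\nu(dx)=0$, then $Y$ is $\theta$-lex-weakly dependent. If $c\in(0,1]$, then for $m=1$ $$\theta_Y(h)\le2\left(\frac{c\Sigma_\Lambda\beta^\alpha}{2\Gamma(\alpha)}\left(\frac{\Gamma(\alpha-2)}{(2\psi(h)+\beta)^{\alpha-2}}+\frac{2\psi(h)\Gamma(\alpha-1)}{(2\psi(h)+\beta)^{\alpha-1}}\right)\right)^{1/2},$$ and for $m\ge2$ $$\theta_Y(h)\le2\left(V_m(c)\frac{m!\Sigma_\Lambda\beta^\alpha}{2^{m+1}}\sum_{k=0}^m\frac{(2\psi(h))^k}{k!(2\psi(h)+\beta)^{\alpha-m-1+k}}\frac{\Gamma(\alpha-m-1+k)}{\Gamma(\alpha)}\right)^{1/2}.$$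 If $c>1$, then for all $m\in\mathbb{N}$ $$\theta_Y(h)\le2\left(V_m(c)\frac{m!\Sigma_\Lambda\beta^\alpha}{2^{m+1}}\sum_{k=0}^m\frac{\left(\frac{2\psi(h)}c\right)^k}{k!\left(\frac{2\psi(h)}c+\beta\right)^{\alpha-m-1+k}}\frac{\Gamma(\alpha-m-1+k)}{\Gamma(\alpha)}\right)^{1/2}.$$ In particular, in all cases $\theta_Y(h)=\mathcal{O}(h^{\frac{(m+1)-\alpha}2})$. (ii) If $\int_{\mathbb{R}}|x|\,\nu(dx)<\infty$ and $\Sigma=0$, put $\gamma_0=\gamma-\int_{|x|\le1}x\,\nu(dx)$ and $\gamma_{abs}=|\gamma_0|+\int_{\mathbb{R}}|x|\nu(dx)$. Then $Y$ is $\theta$-lex-weakly dependent, and for all $m\in\mathbb{N}$: if $c\in(0,1]$, $$\theta_Y(h)\le2V_m(c)\,m!\,\beta^\alpha\gamma_{abs}\sum_{k=0}^m\frac{\psi(h)^k}{k!(\psi(h)+\beta)^{\alpha-m-1+k}}\frac{\Gamma(\alpha-m-1+k)}{\Gamma(\alpha)},$$ whereas if $c>1$, $$\theta_Y(h)\le2V_m(c)\,m!\,\beta^\alpha\gamma_{abs}\sum_{k=0}^m\frac{\left(\frac{\psi(h)}c\right)^k}{k!\left(\frac{\psi(h)}c+\beta\right)^{\alpha-m-1+k}}\frac{\Gamma(\alpha-m-1+k)}{\Gamma(\alpha)}.$$ In particular, in all cases $\theta_Y(h)=\mathcal{O}(h^{(m+1)-\alpha})$.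
   Context: A real-valued Lévy basis on $(0,\infty)\times\mathbb{R}\times\mathbb{R}^m$ with characteristic quadruplet $(\gamma,\Sigma,\nu,\pi)$ is a family $\Lambda=\{\Lambda(B)\}$ of real random variables indexed by the bounded Borel sets $B$, with independent values on disjoint sets, almost surely $\sigma$-additive, and with $E[e^{iu\Lambda(B)}]=e^{\Phi(u)(\pi\times Leb)(B)}$, where $\Phi(u)=i\gamma u-\frac12\Sigma u^2+\int_{\mathbb{R}}(e^{iux}-1-iux\mathbb{1}_{[0,1]}(|x|))\nu(dx)$; $\pi$ is a probability measure on $(0,\infty)$. Stochastic integrals are in the sense of Rajput and Rosiński (1989). $c$-class MSTOU process (mixed spatio-temporal Ornstein–Uhlenbeck process): $\int_{|x|>1}x^2\nu(dx)<\infty$, $\pi$ has a density $f$ with $\int_0^\infty\lambda^{-(m+1)}f(\lambda)\,d\lambda<\infty$, and $$Y_t(x)=\int_0^\infty\int_{A_t(x)}e^{-\lambda(t-s)}\,\Lambda(d\lambda,ds,d\xi),\qquad A_t(x)=\{(s,\xi)\in\mathbb{R}\times\mathbb{R}^m:s\le t,\ \|x-\xi\|\le c|t-s|\}.$$ Lexicographic order on $\mathbb{R}^{m+1}=\mathbb{R}\times\mathbb{R}^m$ (time coordinate first): for $y\ne z$, $y<_{lex}z$ iff at the first coordinate where they differ $y$ is smaller. $V_p=\{q:q<_{lex}p\}\cup\{p\}$, $V_p^h=V_p\cap\{q:\|p-q\|_\infty\ge h\}$. $\theta$-lex-weak dependence of a real-valued field $Y=(Y_p)_{p\in\mathbb{R}^{m+1}}$: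 $\theta_Y(h)=\sup_{u\in\mathbb{N}}\theta_u(h)\to0$ as $h\to\infty$, where $\theta_u(h)$ is the supremum of $|Cov(F(Y_\Gamma),G(Y_p))|/(\|F\|_\infty Lip(G))$ over bounded Borel $F:\mathbb{R}^u\to\mathbb{R}$, bounded Lipschitz $G:\mathbb{R}\to\mathbb{R}$ (non-zero denominator), $p\in\mathbb{R}^{m+1}$ and $\Gamma\subset V_p^h$ with $|\Gamma|=u$. *)

theory Defs
  imports "HOL-Probability.Probability" "HOL-Library.Landau_Symbols"
begin

subsection \<open>Levy bases\<close>

definition levy_measure :: "real measure \<Rightarrow> bool" where
  "levy_measure \<nu> \<longleftrightarrow>
     sets \<nu> = sets borel \<and> emeasure \<nu> {0} = 0 \<and>
     (\<integral>\<^sup>+ x. ennreal (min 1 (x\<^sup>2)) \<partial>\<nu>) < \<infinity>"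

definition characteristic_quadruplet ::
    "real \<Rightarrow> real \<Rightarrow> real measure \<Rightarrow> real measure \<Rightarrow> bool" where
  "characteristic_quadruplet \<gamma> \<Sigma> \<nu> \<pi> \<longleftrightarrow>
     0 \<le> \<Sigma> \<and> levy_measure \<nu> \<and>
     prob_space \<pi> \<and> sets \<pi> = sets borel \<and> emeasure \<pi> {..0} = 0"

definition levy_exponent :: "real \<Rightarrow> real \<Rightarrow> real measure \<Rightarrow> real \<Rightarrow> complex" where
  "levy_exponent \<gamma> \<Sigma> \<nu> u =
     \<i> * of_real (\<gamma> * u) - of_real (\<Sigma> * u\<^sup>2 / 2)
     + (CLINT x|\<nu>. iexp (u * x) - 1 - \<i> * of_real (u * x * indicator {0..1} \<bar>x\<bar>))"

text \<open>Points of the state space are triples (mean reversion rate, time, location).\<close>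

definition levy_space :: "(real \<times> real \<times> (real ^ 'm)) set" where
  "levy_space = {0<..} \<times> UNIV"

definition bounded_borel_sets :: "(real \<times> real \<times> (real ^ 'm)) set set" where
  "bounded_borel_sets = {B \<in> sets borel. B \<subseteq> levy_space \<and> bounded B}"

definition levy_basis ::
    "'w measure \<Rightarrow> ((real \<times> real \<times> (real ^ 'm)) set \<Rightarrow> 'w \<Rightarrow> real) \<Rightarrow>
     real \<Rightarrow> real \<Rightarrow> real measure \<Rightarrow> real measure \<Rightarrow> bool" where
  "levy_basis M \<Lambda> \<gamma> \<Sigma> \<nu> \<pi> \<longleftrightarrow>
     prob_space M \<and>
     characteristic_quadruplet \<gamma> \<Sigma> \<nu> \<pi> \<and>
     (\<forall>B\<in>bounded_borel_sets. \<Lambda> B \<in> borel_measurable M) \<and>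
     (\<forall>B :: nat \<Rightarrow> _. range B \<subseteq> bounded_borel_sets \<and> disjoint_family B \<longrightarrow>
        prob_space.indep_vars M (\<lambda>_. borel) (\<lambda>n. \<Lambda> (B n)) UNIV) \<and>
     (\<forall>B :: nat \<Rightarrow> _. range B \<subseteq> bounded_borel_sets \<and> disjoint_family B \<and>
          (\<Union>n. B n) \<in> bounded_borel_sets \<longrightarrow>
        (AE \<omega> in M. (\<lambda>n. \<Lambda> (B n) \<omega>) sums \<Lambda> (\<Union>n. B n) \<omega>)) \<and>
     (\<forall>B\<in>bounded_borel_sets. \<forall>u.
        char (distr M borel (\<Lambda> B)) u =
          exp (levy_exponent \<gamma> \<Sigma> \<nu> u * of_real (measure (\<pi> \<Otimes>\<^sub>M lborel) B)))"

subsection \<open>Stochastic integrals in the sense of Rajput and Rosinski\<close>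

definition converges_in_probability ::
    "'w measure \<Rightarrow> (nat \<Rightarrow> 'w \<Rightarrow> real) \<Rightarrow> ('w \<Rightarrow> real) \<Rightarrow> bool" where
  "converges_in_probability M X Z \<longleftrightarrow>
     (\<forall>\<epsilon>>0. (\<lambda>n. measure M {\<omega> \<in> space M. \<bar>X n \<omega> - Z \<omega>\<bar> > \<epsilon>}) \<longlonglongrightarrow> 0)"

definition levy_simple :: "(real \<times> real \<times> (real ^ 'm) \<Rightarrow> real) \<Rightarrow> bool" where
  "levy_simple g \<longleftrightarrow>
     g \<in> borel_measurable borel \<and> finite (range g) \<and>
     {z. g z \<noteq> 0} \<in> bounded_borel_sets"

definition levy_simple_integral ::
    "((real \<times> real \<times> (real ^ 'm)) set \<Rightarrow> 'w \<Rightarrow> real) \<Rightarrow>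
     (real \<times> real \<times> (real ^ 'm)) set \<Rightarrow> (real \<times> real \<times> (real ^ 'm) \<Rightarrow> real) \<Rightarrow> 'w \<Rightarrow> real" where
  "levy_simple_integral \<Lambda> A g \<omega> = (\<Sum>y\<in>range g - {0}. y * \<Lambda> (A \<inter> g -` {y}) \<omega>)"

text \<open>
  The control measure of a homogeneous basis is a constant multiple of the product of
  \<open>\<pi>\<close> and Lebesgue measure, so that product is used for the almost everywhere
  convergence. Integrals are only determined up to null sets; hence a relation.
\<close>

definition has_levy_integral ::
    "'w measure \<Rightarrow> ((real \<times> real \<times> (real ^ 'm)) set \<Rightarrow> 'w \<Rightarrow> real) \<Rightarrow> real measure \<Rightarrow>
     (real \<times> real \<times> (real ^ 'm)) set \<Rightarrow> (real \<times> real \<times> (real ^ 'm) \<Rightarrow> real) \<Rightarrow>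
     ('w \<Rightarrow> real) \<Rightarrow> bool" where
  "has_levy_integral M \<Lambda> \<pi> A f X \<longleftrightarrow>
     f \<in> borel_measurable borel \<and> X \<in> borel_measurable M \<and>
     (\<exists>g. (\<forall>n. levy_simple (g n)) \<and>
          (AE z in \<pi> \<Otimes>\<^sub>M lborel. (\<lambda>n. g n z) \<longlonglongrightarrow> f z) \<and>
          (\<forall>B\<in>sets borel. B \<subseteq> levy_space \<longrightarrow>
             (\<exists>Z\<in>borel_measurable M.
                converges_in_probability M (\<lambda>n. levy_simple_integral \<Lambda> B (g n)) Z)) \<and>
          converges_in_probability M (\<lambda>n. levy_simple_integral \<Lambda> A (g n)) X)"

subsection \<open>MSTOU processes\<close>

definition ambit_set :: "real \<Rightarrow> real \<times> (real ^ 'm) \<Rightarrow> (real \<times> (real ^ 'm)) set" where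
  "ambit_set c p = {(s, \<xi>). s \<le> fst p \<and> norm (snd p - \<xi>) \<le> c * \<bar>fst p - s\<bar>}"

definition mstou_kernel ::
    "real \<Rightarrow> real \<times> (real ^ 'm) \<Rightarrow> real \<times> real \<times> (real ^ 'm) \<Rightarrow> real" where
  "mstou_kernel c p = (\<lambda>(l, s, \<xi>). exp (- l * (fst p - s)) * indicator (ambit_set c p) (s, \<xi>))"

definition c_class_MSTOU ::
    "'w measure \<Rightarrow> ((real \<times> real \<times> (real ^ 'm)) set \<Rightarrow> 'w \<Rightarrow> real) \<Rightarrow>
     real \<Rightarrow> real \<Rightarrow> real measure \<Rightarrow> real measure \<Rightarrow> real \<Rightarrow>
     (real \<times> (real ^ 'm) \<Rightarrow> 'w \<Rightarrow> real) \<Rightarrow> bool" where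
  "c_class_MSTOU M \<Lambda> \<gamma> \<Sigma> \<nu> \<pi> c Y \<longleftrightarrow>
     0 < c \<and> levy_basis M \<Lambda> \<gamma> \<Sigma> \<nu> \<pi> \<and>
     set_integrable \<nu> {x. \<bar>x\<bar> > 1} (\<lambda>x. x\<^sup>2) \<and>
     (\<exists>f \<in> borel_measurable borel. (\<forall>l. 0 \<le> f l) \<and> (\<forall>l\<le>0. f l = 0) \<and>
        \<pi> = density lborel (\<lambda>l. ennreal (f l)) \<and>
        set_integrable lborel {0<..} (\<lambda>l. l powr (- (real CARD('m) + 1)) * f l)) \<and>
     (\<forall>p. has_levy_integral M \<Lambda> \<pi> levy_space (mstou_kernel c p) (Y p))"

definition gamma_density :: "real \<Rightarrow> real \<Rightarrow> real \<Rightarrow> real" where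
  "gamma_density \<alpha> \<beta> l =
     (if 0 < l then \<beta> powr \<alpha> / Gamma \<alpha> * l powr (\<alpha> - 1) * exp (- \<beta> * l) else 0)"

subsection \<open>\<open>\<theta>\<close>-lex-weak dependence\<close>

definition lex_less ::
    "real \<times> (real ^ 'm::{finite,linorder}) \<Rightarrow> real \<times> (real ^ 'm::{finite,linorder}) \<Rightarrow> bool" where
  "lex_less p q \<longleftrightarrow>
     fst p < fst q \<or>
     (fst p = fst q \<and> (\<exists>i. snd p $ i < snd q $ i \<and> (\<forall>j<i. snd p $ j = snd q $ j)))"

text \<open>\<open>infnorm\<close> on the product space is the maximum norm on \<open>m + 1\<close> coordinates.\<close>

definition lex_past ::
    "real \<times> (real ^ 'm::{finite,linorder}) \<Rightarrow> real \<Rightarrow> (real \<times> (real ^ 'm::{finite,linorder})) set" where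
  "lex_past p h = {q. (lex_less q p \<or> q = p) \<and> h \<le> infnorm (p - q)}"

definition covariance :: "'w measure \<Rightarrow> ('w \<Rightarrow> real) \<Rightarrow> ('w \<Rightarrow> real) \<Rightarrow> real" where
  "covariance M X Z =
     (\<integral>\<omega>. (X \<omega> - (\<integral>\<omega>'. X \<omega>' \<partial>M)) * (Z \<omega> - (\<integral>\<omega>'. Z \<omega>' \<partial>M)) \<partial>M)"

definition sup_norm_on :: "'a set \<Rightarrow> ('a \<Rightarrow> real) \<Rightarrow> real" where
  "sup_norm_on S F = (SUP x\<in>S. \<bar>F x\<bar>)"

definition Lip :: "(real \<Rightarrow> real) \<Rightarrow> real" where
  "Lip G = Sup {\<bar>G x - G y\<bar> / \<bar>x - y\<bar> | x y. x \<noteq> y}"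

text \<open>
  A set of \<open>u\<close> points is given by an injective enumeration \<open>q\<close> on \<open>{..<u}\<close>, and functions
  on \<open>u\<close>-dimensional space live on the product measurable space over \<open>{..<u}\<close>. The
  suprema are taken in \<open>ennreal\<close>, so no finiteness is presupposed.
\<close>

definition theta_lex_u ::
    "'w measure \<Rightarrow> (real \<times> (real ^ 'm::{finite,linorder}) \<Rightarrow> 'w \<Rightarrow> real) \<Rightarrow>
     nat \<Rightarrow> real \<Rightarrow> ennreal" where
  "theta_lex_u M Y u h =
     Sup {ennreal (\<bar>covariance M (\<lambda>\<omega>. F (\<lambda>i\<in>{..<u}. Y (q i) \<omega>)) (\<lambda>\<omega>. G (Y p \<omega>))\<bar>
              / (sup_norm_on (space (\<Pi>\<^sub>M i\<in>{..<u}. borel)) F * Lip G)) | F G p q.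
            F \<in> borel_measurable (\<Pi>\<^sub>M i\<in>{..<u}. (borel :: real measure)) \<and>
            bounded (F ` space (\<Pi>\<^sub>M i\<in>{..<u}. (borel :: real measure))) \<and>
            bounded (range G) \<and> (\<exists>L. L-lipschitz_on UNIV G) \<and>
            sup_norm_on (space (\<Pi>\<^sub>M i\<in>{..<u}. borel)) F * Lip G \<noteq> 0 \<and>
            inj_on q {..<u} \<and> q ` {..<u} \<subseteq> lex_past p h}"

definition theta_lex ::
    "'w measure \<Rightarrow> (real \<times> (real ^ 'm::{finite,linorder}) \<Rightarrow> 'w \<Rightarrow> real) \<Rightarrow> real \<Rightarrow> ennreal" where
  "theta_lex M Y h = (SUP u\<in>{1..}. theta_lex_u M Y u h)"

definition theta_lex_weakly_dependent ::
    "'w measure \<Rightarrow> (real \<times> (real ^ 'm::{finite,linorder}) \<Rightarrow> 'w \<Rightarrow> real) \<Rightarrow> bool" where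
  "theta_lex_weakly_dependent M Y \<longleftrightarrow> (theta_lex M Y \<longlongrightarrow> 0) at_top"

end

theory Submission
  imports Defs
begin

text \<open>
  The field is truncated in time. If \<open>q\<close> lies in the lexicographic past of \<open>p = (t, x)\<close> at maximum
  distance at least \<open>h\<close>, the ambit sets of \<open>p\<close> and \<open>q\<close> meet only at times \<open>s \<le> t - r\<close>, where
  \<open>r = \<psi> h\<close> if \<open>c \<le> 1\<close> and \<open>r = \<psi> h / c\<close> if \<open>c > 1\<close>: either the times of \<open>p\<close> and \<open>q\<close> are \<open>h\<close> apart,
  or a spatial gap of length \<open>h\<close> has to be bridged by two cones of slope \<open>c\<close> (\<open>ambit_overlap_far\<close>,
  \<open>truncation_radius\<close>). So the part of \<open>Y p\<close> that is collected at times later than \<open>t - r\<close> is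
  independent of the field on the past, and only the far part, collected before, contributes to
  the covariance: its modulus is at most \<open>2 * \<parallel>F\<parallel> * Lip G * E \<bar>far part\<bar>\<close> (\<open>covariance_bound\<close>).

  The expectation is at most the square root of \<open>\<Sigma>\<^sub>\<Lambda> * \<integral> f\<^sup>2\<close> for a centred basis
  (\<open>moment_bound_centered\<close>) and at most \<open>\<gamma>\<^sub>a\<^sub>b\<^sub>s * \<integral> f\<close> for a basis of finite variation
  (\<open>moment_bound_finite_variation\<close>), \<open>f\<close> being the kernel on the far set. The integrals of \<open>f\<close> and
  \<open>f\<^sup>2\<close> are explicit: the ambit set has slices of volume \<open>V * (t - s) ^ m\<close>, the time integral is an
  incomplete gamma function, that is a polynomial times an exponential, and the integral over the
  mean reversion rate turns each monomial into a Gamma value (\<open>mstou_kernel_power_integral\<close>).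
  Estimating \<open>k * r + \<beta>\<close> from below by \<open>k * r\<close> there yields the rate \<open>r powr (m + 1 - \<alpha>)\<close>.

  The stochastic integral is given by some sequence of simple functions that converges almost
  everywhere and whose integrals converge in probability over each Borel set. Such a sequence need
  not be dominated by the kernel, be supported in the ambit set or have bounded moments, so
  neither independence nor moment bounds can be read off it. The bridge is uniqueness: if simple
  functions tend to \<open>0\<close> almost everywhere and their integrals converge over each Borel set, the
  integrals tend to \<open>0\<close> (\<open>uniqueness_char\<close>, a sliding hump argument). Hence every integral is also the
  limit of the integrals of simple functions increasing to the kernel (\<open>integral_limit_of_simple\<close>),
  and these have the support and the moments that the argument needs.

  The first moment in the case of finite variation comes from characteristic functions as well:
  \<open>\<bar>x\<bar>\<close> is a constant multiple of \<open>\<integral> (1 - cos (u * x)) / u\<^sup>2\<close> over \<open>u > 0\<close>. For a set of small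
  control measure this gives the bound up to an error of smaller order, and every bounded set can
  be cut into arbitrarily small time slices.
\<close>

section \<open>The Levy exponent under a second moment\<close>

lemma norm_iexp_minus_1_le: "norm (iexp x - 1) \<le> \<bar>x\<bar>"
  using iexp_approx1[of x 0] by simp

lemma norm_iexp_minus_1_minus_le: "norm (iexp x - 1 - \<i> * of_real x) \<le> x\<^sup>2 / 2"
  using iexp_approx1[of x 1] by (simp add: power2_eq_square algebra_simps)

text \<open>
  The second moment of the large jumps is part of the definition of a \<open>c\<close>-class process, and it makes
  \<open>x\<^sup>2\<close> integrable for the Levy measure. All of the analysis of the integral takes place under this
  assumption.
\<close>

locale square_integrable_levy_basis = prob_space M
  for M :: "'w measure" +
  fixes \<Lambda> :: "(real \<times> real \<times> (real ^ 'm)) set \<Rightarrow> 'w \<Rightarrow> real"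
    and \<gamma> \<Sigma> :: real and \<nu> \<pi> :: "real measure"
  assumes basis: "levy_basis M \<Lambda> \<gamma> \<Sigma> \<nu> \<pi>"
    and tail: "set_integrable \<nu> {x. \<bar>x\<bar> > 1} (\<lambda>x. x\<^sup>2)"
begin

abbreviation control :: "(real \<times> real \<times> (real ^ 'm)) measure" where
  "control \<equiv> \<pi> \<Otimes>\<^sub>M lborel"

abbreviation exponent :: "real \<Rightarrow> complex" where
  "exponent \<equiv> levy_exponent \<gamma> \<Sigma> \<nu>"

lemma Sigma_nonneg: "0 \<le> \<Sigma>"
  and sets_nu [measurable_cong, simp]: "sets \<nu> = sets borel"
  and sets_pi [measurable_cong, simp]: "sets \<pi> = sets borel"
  and prob_space_pi: "prob_space \<pi>"
  and pi_nonpos: "emeasure \<pi> {..0} = 0"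
  and nu_zero: "emeasure \<nu> {0} = 0"
  and nu_min: "(\<integral>\<^sup>+ x. ennreal (min 1 (x\<^sup>2)) \<partial>\<nu>) < \<infinity>"
  using basis by (auto simp: levy_basis_def characteristic_quadruplet_def levy_measure_def)

lemma space_nu [simp]: "space \<nu> = UNIV"
  using sets_eq_imp_space_eq[OF sets_nu] by simp

lemma space_pi [simp]: "space \<pi> = UNIV"
  using sets_eq_imp_space_eq[OF sets_pi] by simp

lemma integrable_square_nu: "integrable \<nu> (\<lambda>x. x\<^sup>2)"
proof -
  have a: "integrable \<nu> (\<lambda>x. min 1 (x\<^sup>2))"
    using nu_min by (intro integrableI_bounded) auto
  have b: "integrable \<nu> (\<lambda>x. indicator {x. \<bar>x\<bar> > 1} x *\<^sub>R x\<^sup>2)"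
    using tail by (simp add: set_integrable_def)
  show ?thesis
  proof (rule Bochner_Integration.integrable_bound[OF Bochner_Integration.integrable_add[OF a b]])
    show "AE x in \<nu>. norm (x\<^sup>2) \<le> norm (min 1 (x\<^sup>2) + indicator {x. \<bar>x\<bar> > 1} x *\<^sub>R x\<^sup>2)"
    proof (intro AE_I2)
      fix x :: real
      show "norm (x\<^sup>2) \<le> norm (min 1 (x\<^sup>2) + indicator {x. \<bar>x\<bar> > 1} x *\<^sub>R x\<^sup>2)"
        using abs_square_le_1[of x] by (auto simp: indicator_def min_def)
    qed
  qed simp
qed

lemma integrable_nu_of_square_bound:
  fixes f :: "real \<Rightarrow> 'b::{banach, second_countable_topology}"
  assumes [measurable]: "f \<in> borel_measurable borel" and "\<And>x. norm (f x) \<le> K * x\<^sup>2"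
  shows "integrable \<nu> f"
proof (rule Bochner_Integration.integrable_bound)
  show "integrable \<nu> (\<lambda>x. K * x\<^sup>2)" using integrable_square_nu by simp
  show "f \<in> borel_measurable \<nu>" by measurable
  show "AE x in \<nu>. norm (f x) \<le> norm (K * x\<^sup>2)"
    using assms(2) by (intro AE_I2) (metis abs_ge_self order_trans real_norm_def)
qed

lemma compensated_integrand_le:
  "norm (iexp (u * x) - 1 - \<i> * of_real (u * x * indicator {0..1} \<bar>x\<bar>)) \<le> (\<bar>u\<bar> + u\<^sup>2) * x\<^sup>2"
proof (cases "\<bar>x\<bar> \<le> 1")
  case True
  then have "norm (iexp (u * x) - 1 - \<i> * of_real (u * x * indicator {0..1} \<bar>x\<bar>)) \<le> (u * x)\<^sup>2 / 2"
    using norm_iexp_minus_1_minus_le[of "u * x"] by simp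
  also have "\<dots> \<le> u\<^sup>2 * x\<^sup>2" by (simp add: power_mult_distrib)
  also have "\<dots> \<le> (\<bar>u\<bar> + u\<^sup>2) * x\<^sup>2" by (intro mult_right_mono) auto
  finally show ?thesis .
next
  case False
  then have "norm (iexp (u * x) - 1 - \<i> * of_real (u * x * indicator {0..1} \<bar>x\<bar>)) \<le> \<bar>u\<bar> * \<bar>x\<bar>"
    using norm_iexp_minus_1_le[of "u * x"] by (simp add: abs_mult)
  also have "\<dots> \<le> \<bar>u\<bar> * x\<^sup>2"
    using False mult_right_mono[of 1 "\<bar>x\<bar>" "\<bar>x\<bar>"]
    by (intro mult_left_mono) (auto simp: power2_eq_square)
  also have "\<dots> \<le> (\<bar>u\<bar> + u\<^sup>2) * x\<^sup>2" by (intro mult_right_mono) auto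
  finally show ?thesis .
qed

lemma integrable_compensated:
  "complex_integrable \<nu> (\<lambda>x. iexp (u * x) - 1 - \<i> * of_real (u * x * indicator {0..1} \<bar>x\<bar>))"
  by (rule integrable_nu_of_square_bound[OF _ compensated_integrand_le]) measurable

lemma exponent_0 [simp]: "exponent 0 = 0"
  by (simp add: levy_exponent_def)

text \<open>
  This growth bound takes over the role of the control function of Rajput and Rosinski: a simple
  function that is small in \<open>L\<^sup>1\<close> and in \<open>L\<^sup>2\<close> has an integral that is small in probability.
\<close>

lemma exponent_bound: "\<exists>C\<ge>0. \<forall>u. norm (exponent u) \<le> C * (\<bar>u\<bar> + u\<^sup>2)"
proof -
  define C where "C = \<bar>\<gamma>\<bar> + \<bar>\<Sigma>\<bar> + (\<integral>x. x\<^sup>2 \<partial>\<nu>)"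
  have nn: "0 \<le> (\<integral>x. x\<^sup>2 \<partial>\<nu>)" by simp
  have "norm (exponent u) \<le> C * (\<bar>u\<bar> + u\<^sup>2)" for u
  proof -
    have "norm (CLINT x|\<nu>. iexp (u * x) - 1 - \<i> * of_real (u * x * indicator {0..1} \<bar>x\<bar>))
        \<le> (\<integral>x. (\<bar>u\<bar> + u\<^sup>2) * x\<^sup>2 \<partial>\<nu>)"
      by (rule Bochner_Integration.integral_norm_bound_integral[OF integrable_compensated])
         (use integrable_square_nu compensated_integrand_le in auto)
    then have c: "norm (CLINT x|\<nu>. iexp (u * x) - 1 - \<i> * of_real (u * x * indicator {0..1} \<bar>x\<bar>))
        \<le> (\<bar>u\<bar> + u\<^sup>2) * (\<integral>x. x\<^sup>2 \<partial>\<nu>)" by simp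
    have a: "norm (\<i> * complex_of_real (\<gamma> * u)) = \<bar>\<gamma>\<bar> * \<bar>u\<bar>" by (simp add: norm_mult)
    have b: "norm (complex_of_real (\<Sigma> * u\<^sup>2 / 2)) = \<bar>\<Sigma>\<bar> * u\<^sup>2 / 2"
      by (simp add: norm_mult norm_divide norm_power)
    have "norm (exponent u) \<le> \<bar>\<gamma>\<bar> * \<bar>u\<bar> + \<bar>\<Sigma>\<bar> * u\<^sup>2 / 2 + (\<bar>u\<bar> + u\<^sup>2) * (\<integral>x. x\<^sup>2 \<partial>\<nu>)"
      unfolding levy_exponent_def
      by (intro norm_triangle_mono norm_triangle_le_diff c) (use a b in auto)
    also have "\<dots> \<le> \<bar>\<gamma>\<bar> * (\<bar>u\<bar> + u\<^sup>2) + \<bar>\<Sigma>\<bar> * (\<bar>u\<bar> + u\<^sup>2) + (\<integral>x. x\<^sup>2 \<partial>\<nu>) * (\<bar>u\<bar> + u\<^sup>2)"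
    proof -
      have "\<bar>\<Sigma>\<bar> * u\<^sup>2 / 2 \<le> \<bar>\<Sigma>\<bar> * (\<bar>u\<bar> + u\<^sup>2)"
        by (simp add: distrib_left add_increasing)
      moreover have "\<bar>\<gamma>\<bar> * \<bar>u\<bar> \<le> \<bar>\<gamma>\<bar> * (\<bar>u\<bar> + u\<^sup>2)" by (intro mult_left_mono) auto
      ultimately show ?thesis by (simp add: mult.commute)
    qed
    finally show ?thesis by (simp add: C_def algebra_simps)
  qed
  moreover have "0 \<le> C" using nn by (simp add: C_def)
  ultimately show ?thesis by blast
qed

lemma Re_exponent:
  "Re (exponent u) = - (\<Sigma> * u\<^sup>2 / 2) - (\<integral>x. 1 - cos (u * x) \<partial>\<nu>)"
proof -
  have "Re (CLINT x|\<nu>. iexp (u * x) - 1 - \<i> * of_real (u * x * indicator {0..1} \<bar>x\<bar>))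
      = (\<integral>x. - (1 - cos (u * x)) \<partial>\<nu>)"
    by (subst integral_Re[OF integrable_compensated, symmetric])
       (auto intro!: Bochner_Integration.integral_cong simp: Re_exp)
  then show ?thesis
    by (simp only: levy_exponent_def Bochner_Integration.integral_minus) simp
qed

lemma Re_exponent_nonpos: "Re (exponent u) \<le> 0"
proof -
  have "0 \<le> (\<integral>x. 1 - cos (u * x) \<partial>\<nu>)" by (rule Bochner_Integration.integral_nonneg) simp
  moreover have "0 \<le> \<Sigma> * u\<^sup>2 / 2" using Sigma_nonneg by simp
  ultimately show ?thesis unfolding Re_exponent by linarith
qed

end

section \<open>Integrals of simple functions\<close>

context square_integrable_levy_basis
begin

abbreviation simple_int :: "(real \<times> real \<times> (real ^ 'm) \<Rightarrow> real) \<Rightarrow> 'w \<Rightarrow> real" where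
  "simple_int g \<equiv> levy_simple_integral \<Lambda> UNIV g"

lemma sets_control [measurable_cong, simp]: "sets control = sets borel"
proof -
  have "sets control = sets (borel \<Otimes>\<^sub>M borel :: (real \<times> real \<times> (real ^ 'm)) measure)"
    by (intro sets_pair_measure_cong) auto
  then show ?thesis by (simp only: borel_prod)
qed

lemma space_control [simp]: "space control = UNIV"
  using sets_eq_imp_space_eq[OF sets_control] by simp

lemma bounded_borel_subset:
  "A \<in> bounded_borel_sets \<Longrightarrow> B \<in> sets borel \<Longrightarrow> B \<subseteq> A \<Longrightarrow> B \<in> bounded_borel_sets"
  unfolding bounded_borel_sets_def using bounded_subset by blast

lemma empty_bounded_borel: "{} \<in> bounded_borel_sets"
  by (simp add: bounded_borel_sets_def)

lemma finite_UN_bounded_borel: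
  "finite J \<Longrightarrow> (\<And>j. j \<in> J \<Longrightarrow> C j \<in> bounded_borel_sets) \<Longrightarrow> (\<Union>j\<in>J. C j) \<in> bounded_borel_sets"
  unfolding bounded_borel_sets_def by auto

lemma measurable_Lambda [measurable]: "B \<in> bounded_borel_sets \<Longrightarrow> \<Lambda> B \<in> borel_measurable M"
  using basis by (auto simp: levy_basis_def)

lemma char_Lambda:
  "B \<in> bounded_borel_sets \<Longrightarrow>
    char (distr M borel (\<Lambda> B)) u = exp (exponent u * of_real (measure control B))"
  using basis by (auto simp: levy_basis_def)

lemma emeasure_control_bounded_borel:
  assumes "B \<in> bounded_borel_sets"
  shows "emeasure control B < \<infinity>"
proof -
  interpret P: prob_space \<pi> by (rule prob_space_pi)
  have "bounded (snd ` B)" using assms by (auto simp: bounded_borel_sets_def intro: bounded_snd)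
  then obtain R where R: "snd ` B \<subseteq> cball 0 R"
    using bounded_subset_ballD[of "snd ` B" 0] by (meson ball_subset_cball order_trans)
  have "emeasure control B \<le> emeasure control (UNIV \<times> cball 0 R)"
    using R by (intro emeasure_mono) (auto simp: image_subset_iff)
  also have "\<dots> = emeasure \<pi> UNIV * emeasure lborel (cball 0 R :: (real \<times> (real ^ 'm)) set)"
    by (intro lborel.emeasure_pair_measure_Times) auto
  also have "\<dots> < \<infinity>"
    using P.emeasure_space_1 emeasure_bounded_finite[OF bounded_cball, of "0 :: real \<times> (real ^ 'm)" R] by simp
  finally show ?thesis .
qed

lemma Lambda_sums:
  assumes "range B \<subseteq> bounded_borel_sets" "disjoint_family B" "(\<Union>n. B n) \<in> bounded_borel_sets"
  shows "AE \<omega> in M. (\<lambda>n::nat. \<Lambda> (B n) \<omega>) sums \<Lambda> (\<Union>n. B n) \<omega>"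
  using basis assms unfolding levy_basis_def by blast

text \<open>
  Additivity over the constant sequence of empty sets makes a constant series converge.
\<close>

lemma Lambda_empty: "AE \<omega> in M. \<Lambda> {} \<omega> = 0"
proof -
  have "AE \<omega> in M. (\<lambda>n::nat. \<Lambda> {} \<omega>) sums \<Lambda> {} \<omega>"
    using Lambda_sums[of "\<lambda>_. {}"] empty_bounded_borel by (auto simp: disjoint_family_on_def)
  then show ?thesis
    by (rule AE_mp) (auto intro!: AE_I2 simp: sums_iff dest: summable_LIMSEQ_zero simp: LIMSEQ_const_iff)
qed

text \<open>
  The axioms of a basis speak of sequences of sets; a finite family is padded with empty sets.
\<close>

lemma enumerate_disjoint:
  fixes C :: "'j \<Rightarrow> (real \<times> real \<times> (real ^ 'm)) set"
  assumes "finite J" "\<And>j. j \<in> J \<Longrightarrow> C j \<in> bounded_borel_sets" "disjoint_family_on C J"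
  obtains B e where "bij_betw e {..<card J} J" "range B \<subseteq> bounded_borel_sets" "disjoint_family B"
    "\<And>n. n < card J \<Longrightarrow> B n = C (e n)" "\<And>n. n \<ge> card J \<Longrightarrow> B n = {}" "(\<Union>n. B n) = (\<Union>j\<in>J. C j)"
proof -
  obtain e where e: "bij_betw e {..<card J} J"
    using ex_bij_betw_nat_finite[OF assms(1)] by (auto simp: lessThan_atLeast0)
  define B where "B n = (if n < card J then C (e n) else {})" for n
  have eJ: "n < card J \<Longrightarrow> e n \<in> J" for n using e by (auto simp: bij_betw_def)
  have "disjoint_family B"
    unfolding disjoint_family_on_def
  proof safe
    fix k l z assume kl: "k \<noteq> l" "z \<in> B k" "z \<in> B l"
    then have "k < card J" "l < card J" by (auto simp: B_def split: if_splits)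
    then show "z \<in> {}"
      using kl e assms(3) eJ unfolding B_def disjoint_family_on_def bij_betw_def inj_on_def
      by (metis IntI lessThan_iff)
  qed
  moreover have "(\<Union>n. B n) = (\<Union>j\<in>J. C j)"
  proof -
    have "(\<Union>n. B n) = (\<Union>j\<in>e ` {..<card J}. C j)"
      by (auto simp: B_def split: if_splits)
    then show ?thesis unfolding bij_betw_imp_surj_on[OF e] .
  qed
  ultimately show ?thesis
    using assms(2) empty_bounded_borel eJ e by (intro that[of e B]) (auto simp: B_def)
qed

lemma Lambda_finite_Union:
  assumes "finite J" "\<And>j. j \<in> J \<Longrightarrow> C j \<in> bounded_borel_sets" "disjoint_family_on C J"
  shows "AE \<omega> in M. \<Lambda> (\<Union>j\<in>J. C j) \<omega> = (\<Sum>j\<in>J. \<Lambda> (C j) \<omega>)"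
proof -
  obtain B e where e: "bij_betw e {..<card J} J" and B: "range B \<subseteq> bounded_borel_sets" "disjoint_family B"
    and BC: "\<And>n. n < card J \<Longrightarrow> B n = C (e n)" and B0: "\<And>n. n \<ge> card J \<Longrightarrow> B n = {}"
    and U: "(\<Union>n. B n) = (\<Union>j\<in>J. C j)"
    by (rule enumerate_disjoint[OF assms]) (assumption, rule that)
  have "AE \<omega> in M. (\<lambda>n. \<Lambda> (B n) \<omega>) sums \<Lambda> (\<Union>n. B n) \<omega>"
    using Lambda_sums[OF B] U finite_UN_bounded_borel[of J C] assms(1,2) by simp
  with Lambda_empty show ?thesis
  proof eventually_elim
    case (elim \<omega>)
    have "(\<lambda>n. \<Lambda> (B n) \<omega>) sums (\<Sum>n<card J. \<Lambda> (B n) \<omega>)"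
      using elim(1) B0 by (intro sums_finite) auto
    with elim(2) have "\<Lambda> (\<Union>n. B n) \<omega> = (\<Sum>n<card J. \<Lambda> (C (e n)) \<omega>)"
      using BC by (simp add: sums_iff)
    also have "\<dots> = (\<Sum>j\<in>J. \<Lambda> (C j) \<omega>)"
      using e by (rule sum.reindex_bij_betw)
    finally show ?case using U by simp
  qed
qed

lemma indep_vars_reindex_inj:
  assumes ind: "indep_vars (\<lambda>_. N) X (e ` I)" and inj: "inj_on e I"
  shows "indep_vars (\<lambda>_. N) (\<lambda>i. X (e i)) I"
  unfolding indep_vars_def2 indep_sets_def
proof (intro conjI ballI allI impI)
  fix i assume "i \<in> I"
  then show "random_variable N (X (e i))" "{X (e i) -` A \<inter> space M |A. A \<in> sets N} \<subseteq> events"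
    using ind by (auto simp: indep_vars_def2)
next
  fix K A assume K: "K \<subseteq> I" "K \<noteq> {}" "finite K"
    and A: "A \<in> (\<Pi> i\<in>K. {X (e i) -` A \<inter> space M |A. A \<in> sets N})"
  have inv: "i \<in> K \<Longrightarrow> inv_into I e (e i) = i" for i using inj K by (auto simp: inv_into_f_f)
  define A' where "A' k = A (inv_into I e k)" for k
  have A'e: "i \<in> K \<Longrightarrow> A' (e i) = A i" for i by (simp add: A'_def inv)
  have "prob (\<Inter>k\<in>e`K. A' k) = (\<Prod>k\<in>e`K. prob (A' k))"
  proof (rule indep_setsD[where F="\<lambda>i. {X i -` A \<inter> space M |A. A \<in> sets N}"])
    show "indep_sets (\<lambda>i. {X i -` A \<inter> space M |A. A \<in> sets N}) (e ` I)"
      using ind by (simp add: indep_vars_def2)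
    show "\<forall>k\<in>e ` K. A' k \<in> {X k -` A \<inter> space M |A. A \<in> sets N}"
      using A A'e by (auto simp: Pi_iff)
  qed (use K in auto)
  moreover have "(\<Inter>k\<in>e`K. A' k) = (\<Inter>i\<in>K. A i)" using A'e by auto
  moreover have "(\<Prod>k\<in>e`K. prob (A' k)) = (\<Prod>i\<in>K. prob (A i))"
    using inj_on_subset[OF inj K(1)] A'e by (simp add: prod.reindex)
  ultimately show "prob (\<Inter>i\<in>K. A i) = (\<Prod>i\<in>K. prob (A i))" by simp
qed

lemma indep_vars_Lambda:
  assumes "finite J" "\<And>j. j \<in> J \<Longrightarrow> C j \<in> bounded_borel_sets" "disjoint_family_on C J"
  shows "indep_vars (\<lambda>_. borel) (\<lambda>j. \<Lambda> (C j)) J"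
proof -
  obtain B e where e: "bij_betw e {..<card J} J" and B: "range B \<subseteq> bounded_borel_sets" "disjoint_family B"
    and BC: "\<And>n. n < card J \<Longrightarrow> B n = C (e n)" and "\<And>n. n \<ge> card J \<Longrightarrow> B n = {}"
    and "(\<Union>n. B n) = (\<Union>j\<in>J. C j)"
    by (rule enumerate_disjoint[OF assms]) (assumption, rule that)
  define d where "d = inv_into {..<card J} e"
  have d: "bij_betw d J {..<card J}" unfolding d_def by (rule bij_betw_inv_into[OF e])
  have ed: "j \<in> J \<Longrightarrow> e (d j) = j" for j unfolding d_def using e by (simp add: bij_betw_inv_into_right)
  have "indep_vars (\<lambda>_. borel) (\<lambda>n. \<Lambda> (B n)) UNIV"
    using basis B by (simp add: levy_basis_def)
  then have "indep_vars (\<lambda>_. borel) (\<lambda>n. \<Lambda> (B n)) (d ` J)"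
    by (rule indep_vars_subset) auto
  then have "indep_vars (\<lambda>_. borel) (\<lambda>j. \<Lambda> (B (d j))) J"
    by (rule indep_vars_reindex_inj) (use d in \<open>simp add: bij_betw_def\<close>)
  moreover have "\<Lambda> (B (d j)) = \<Lambda> (C j)" if "j \<in> J" for j
    using BC[of "d j"] bij_betw_apply[OF d that] ed[OF that] by simp
  ultimately show ?thesis
    by (subst indep_vars_cong[OF refl, where Y="\<lambda>j. \<Lambda> (B (d j))"]) auto
qed

lemma levy_simpleD:
  assumes "levy_simple g"
  shows levy_simple_measurable: "g \<in> borel_measurable borel"
    and levy_simple_finite: "finite (range g)"
    and levy_simple_support: "{z. g z \<noteq> 0} \<in> bounded_borel_sets"
    and levy_simple_vimage: "y \<noteq> 0 \<Longrightarrow> g -` {y} \<in> bounded_borel_sets"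
proof -
  show *: "g \<in> borel_measurable borel" "finite (range g)" "{z. g z \<noteq> 0} \<in> bounded_borel_sets"
    using assms by (auto simp: levy_simple_def)
  have "g -` {y} \<in> sets borel" using measurable_sets[OF *(1), of "{y}"] by simp
  then show "y \<noteq> 0 \<Longrightarrow> g -` {y} \<in> bounded_borel_sets"
    by (rule bounded_borel_subset[OF *(3)]) auto
qed

lemma levy_simpleI:
  assumes [measurable]: "g \<in> borel_measurable borel" and "finite (range g)"
    and "B \<in> bounded_borel_sets" "\<And>z. z \<notin> B \<Longrightarrow> g z = 0"
  shows "levy_simple g"
proof -
  have "{z \<in> space borel. g z \<noteq> 0} \<in> sets borel" by measurable
  then have "{z. g z \<noteq> 0} \<in> bounded_borel_sets"
    using assms(4) by (intro bounded_borel_subset[OF assms(3)]) auto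
  then show ?thesis using assms by (simp add: levy_simple_def)
qed

lemma levy_simple_diff:
  assumes "levy_simple g" "levy_simple h"
  shows "levy_simple (\<lambda>z. g z - h z)"
proof (rule levy_simpleI[of _ "{z. g z \<noteq> 0} \<union> {z. h z \<noteq> 0}"])
  show "(\<lambda>z. g z - h z) \<in> borel_measurable borel"
    using assms[THEN levy_simple_measurable] by measurable
  have "range (\<lambda>z. g z - h z) \<subseteq> (\<lambda>(a, b). a - b) ` (range g \<times> range h)" by auto
  then show "finite (range (\<lambda>z. g z - h z))"
    using assms[THEN levy_simple_finite] by (meson finite_SigmaI finite_imageI finite_subset)
  show "{z. g z \<noteq> 0} \<union> {z. h z \<noteq> 0} \<in> bounded_borel_sets"
    using assms[THEN levy_simple_support] by (auto simp: bounded_borel_sets_def)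
qed auto

lemma levy_simple_indicator:
  assumes g: "levy_simple g" and [measurable]: "B \<in> sets borel"
  shows "levy_simple (\<lambda>z. g z * indicator B z)"
proof (rule levy_simpleI[OF _ _ levy_simple_support[OF g]])
  show "(\<lambda>z. g z * indicator B z) \<in> borel_measurable borel"
    using levy_simple_measurable[OF g] by measurable
  have "range (\<lambda>z. g z * indicator B z) \<subseteq> insert 0 (range g)" by (auto simp: indicator_def)
  then show "finite (range (\<lambda>z. g z * indicator B z))"
    using levy_simple_finite[OF g] by (meson finite_insert finite_subset)
qed auto

text \<open>
  The integral of a simple function is defined by its level sets. Additivity allows any finite
  partition on whose cells the function is constant, with repeated values or the value \<open>0\<close>; all
  linearity statements reduce to this.
\<close>

lemma levy_simple_integral_partition:
  assumes J: "finite J" and C: "\<And>j. j \<in> J \<Longrightarrow> C j \<in> bounded_borel_sets"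
    and dis: "disjoint_family_on C J"
    and g: "g = (\<lambda>z. \<Sum>j\<in>J. a j * indicator (C j) z)" and B: "B \<in> sets borel"
  shows "AE \<omega> in M. levy_simple_integral \<Lambda> B g \<omega> = (\<Sum>j\<in>J. a j * \<Lambda> (B \<inter> C j) \<omega>)"
proof -
  have gC: "g z = a j" if "j \<in> J" "z \<in> C j" for j z
  proof -
    have "g z = (\<Sum>i\<in>J. if i = j then a j else 0)"
      unfolding g using that dis
      by (intro sum.cong) (auto simp: disjoint_family_on_def indicator_def)
    then show ?thesis using that J by simp
  qed
  have g0: "\<exists>j\<in>J. z \<in> C j" if "g z \<noteq> 0" for z
  proof (rule ccontr)
    assume "\<not> ?thesis"
    then have "g z = 0" unfolding g by (intro sum.neutral) auto
    with that show False by simp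
  qed
  let ?T = "insert 0 (a ` J)" let ?R = "range g - {0}"
  have RT: "?R \<subseteq> ?T" using g0 gC by fastforce
  have BC: "B \<inter> C j \<in> bounded_borel_sets" if "j \<in> J" for j
    using B C[OF that] by (intro bounded_borel_subset[OF C[OF that]]) (auto simp: bounded_borel_sets_def)
  have "AE \<omega> in M. \<Lambda> (B \<inter> g -` {y}) \<omega> = (\<Sum>j\<in>{j \<in> J. a j = y}. \<Lambda> (B \<inter> C j) \<omega>)" if "y \<in> ?R" for y
  proof -
    have "B \<inter> g -` {y} = (\<Union>j\<in>{j \<in> J. a j = y}. B \<inter> C j)"
    proof (intro equalityI subsetI)
      fix z assume z: "z \<in> B \<inter> g -` {y}"
      with that obtain j where "j \<in> J" "z \<in> C j" using g0[of z] by auto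
      then show "z \<in> (\<Union>j\<in>{j \<in> J. a j = y}. B \<inter> C j)" using z gC[of j z] by auto
    next
      fix z assume "z \<in> (\<Union>j\<in>{j \<in> J. a j = y}. B \<inter> C j)"
      then show "z \<in> B \<inter> g -` {y}" using gC[of _ z] by auto
    qed
    moreover have "disjoint_family_on (\<lambda>j. B \<inter> C j) {j \<in> J. a j = y}"
      using dis by (auto simp: disjoint_family_on_def)
    ultimately show ?thesis
      using Lambda_finite_Union[of "{j \<in> J. a j = y}" "\<lambda>j. B \<inter> C j"] J BC by auto
  qed
  then have "AE \<omega> in M. \<forall>y\<in>?R. \<Lambda> (B \<inter> g -` {y}) \<omega> = (\<Sum>j\<in>{j \<in> J. a j = y}. \<Lambda> (B \<inter> C j) \<omega>)"
    using finite_subset[OF RT] J by (intro AE_finite_allI) auto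
  with Lambda_empty show ?thesis
  proof eventually_elim
    case (elim \<omega>)
    have "levy_simple_integral \<Lambda> B g \<omega> = (\<Sum>y\<in>?R. \<Sum>j\<in>{j \<in> J. a j = y}. a j * \<Lambda> (B \<inter> C j) \<omega>)"
      unfolding levy_simple_integral_def using elim(2)
      by (intro sum.cong) (auto simp: sum_distrib_left intro!: sum.cong)
    also have "\<dots> = (\<Sum>y\<in>?T. \<Sum>j\<in>{j \<in> J. a j = y}. a j * \<Lambda> (B \<inter> C j) \<omega>)"
    proof (rule sum.mono_neutral_left)
      show "\<forall>y\<in>?T - ?R. (\<Sum>j\<in>{j \<in> J. a j = y}. a j * \<Lambda> (B \<inter> C j) \<omega>) = 0"
      proof (intro ballI sum.neutral)
        fix y j assume y: "y \<in> ?T - ?R" and j: "j \<in> {j \<in> J. a j = y}"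
        show "a j * \<Lambda> (B \<inter> C j) \<omega> = 0"
        proof (cases "y = 0")
          case False
          then have "y \<notin> range g" using y by auto
          then have "C j = {}" using gC[of j] j by (metis (mono_tags, lifting) equals0I mem_Collect_eq rangeI)
          then show ?thesis using elim(1) by simp
        qed (use j in simp)
      qed
    qed (use J RT in auto)
    also have "\<dots> = (\<Sum>j\<in>J. a j * \<Lambda> (B \<inter> C j) \<omega>)"
      using J by (intro sum.group) auto
    finally show ?case .
  qed
qed

text \<open>
  The cells are the level sets of the vector of all functions, so they are indexed by the vectors of
  values. Leaving out the zero vector keeps the cells bounded.
\<close>

lemma common_refinement:
  fixes g :: "'i \<Rightarrow> real \<times> real \<times> (real ^ 'm) \<Rightarrow> real"
  assumes I: "finite I" and g: "\<And>i. i \<in> I \<Longrightarrow> levy_simple (g i)"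
  obtains J :: "('i \<Rightarrow> real) set" and C where
    "finite J" "\<And>v. v \<in> J \<Longrightarrow> C v \<in> bounded_borel_sets" "disjoint_family_on C J"
    "\<And>v. v \<in> J \<Longrightarrow> C v \<noteq> {}" "\<And>v z i. v \<in> J \<Longrightarrow> z \<in> C v \<Longrightarrow> i \<in> I \<Longrightarrow> g i z = v i"
    "\<And>i. i \<in> I \<Longrightarrow> g i = (\<lambda>z. \<Sum>v\<in>J. v i * indicator (C v) z)"
proof -
  define T where "T z i = (if i \<in> I then g i z else 0)" for z i
  define J where "J = range T - {\<lambda>_. 0}"
  define C where "C v = T -` {v}" for v
  have "range T \<subseteq> (\<lambda>w i. if i \<in> I then w i else 0) ` (Pi\<^sub>E I (\<lambda>i. range (g i)))"
  proof safe
    fix z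
    show "T z \<in> (\<lambda>w i. if i \<in> I then w i else 0) ` (Pi\<^sub>E I (\<lambda>i. range (g i)))"
      by (rule image_eqI[of _ _ "\<lambda>i\<in>I. g i z"]) (auto simp: T_def fun_eq_iff)
  qed
  then have "finite (range T)"
    using I g levy_simple_finite by (meson finite_PiE finite_imageI finite_subset)
  then have fJ: "finite J" by (simp add: J_def)
  have Cb: "C v \<in> bounded_borel_sets" if v: "v \<in> J" for v
  proof -
    have vI: "v i = 0" if "i \<notin> I" for i using v that by (auto simp: J_def T_def)
    then obtain i where i: "i \<in> I" "v i \<noteq> 0" using v by (fastforce simp: J_def)
    have "C v = (\<Inter>i\<in>I. g i -` {v i})"
      using vI by (fastforce simp: C_def T_def fun_eq_iff split: if_splits)
    moreover have "g i -` {v i} \<in> sets borel" if "i \<in> I" for i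
      using measurable_sets[OF levy_simple_measurable[OF g[OF that]], of "{v i}"] by simp
    ultimately have "C v \<in> sets borel" using I i by (auto intro!: sets.finite_INT)
    then show ?thesis
      using i by (intro bounded_borel_subset[OF levy_simple_support[OF g[OF i(1)]]]) (auto simp: C_def T_def)
  qed
  have dis: "disjoint_family_on C J" by (auto simp: disjoint_family_on_def C_def)
  have ne: "C v \<noteq> {}" if "v \<in> J" for v using that by (auto simp: J_def C_def)
  have val: "g i z = v i" if "z \<in> C v" "i \<in> I" for v z i using that by (auto simp: C_def T_def)
  have "g i = (\<lambda>z. \<Sum>v\<in>J. v i * indicator (C v) z)" if i: "i \<in> I" for i
  proof
    fix z
    have "(\<Sum>v\<in>J. v i * indicator (C v) z) = (\<Sum>v\<in>J. if v = T z then T z i else 0)"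
      by (intro sum.cong) (auto simp: C_def indicator_def)
    also have "\<dots> = (if T z \<in> J then T z i else 0)" using fJ by simp
    also have "\<dots> = T z i" using fun_cong[of "T z" "\<lambda>_. 0" i] by (auto simp: J_def)
    also have "\<dots> = g i z" using i by (simp add: T_def)
    finally show "g i z = (\<Sum>v\<in>J. v i * indicator (C v) z)" by simp
  qed
  then show ?thesis using fJ Cb dis ne val that[of J C] by blast
qed

lemma simple_int_diff:
  assumes "levy_simple g" "levy_simple h"
  shows "AE \<omega> in M. simple_int (\<lambda>z. g z - h z) \<omega> = simple_int g \<omega> - simple_int h \<omega>"
proof -
  define k where "k b = (if b then g else h)" for b
  obtain J C where J: "finite J" "\<And>v. v \<in> J \<Longrightarrow> C v \<in> bounded_borel_sets" "disjoint_family_on C J"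
    and k: "\<And>b. k b = (\<lambda>z. \<Sum>v\<in>J. v b * indicator (C v) z)"
    by (rule common_refinement[of UNIV k]) (use assms in \<open>auto simp: k_def\<close>)
  have part: "AE \<omega> in M. simple_int k \<omega> = (\<Sum>v\<in>J. a v * \<Lambda> (UNIV \<inter> C v) \<omega>)"
    if "k = (\<lambda>z. \<Sum>v\<in>J. a v * indicator (C v) z)" for k a
    by (rule levy_simple_integral_partition[OF J that]) auto
  have "(\<lambda>z. g z - h z) = (\<lambda>z. \<Sum>v\<in>J. (v True - v False) * indicator (C v) z)"
    using k[of True] k[of False] by (auto simp: k_def sum_subtractf left_diff_distrib)
  from part[OF this] part[OF k[of True]] part[OF k[of False]]
  show ?thesis
    by eventually_elim (simp add: k_def sum_subtractf left_diff_distrib)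
qed

lemma levy_simple_as_sum:
  assumes "levy_simple g"
  shows "g = (\<lambda>z. \<Sum>y\<in>range g - {0}. y * indicator (g -` {y}) z)"
proof
  fix z
  have "(\<Sum>y\<in>range g - {0}. y * indicator (g -` {y}) z) = (\<Sum>y\<in>range g - {0}. if y = g z then g z else 0)"
    by (intro sum.cong) (auto simp: indicator_def)
  then show "g z = (\<Sum>y\<in>range g - {0}. y * indicator (g -` {y}) z)"
    using levy_simple_finite[OF assms] by auto
qed

lemma levy_simple_integral_eq_simple_int:
  assumes g: "levy_simple g" and B: "B \<in> sets borel"
  shows "AE \<omega> in M. levy_simple_integral \<Lambda> B g \<omega> = simple_int (\<lambda>z. g z * indicator B z) \<omega>"
proof -
  have "(\<lambda>z. g z * indicator B z) = (\<lambda>z. \<Sum>y\<in>range g - {0}. y * indicator (B \<inter> g -` {y}) z)"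
  proof
    fix z
    have "g z * indicator B z = (\<Sum>y\<in>range g - {0}. y * indicator (g -` {y}) z * indicator B z)"
      by (subst (1) levy_simple_as_sum[OF g]) (rule sum_distrib_right)
    also have "\<dots> = (\<Sum>y\<in>range g - {0}. y * indicator (B \<inter> g -` {y}) z)"
      by (intro sum.cong) (auto simp: indicator_def)
    finally show "g z * indicator B z = (\<Sum>y\<in>range g - {0}. y * indicator (B \<inter> g -` {y}) z)" .
  qed
  moreover have "B \<inter> g -` {y} \<in> bounded_borel_sets" if "y \<in> range g - {0}" for y
    using levy_simple_vimage[OF g, of y] that B
    by (intro bounded_borel_subset[OF levy_simple_vimage[OF g, of y]]) (auto simp: bounded_borel_sets_def)
  moreover have "disjoint_family_on (\<lambda>y. B \<inter> g -` {y}) (range g - {0})"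
    by (auto simp: disjoint_family_on_def)
  ultimately show ?thesis
    using levy_simple_integral_partition[of "range g - {0}" "\<lambda>y. B \<inter> g -` {y}"
        "\<lambda>z. g z * indicator B z" "\<lambda>y. y" UNIV] levy_simple_finite[OF g]
    by (auto simp: levy_simple_integral_def)
qed

lemma measurable_simple_int [measurable]:
  assumes "levy_simple g" shows "simple_int g \<in> borel_measurable M"
  unfolding levy_simple_integral_def[abs_def]
  using levy_simple_vimage[OF assms] by (auto intro!: borel_measurable_sum borel_measurable_times)

text \<open>
  Composition with a function that fixes \<open>0\<close>: applied to powers, moduli and the Levy exponent.
\<close>

lemma has_bochner_integral_levy_simple:
  fixes \<psi> :: "real \<Rightarrow> 'b::{banach, second_countable_topology}"
  assumes g: "levy_simple g" and 0: "\<psi> 0 = 0"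
  shows "has_bochner_integral control (\<lambda>z. \<psi> (g z))
    (\<Sum>y\<in>range g - {0}. measure control (g -` {y}) *\<^sub>R \<psi> y)"
proof -
  have "has_bochner_integral control (\<lambda>z. indicator (g -` {y}) z *\<^sub>R \<psi> y)
      (measure control (g -` {y}) *\<^sub>R \<psi> y)" if "y \<in> range g - {0}" for y
  proof (intro has_bochner_integral_scaleR_left has_bochner_integral_real_indicator)
    have *: "g -` {y} \<in> bounded_borel_sets" using levy_simple_vimage[OF g, of y] that by simp
    then show "g -` {y} \<in> sets control" unfolding sets_control by (simp add: bounded_borel_sets_def)
    show "emeasure control (g -` {y}) < \<infinity>" by (rule emeasure_control_bounded_borel[OF *])
  qed
  then have "has_bochner_integral control (\<lambda>z. \<Sum>y\<in>range g - {0}. indicator (g -` {y}) z *\<^sub>R \<psi> y)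
      (\<Sum>y\<in>range g - {0}. measure control (g -` {y}) *\<^sub>R \<psi> y)"
    by (intro has_bochner_integral_sum) auto
  moreover have "(\<Sum>y\<in>range g - {0}. indicator (g -` {y}) z *\<^sub>R \<psi> y) = \<psi> (g z)" for z
  proof -
    have "(\<Sum>y\<in>range g - {0}. indicator (g -` {y}) z *\<^sub>R \<psi> y) = (\<Sum>y\<in>range g - {0}. if y = g z then \<psi> (g z) else 0)"
      by (intro sum.cong) (auto simp: indicator_def)
    then show ?thesis using levy_simple_finite[OF g] 0 by auto
  qed
  ultimately show ?thesis by simp
qed

lemma char_scale:
  assumes [measurable]: "X \<in> borel_measurable M"
  shows "char (distr M borel (\<lambda>\<omega>. y * X \<omega>)) u = char (distr M borel X) (u * y)"
  by (simp add: char_def integral_distr ac_simps)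

lemma char_simple_int:
  assumes g: "levy_simple g"
  shows "char (distr M borel (simple_int g)) u = exp (CLINT z|control. exponent (u * g z))"
proof -
  let ?R = "range g - {0}"
  have *: "finite ?R" "\<And>y. y \<in> ?R \<Longrightarrow> g -` {y} \<in> bounded_borel_sets" "disjoint_family_on (\<lambda>y. g -` {y}) ?R"
    using g levy_simple_finite levy_simple_vimage by (auto simp: disjoint_family_on_def)
  have "indep_vars (\<lambda>_. borel) (\<lambda>y \<omega>. y * \<Lambda> (g -` {y}) \<omega>) ?R"
    by (rule indep_vars_compose2[OF indep_vars_Lambda[OF *], where Y="\<lambda>y x. y * x"]) auto
  then have "char (distr M borel (simple_int g)) u
      = (\<Prod>y\<in>?R. char (distr M borel (\<lambda>\<omega>. y * \<Lambda> (g -` {y}) \<omega>)) u)"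
    unfolding levy_simple_integral_def[abs_def] by (simp add: char_distr_sum)
  also have "\<dots> = (\<Prod>y\<in>?R. exp (exponent (u * y) * of_real (measure control (g -` {y}))))"
    using *(2) by (intro prod.cong) (auto simp: char_scale char_Lambda)
  also have "\<dots> = exp (\<Sum>y\<in>?R. measure control (g -` {y}) *\<^sub>R exponent (u * y))"
    using *(1) by (simp add: exp_sum scaleR_conv_of_real mult.commute)
  also have "(\<Sum>y\<in>?R. measure control (g -` {y}) *\<^sub>R exponent (u * y)) = (CLINT z|control. exponent (u * g z))"
    using has_bochner_integral_levy_simple[OF g, of "\<lambda>y. exponent (u * y)"]
    by (simp add: has_bochner_integral_integral_eq)
  finally show ?thesis .
qed

end

section \<open>Convergence in probability and almost disjoint subsequences\<close>

text \<open>
  The sliding hump. Since \<open>w n \<rightarrow> 0\<close>, dominated convergence makes the overlap \<open>\<integral> min (w n) (w i)\<close> small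
  for large \<open>n\<close>, so a subsequence can be chosen whose pairwise overlaps are summable. Each of its
  members is then concentrated on the set where it exceeds all the others, and these sets are
  disjoint.
\<close>

lemma almost_disjoint_subsequence:
  fixes w :: "nat \<Rightarrow> 'a \<Rightarrow> real"
  assumes int: "\<And>n. integrable N (w n)" and nn: "\<And>n x. 0 \<le> w n x"
    and lim: "AE x in N. (\<lambda>n. w n x) \<longlonglongrightarrow> 0" and e: "0 < e"
  obtains r E where "strict_mono (r :: nat \<Rightarrow> nat)" "\<And>j. E j \<in> sets N" "disjoint_family E"
    "\<And>j. (\<integral>x. w (r j) x * indicator (space N - E j) x \<partial>N) \<le> e"
proof -
  have [measurable]: "w n \<in> borel_measurable N" for n using int by blast
  have int_min: "integrable N (\<lambda>x. min (w n x) (w i x))" for n i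
    by (rule Bochner_Integration.integrable_bound[OF int[of n]]) (auto simp: nn)
  have to_0: "(\<lambda>n. \<integral>x. min (w n x) (w i x) \<partial>N) \<longlonglongrightarrow> 0" for i
  proof -
    have "(\<lambda>n. \<integral>x. min (w n x) (w i x) \<partial>N) \<longlonglongrightarrow> (\<integral>x. 0 \<partial>N)"
    proof (rule integral_dominated_convergence[where w="w i"])
      show "AE x in N. (\<lambda>n. min (w n x) (w i x)) \<longlonglongrightarrow> 0"
        using lim
      proof eventually_elim
        case (elim x)
        from tendsto_min[OF elim tendsto_const[of "w i x"]] nn[of i x] show ?case by simp
      qed
    qed (use int nn in auto)
    then show ?thesis by simp
  qed
  have "\<exists>r. \<forall>n. True \<and> (r n < r (Suc n) \<and>
      (\<forall>i\<le>r n. (\<integral>x. min (w (r (Suc n)) x) (w i x) \<partial>N) \<le> e / 2 * (1/4) ^ Suc n))"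
  proof (rule dependent_nat_choice)
    fix k n :: nat
    have "\<forall>\<^sub>F y in sequentially. \<forall>i\<in>{..k}. (\<integral>x. min (w y x) (w i x) \<partial>N) \<le> e / 2 * (1/4) ^ Suc n"
    proof (intro eventually_ball_finite ballI)
      fix i
      have "\<forall>\<^sub>F y in sequentially. (\<integral>x. min (w y x) (w i x) \<partial>N) < e / 2 * (1/4) ^ Suc n"
        using e by (intro order_tendstoD(2)[OF to_0]) auto
      then show "\<forall>\<^sub>F y in sequentially. (\<integral>x. min (w y x) (w i x) \<partial>N) \<le> e / 2 * (1/4) ^ Suc n"
        by (rule eventually_mono) simp
    qed simp
    with eventually_gt_at_top[of k]
    have "\<forall>\<^sub>F y in sequentially. k < y \<and> (\<forall>i\<in>{..k}. (\<integral>x. min (w y x) (w i x) \<partial>N) \<le> e / 2 * (1/4) ^ Suc n)"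
      by eventually_elim simp
    then show "\<exists>y. True \<and> k < y \<and> (\<forall>i\<le>k. (\<integral>x. min (w y x) (w i x) \<partial>N) \<le> e / 2 * (1/4) ^ Suc n)"
      by (auto simp: eventually_sequentially)
  qed simp
  then obtain r where r: "\<And>n. r n < r (Suc n)"
      "\<And>n i. i \<le> r n \<Longrightarrow> (\<integral>x. min (w (r (Suc n)) x) (w i x) \<partial>N) \<le> e / 2 * (1/4) ^ Suc n"
    by blast
  have sm: "strict_mono r" using r(1) by (simp add: strict_mono_Suc_iff)
  have lt: "(\<integral>x. min (w (r j) x) (w (r i) x) \<partial>N) \<le> e / 2 * (1/4) ^ j" if ij: "i < j" for i j
  proof -
    obtain n where "j = Suc n" using ij by (cases j) auto
    then show ?thesis using r(2)[of "r i" n] ij sm by (simp add: strict_mono_less_eq)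
  qed
  \<comment> \<open>summable in \<open>i\<close> for each fixed \<open>j\<close>, with total \<open>e\<close>, whichever index is larger\<close>
  have le: "(\<integral>x. min (w (r j) x) (w (r i) x) \<partial>N) \<le> e / 2 * (1/2) ^ i" if "i \<noteq> j" for i j
  proof (cases "i < j")
    case True
    have "(1/4) ^ j \<le> ((1/4) ^ i :: real)" using True by (intro power_decreasing) auto
    also have "\<dots> \<le> (1/2) ^ i" by (intro power_mono) auto
    finally show ?thesis using lt[OF True] e mult_left_mono[of "(1/4) ^ j" "(1/2) ^ i" "e / 2"] by linarith
  next
    case False
    then have "j < i" using that by simp
    from lt[OF this] have "(\<integral>x. min (w (r j) x) (w (r i) x) \<partial>N) \<le> e / 2 * (1/4) ^ i"
      by (simp add: min.commute)
    also have "\<dots> \<le> e / 2 * (1/2) ^ i" using e by (intro mult_left_mono power_mono) auto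
    finally show ?thesis .
  qed
  define E where "E j = {x \<in> space N. \<forall>i. i \<noteq> j \<longrightarrow> w (r i) x < w (r j) x}" for j
  have [measurable]: "E j \<in> sets N" for j unfolding E_def by measurable
  have dis: "disjoint_family E"
    unfolding disjoint_family_on_def E_def by (auto dest: less_asym)
  have bound: "(\<integral>x. w (r j) x * indicator (space N - E j) x \<partial>N) \<le> e" for j
  proof -
    let ?m = "\<lambda>i x. if i = j then 0 else min (w (r j) x) (w (r i) x)"
    have "(\<integral>\<^sup>+x. ennreal (w (r j) x * indicator (space N - E j) x) \<partial>N) \<le> (\<integral>\<^sup>+x. (\<Sum>i. ennreal (?m i x)) \<partial>N)"
    proof (rule nn_integral_mono)
      fix x assume x: "x \<in> space N"
      show "ennreal (w (r j) x * indicator (space N - E j) x) \<le> (\<Sum>i. ennreal (?m i x))"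
      proof (cases "x \<in> E j")
        case False
        then obtain i where i: "i \<noteq> j" "w (r j) x \<le> w (r i) x" using x by (auto simp: E_def not_less)
        have "ennreal (?m i x) \<le> (\<Sum>i. ennreal (?m i x))"
          using sum_le_suminf[of "\<lambda>i. ennreal (?m i x)" "{i}"] by simp
        then show ?thesis using i False x by (simp add: min_absorb1)
      qed simp
    qed
    also have "\<dots> = (\<Sum>i. \<integral>\<^sup>+x. ennreal (?m i x) \<partial>N)"
      by (rule nn_integral_suminf) measurable
    also have "\<dots> \<le> (\<Sum>i. ennreal (e / 2 * (1/2) ^ i))"
    proof (intro suminf_le)
      fix i
      show "(\<integral>\<^sup>+x. ennreal (?m i x) \<partial>N) \<le> ennreal (e / 2 * (1/2) ^ i)"
      proof (cases "i = j")
        case False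
        have "(\<integral>\<^sup>+x. ennreal (min (w (r j) x) (w (r i) x)) \<partial>N) = ennreal (\<integral>x. min (w (r j) x) (w (r i) x) \<partial>N)"
          using nn by (intro nn_integral_eq_integral int_min) auto
        then show ?thesis using False le[OF False] by (simp add: ennreal_leI)
      qed simp
    qed auto
    also have "\<dots> = ennreal e"
    proof -
      have "(\<lambda>i. e / 2 * (1/2) ^ i) sums (e / 2 * 2)"
        using geometric_sums[of "1/2 :: real"] by (intro sums_mult) simp
      then show ?thesis using e by (subst suminf_ennreal2) (auto simp: sums_iff)
    qed
    finally have *: "(\<integral>\<^sup>+x. ennreal (w (r j) x * indicator (space N - E j) x) \<partial>N) \<le> ennreal e" .
    have "integrable N (\<lambda>x. w (r j) x * indicator (space N - E j) x)"
      by (rule Bochner_Integration.integrable_bound[OF int[of "r j"]]) (auto simp: nn indicator_def)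
    with * show ?thesis
      using nn e by (subst (asm) nn_integral_eq_integral) auto
  qed
  show ?thesis by (rule that[OF sm _ dis bound]) auto
qed

text \<open>
  The mean value inequality on the left half plane, where the exponential has derivative of modulus
  at most \<open>1\<close>.
\<close>

lemma norm_exp_minus_1_le:
  assumes "Re z \<le> 0" shows "norm (exp z - 1) \<le> norm z"
proof -
  have "norm (exp z - exp 0) \<le> 1 * norm (z - 0)"
  proof (rule field_differentiable_bound[where S="{z. Re z \<le> 0}" and f'=exp])
    show "convex {z. Re z \<le> 0}" by (rule convex_halfspace_Re_le)
  qed (use assms in \<open>auto intro!: derivative_eq_intros\<close>)
  then show ?thesis by simp
qed

context prob_space
begin

text \<open>
  A translation invariant metric for convergence in probability. Up to a factor it dominates the
  differences of characteristic functions and of expectations of bounded Lipschitz functions.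
\<close>

definition ky_fan :: "('a \<Rightarrow> real) \<Rightarrow> ('a \<Rightarrow> real) \<Rightarrow> real" where
  "ky_fan X Z = expectation (\<lambda>\<omega>. min 1 \<bar>X \<omega> - Z \<omega>\<bar>)"

lemma integrable_min_1 [simp]:
  "f \<in> borel_measurable M \<Longrightarrow> integrable M (\<lambda>\<omega>. min 1 \<bar>f \<omega> :: real\<bar>)"
  by (rule integrable_const_bound[of _ 1]) auto

lemma ky_fan_nonneg: "0 \<le> ky_fan X Z"
  unfolding ky_fan_def by (intro Bochner_Integration.integral_nonneg) auto

lemma ky_fan_commute: "ky_fan X Z = ky_fan Z X"
  by (simp add: ky_fan_def abs_minus_commute)

lemma ky_fan_triangle:
  assumes [measurable]: "X \<in> borel_measurable M" "Z \<in> borel_measurable M" "W \<in> borel_measurable M"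
  shows "ky_fan X W \<le> ky_fan X Z + ky_fan Z W"
proof -
  have "ky_fan X W \<le> expectation (\<lambda>\<omega>. min 1 \<bar>X \<omega> - Z \<omega>\<bar> + min 1 \<bar>Z \<omega> - W \<omega>\<bar>)"
    unfolding ky_fan_def by (intro integral_mono integrable_min_1 Bochner_Integration.integrable_add) auto
  also have "\<dots> = ky_fan X Z + ky_fan Z W"
    unfolding ky_fan_def by (intro Bochner_Integration.integral_add integrable_min_1) auto
  finally show ?thesis .
qed

lemma ky_fan_diff_le:
  assumes [measurable]: "X \<in> borel_measurable M" "Z \<in> borel_measurable M"
    "X' \<in> borel_measurable M" "Z' \<in> borel_measurable M"
  shows "ky_fan (\<lambda>\<omega>. X \<omega> - Z \<omega>) (\<lambda>\<omega>. X' \<omega> - Z' \<omega>) \<le> ky_fan X X' + ky_fan Z Z'"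
proof -
  have "ky_fan (\<lambda>\<omega>. X \<omega> - Z \<omega>) (\<lambda>\<omega>. X' \<omega> - Z' \<omega>)
      \<le> expectation (\<lambda>\<omega>. min 1 \<bar>X \<omega> - X' \<omega>\<bar> + min 1 \<bar>Z \<omega> - Z' \<omega>\<bar>)"
    unfolding ky_fan_def by (intro integral_mono integrable_min_1 Bochner_Integration.integrable_add) auto
  also have "\<dots> = ky_fan X X' + ky_fan Z Z'"
    unfolding ky_fan_def by (intro Bochner_Integration.integral_add integrable_min_1) auto
  finally show ?thesis .
qed

lemma ky_fan_cong_AE:
  assumes "AE \<omega> in M. X \<omega> = X' \<omega>" "AE \<omega> in M. Z \<omega> = Z' \<omega>"
    and [measurable]: "X \<in> borel_measurable M" "Z \<in> borel_measurable M"
    "X' \<in> borel_measurable M" "Z' \<in> borel_measurable M"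
  shows "ky_fan X Z = ky_fan X' Z'"
  unfolding ky_fan_def
proof (rule integral_cong_AE)
  show "AE \<omega> in M. min 1 \<bar>X \<omega> - Z \<omega>\<bar> = min 1 \<bar>X' \<omega> - Z' \<omega>\<bar>"
    using assms(1,2) by eventually_elim simp
qed auto

lemma ky_fan_le_L1:
  assumes "integrable M (\<lambda>\<omega>. X \<omega> - Z \<omega>)" and [measurable]: "X \<in> borel_measurable M" "Z \<in> borel_measurable M"
  shows "ky_fan X Z \<le> expectation (\<lambda>\<omega>. \<bar>X \<omega> - Z \<omega>\<bar>)"
  unfolding ky_fan_def using assms by (intro integral_mono) auto

lemma ky_fan_tendsto_0:
  assumes conv: "converges_in_probability M X Z"
    and [measurable]: "\<And>n. X n \<in> borel_measurable M" "Z \<in> borel_measurable M"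
  shows "(\<lambda>n. ky_fan (X n) Z) \<longlonglongrightarrow> 0"
proof (rule LIMSEQ_I)
  fix e :: real assume e: "0 < e"
  have "(\<lambda>n. prob {\<omega> \<in> space M. \<bar>X n \<omega> - Z \<omega>\<bar> > e / 2}) \<longlonglongrightarrow> 0"
    using conv half_gt_zero[OF e] unfolding converges_in_probability_def by blast
  from LIMSEQ_D[OF this, of "e / 2"] e obtain N where
    N: "\<And>n. n \<ge> N \<Longrightarrow> prob {\<omega> \<in> space M. \<bar>X n \<omega> - Z \<omega>\<bar> > e / 2} < e / 2" by auto
  have "norm (ky_fan (X n) Z - 0) < e" if "n \<ge> N" for n
  proof -
    define S where "S = {\<omega> \<in> space M. \<bar>X n \<omega> - Z \<omega>\<bar> > e / 2}"
    have [measurable]: "S \<in> events" unfolding S_def by measurable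
    have iS: "integrable M (\<lambda>\<omega>. indicator S \<omega> :: real)" by (rule integrable_const_bound[of _ 1]) auto
    have "min 1 \<bar>X n \<omega> - Z \<omega>\<bar> \<le> e / 2 + indicator S \<omega>" if "\<omega> \<in> space M" for \<omega>
      using e that unfolding S_def indicator_def min_def by auto
    then have "ky_fan (X n) Z \<le> expectation (\<lambda>\<omega>. e / 2 + indicator S \<omega>)"
      unfolding ky_fan_def using iS by (intro integral_mono) auto
    also have "\<dots> = e / 2 + prob S"
      using iS by (subst Bochner_Integration.integral_add) (auto simp: prob_space)
    finally have "ky_fan (X n) Z \<le> e / 2 + prob {\<omega> \<in> space M. \<bar>X n \<omega> - Z \<omega>\<bar> > e / 2}"
      unfolding S_def .
    then show ?thesis using N[OF that] ky_fan_nonneg[of "X n" Z] by simp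
  qed
  then show "\<exists>N. \<forall>n\<ge>N. norm (ky_fan (X n) Z - 0) < e" by blast
qed

lemma norm_char_diff_le_ky_fan:
  assumes [measurable]: "X \<in> borel_measurable M" "Z \<in> borel_measurable M"
  shows "norm (char (distr M borel X) u - char (distr M borel Z) u) \<le> (2 + \<bar>u\<bar>) * ky_fan X Z"
proof -
  have pw: "norm (iexp (u * X \<omega>) - iexp (u * Z \<omega>)) \<le> (2 + \<bar>u\<bar>) * min 1 \<bar>X \<omega> - Z \<omega>\<bar>" for \<omega>
  proof -
    have "iexp (u * X \<omega>) - iexp (u * Z \<omega>) = iexp (u * Z \<omega>) * (iexp (u * (X \<omega> - Z \<omega>)) - 1)"
      by (simp add: exp_add[symmetric] algebra_simps)
    then have eq: "norm (iexp (u * X \<omega>) - iexp (u * Z \<omega>)) = norm (iexp (u * (X \<omega> - Z \<omega>)) - 1)"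
      by (simp add: norm_mult)
    have le1: "norm (iexp (u * (X \<omega> - Z \<omega>)) - 1) \<le> \<bar>u\<bar> * \<bar>X \<omega> - Z \<omega>\<bar>"
      using norm_iexp_minus_1_le[of "u * (X \<omega> - Z \<omega>)"] by (simp add: abs_mult)
    have le2: "norm (iexp (u * (X \<omega> - Z \<omega>)) - 1) \<le> 2"
      using norm_triangle_ineq4[of "iexp (u * (X \<omega> - Z \<omega>))" 1] by simp
    show ?thesis
    proof (cases "\<bar>X \<omega> - Z \<omega>\<bar> \<le> 1")
      case True
      have "\<bar>u\<bar> * \<bar>X \<omega> - Z \<omega>\<bar> \<le> (2 + \<bar>u\<bar>) * \<bar>X \<omega> - Z \<omega>\<bar>" by (simp add: distrib_right)
      from order_trans[OF le1 this] show ?thesis unfolding eq min_absorb2[OF True] .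
    next
      case False
      then show ?thesis using eq le2 by (simp add: min_absorb1)
    qed
  qed
  have i: "complex_integrable M (\<lambda>\<omega>. iexp (u * X \<omega>))" "complex_integrable M (\<lambda>\<omega>. iexp (u * Z \<omega>))"
    by (rule integrable_const_bound[of _ 1]; simp)+
  have "char (distr M borel X) u - char (distr M borel Z) u = (CLINT \<omega>|M. iexp (u * X \<omega>) - iexp (u * Z \<omega>))"
    using i by (simp add: char_def integral_distr)
  also have "norm \<dots> \<le> expectation (\<lambda>\<omega>. (2 + \<bar>u\<bar>) * min 1 \<bar>X \<omega> - Z \<omega>\<bar>)"
  proof (rule order_trans[OF integral_norm_bound integral_mono])
    show "integrable M (\<lambda>\<omega>. norm (iexp (u * X \<omega>) - iexp (u * Z \<omega>)))" using i by simp
  qed (use pw in auto)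
  finally show ?thesis by (simp add: ky_fan_def)
qed

text \<open>
  Levy's continuity theorem with the point mass at \<open>0\<close> as limit.
\<close>

lemma ky_fan_0_of_char:
  assumes [measurable]: "\<And>n. Z n \<in> borel_measurable M"
    and char: "\<And>u. (\<lambda>n. char (distr M borel (Z n)) u) \<longlonglongrightarrow> 1"
  shows "(\<lambda>n. ky_fan (Z n) (\<lambda>_. 0)) \<longlonglongrightarrow> 0"
proof -
  let ?D = "return borel (0::real)"
  have D: "real_distribution ?D"
    using prob_space_return[of "0::real" borel]
    by (auto simp: real_distribution_def real_distribution_axioms_def)
  have Zd: "real_distribution (distr M borel (Z n))" for n by (simp add: real_distribution_distr)
  have "char ?D u = 1" for u by (simp add: char_def integral_return)
  then have "weak_conv_m (\<lambda>n. distr M borel (Z n)) ?D"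
    using char by (intro levy_continuity[OF Zd D]) simp
  then have "(\<lambda>n. integral\<^sup>L (distr M borel (Z n)) (\<lambda>x. min 1 \<bar>x\<bar>)) \<longlonglongrightarrow> integral\<^sup>L ?D (\<lambda>x. min 1 \<bar>x\<bar>)"
    by (rule weak_conv_imp_integral_bdd_continuous_conv[OF Zd D, where B=1])
       (auto intro!: continuous_intros)
  then show ?thesis by (simp add: ky_fan_def integral_distr integral_return)
qed

end

section \<open>Uniqueness of the stochastic integral\<close>

context square_integrable_levy_basis
begin

lemma integrable_exponent_simple:
  "levy_simple g \<Longrightarrow> complex_integrable control (\<lambda>z. exponent (u * g z))"
  using has_bochner_integral_levy_simple[of g "\<lambda>y. exponent (u * y)"] by (auto simp: has_bochner_integral_iff)

lemma Re_integral_exponent_nonpos: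
  assumes "levy_simple g"
  shows "Re (CLINT z|control. exponent (u * g z)) \<le> 0"
proof -
  have "Re (CLINT z|control. exponent (u * g z)) = (\<integral>z. Re (exponent (u * g z)) \<partial>control)"
    by (rule integral_Re[OF integrable_exponent_simple[OF assms], symmetric])
  moreover have "0 \<le> (\<integral>z. - Re (exponent (u * g z)) \<partial>control)"
    using Re_exponent_nonpos by (intro Bochner_Integration.integral_nonneg) auto
  ultimately show ?thesis by simp
qed

text \<open>
  Let \<open>\<phi> n B\<close> be the characteristic function at \<open>u\<close> of the integral of \<open>k n\<close> over \<open>B\<close>. It is multiplicative
  in \<open>B\<close> and close to \<open>1\<close> when \<open>B\<close> avoids the hump of \<open>k n\<close>. Along an almost disjoint subsequence let
  \<open>U\<close> collect the humps of even index. For odd indices \<open>\<phi> U\<close> is close to \<open>1\<close>; for even indices the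
  complement of \<open>U\<close> avoids the hump, and \<open>\<phi> U\<close> is close to \<open>\<phi> UNIV\<close>. As \<open>\<phi> n U\<close> has a limit, the limit of
  \<open>\<phi> n UNIV\<close> is close to \<open>1\<close>.
\<close>

lemma uniqueness_char:
  assumes k: "\<And>n. levy_simple (k n)"
    and lim: "AE z in control. (\<lambda>n. k n z) \<longlonglongrightarrow> 0"
    and conv: "\<And>B. B \<in> sets borel \<Longrightarrow>
      convergent (\<lambda>n. exp (CLINT z|control. exponent (u * (k n z * indicator B z))))"
  shows "(\<lambda>n. exp (CLINT z|control. exponent (u * k n z))) \<longlonglongrightarrow> 1"
proof -
  define \<phi> where "\<phi> n B = exp (CLINT z|control. exponent (u * (k n z * indicator B z)))" for n B
  obtain C where C: "C \<ge> 0" "\<And>u. norm (exponent u) \<le> C * (\<bar>u\<bar> + u\<^sup>2)"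
    using exponent_bound by blast
  define w where "w n z = C * (\<bar>u * k n z\<bar> + (u * k n z)\<^sup>2)" for n z
  have w_int: "integrable control (w n)" for n
    using has_bochner_integral_levy_simple[OF k[of n], of "\<lambda>y. C * (\<bar>u * y\<bar> + (u * y)\<^sup>2)"]
    by (auto simp: has_bochner_integral_iff w_def[abs_def])
  have w_nn: "0 \<le> w n z" for n z using C(1) by (simp add: w_def)
  have w_lim: "AE z in control. (\<lambda>n. w n z) \<longlonglongrightarrow> 0"
    using lim
  proof eventually_elim
    case (elim z)
    have "(\<lambda>n. C * (\<bar>u * k n z\<bar> + (u * k n z)\<^sup>2)) \<longlonglongrightarrow> C * (\<bar>u * 0\<bar> + (u * 0)\<^sup>2)"
      by (intro tendsto_intros elim)
    then show ?case by (simp add: w_def)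
  qed
  have kB: "levy_simple (\<lambda>z. k n z * indicator B z)" if "B \<in> sets borel" for n B
    by (rule levy_simple_indicator[OF k that])
  have norm_1: "norm (\<phi> n B) \<le> 1" if "B \<in> sets borel" for n B
    using Re_integral_exponent_nonpos[OF kB[OF that]] by (simp add: \<phi>_def)
  have near_1: "norm (\<phi> n B - 1) \<le> e"
    if B: "B \<in> sets borel" "B \<inter> E = {}" and E: "E \<in> sets borel"
      "(\<integral>z. w n z * indicator (space control - E) z \<partial>control) \<le> e" for n B E e
  proof -
    have "norm (\<phi> n B - 1) \<le> norm (CLINT z|control. exponent (u * (k n z * indicator B z)))"
      unfolding \<phi>_def by (rule norm_exp_minus_1_le[OF Re_integral_exponent_nonpos[OF kB[OF B(1)]]])
    also have "\<dots> \<le> (\<integral>z. w n z * indicator (space control - E) z \<partial>control)"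
    proof (rule order_trans[OF integral_norm_bound integral_mono])
      show "integrable control (\<lambda>z. norm (exponent (u * (k n z * indicator B z))))"
        using integrable_exponent_simple[OF kB[OF B(1)]] by (rule integrable_norm)
      have "space control - E \<in> sets control" using sets.compl_sets[of E control] E(1) unfolding sets_control .
      then show "integrable control (\<lambda>z. w n z * indicator (space control - E) z)"
        by (intro integrable_real_mult_indicator w_int)
      fix z
      show "norm (exponent (u * (k n z * indicator B z))) \<le> w n z * indicator (space control - E) z"
        using C(2)[of "u * k n z"] w_nn[of n z] B(2) by (auto simp: indicator_def w_def)
    qed
    finally show ?thesis using E(2) by simp
  qed
  have split: "\<phi> n UNIV = \<phi> n B * \<phi> n (- B)" if B: "B \<in> sets borel" for n B
  proof -
    have B': "- B \<in> sets borel" using B by auto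
    have "(CLINT z|control. exponent (u * (k n z * indicator B z))) + (CLINT z|control. exponent (u * (k n z * indicator (- B) z)))
       = (CLINT z|control. exponent (u * (k n z * indicator B z)) + exponent (u * (k n z * indicator (- B) z)))"
      by (rule Bochner_Integration.integral_add[symmetric]; rule integrable_exponent_simple; rule kB; fact)
    also have "\<dots> = (CLINT z|control. exponent (u * (k n z * indicator UNIV z)))"
      by (intro Bochner_Integration.integral_cong) (auto simp: indicator_def)
    finally show ?thesis by (simp add: \<phi>_def exp_add[symmetric])
  qed
  have \<phi>_conv: "convergent (\<lambda>n. \<phi> n B)" if "B \<in> sets borel" for B
    using conv[OF that] by (simp add: \<phi>_def)
  obtain a where a: "(\<lambda>n. \<phi> n UNIV) \<longlonglongrightarrow> a" using \<phi>_conv[of UNIV] by (auto simp: convergent_def)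
  have "norm (a - 1) \<le> 2 * e" if e: "0 < e" for e
  proof -
    obtain r E where r: "strict_mono (r :: nat \<Rightarrow> nat)" and E: "\<And>j. E j \<in> sets control"
      and dis: "disjoint_family E"
      and small: "\<And>j. (\<integral>z. w (r j) z * indicator (space control - E j) z \<partial>control) \<le> e"
      using almost_disjoint_subsequence[OF w_int w_nn w_lim e] by blast
    have Eb [measurable]: "E j \<in> sets borel" for j using E[of j] unfolding sets_control .
    define U where "U = (\<Union>j. E (2 * j))"
    have Ub [measurable]: "U \<in> sets borel" unfolding U_def by measurable
    obtain b where b: "(\<lambda>n. \<phi> n U) \<longlonglongrightarrow> b" using \<phi>_conv[OF Ub] by (auto simp: convergent_def)
    have "norm (b - 1) \<le> e"
    proof (rule LIMSEQ_le_const2)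
      have "strict_mono (\<lambda>j. r (2 * j + 1))" using r by (simp add: strict_mono_def)
      from LIMSEQ_subseq_LIMSEQ[OF b this]
      show "(\<lambda>j. norm (\<phi> (r (2 * j + 1)) U - 1)) \<longlonglongrightarrow> norm (b - 1)"
        by (intro tendsto_intros) (simp add: o_def)
      have "U \<inter> E (2 * j + 1) = {}" for j
      proof -
        have "E (2 * i) \<inter> E (2 * j + 1) = {}" for i
          using dis by (intro disjoint_family_onD[OF dis]) (auto, presburger)
        then show ?thesis unfolding U_def by blast
      qed
      then show "\<exists>N. \<forall>j\<ge>N. norm (\<phi> (r (2 * j + 1)) U - 1) \<le> e"
        using near_1[OF Ub _ Eb small] by blast
    qed
    moreover have "norm (a - b) \<le> e"
    proof (rule LIMSEQ_le_const2)
      have sm: "strict_mono (\<lambda>j. r (2 * j))" using r by (simp add: strict_mono_def)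
      show "(\<lambda>j. norm (\<phi> (r (2 * j)) UNIV - \<phi> (r (2 * j)) U)) \<longlonglongrightarrow> norm (a - b)"
        using LIMSEQ_subseq_LIMSEQ[OF a sm] LIMSEQ_subseq_LIMSEQ[OF b sm]
        by (intro tendsto_intros) (simp_all add: o_def)
      have "norm (\<phi> (r (2 * j)) UNIV - \<phi> (r (2 * j)) U) \<le> e" for j
      proof -
        have "\<phi> (r (2 * j)) UNIV - \<phi> (r (2 * j)) U = \<phi> (r (2 * j)) U * (\<phi> (r (2 * j)) (- U) - 1)"
          by (simp add: split[OF Ub] right_diff_distrib)
        moreover have "norm (\<phi> (r (2 * j)) (- U) - 1) \<le> e"
          by (rule near_1[OF _ _ Eb small]) (auto simp: U_def)
        ultimately show ?thesis
          using mult_mono[OF norm_1[OF Ub, of "r (2 * j)"], of "norm (\<phi> (r (2 * j)) (- U) - 1)" e] 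
          by (simp add: norm_mult)
      qed
      then show "\<exists>N. \<forall>j\<ge>N. norm (\<phi> (r (2 * j)) UNIV - \<phi> (r (2 * j)) U) \<le> e" by blast
    qed
    ultimately show ?thesis
      using norm_triangle_ineq[of "a - b" "b - 1"] by simp
  qed
  then have "norm (a - 1) \<le> e" if "0 < e" for e
    using that by (metis field_sum_of_halves half_gt_zero mult_2)
  then have "norm (a - 1) \<le> 0" by (rule field_le_epsilon) simp
  then show ?thesis using a by (simp add: \<phi>_def)
qed

text \<open>
  The two cases of the theorem share their proof through this property: it holds with \<open>p = 2\<close> for
  centred bases and with \<open>p = 1\<close> for bases of finite variation.
\<close>

definition moment_bound :: "nat \<Rightarrow> real \<Rightarrow> bool" where
  "moment_bound p a \<longleftrightarrow> 1 \<le> p \<and> 0 \<le> a \<and>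
     (\<forall>g. levy_simple g \<longrightarrow> integrable M (simple_int g) \<and>
        (expectation (\<lambda>\<omega>. \<bar>simple_int g \<omega>\<bar>)) ^ p \<le> a * (\<integral>z. \<bar>g z\<bar> ^ p \<partial>control))"

lemma integrable_levy_simple_power:
  assumes "levy_simple g" "1 \<le> p" shows "integrable control (\<lambda>z. \<bar>g z\<bar> ^ p)"
  using has_bochner_integral_levy_simple[OF assms(1), of "\<lambda>y. \<bar>y\<bar> ^ p"] assms(2)
  by (auto simp: has_bochner_integral_iff)

lemma levy_space_borel [measurable]: "levy_space \<in> sets borel"
  unfolding levy_space_def by (intro borel_open open_Times) auto

lemma levy_simple_restrict_levy_space:
  assumes "levy_simple g"
  shows "(\<lambda>z. g z * indicator (B \<inter> levy_space) z) = (\<lambda>z. g z * indicator B z)"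
proof
  fix z
  have "g z = 0" if "z \<notin> levy_space"
    using levy_simple_support[OF assms] that by (auto simp: bounded_borel_sets_def)
  then show "g z * indicator (B \<inter> levy_space) z = g z * indicator B z"
    by (auto simp: indicator_def)
qed

text \<open>
  The given sequence \<open>g\<close> and the sequence \<open>h\<close> have a difference that tends to \<open>0\<close> almost everywhere.
  Its integral over any Borel set is Cauchy in probability: the part from \<open>g\<close> by the definition of
  the integral, the part from \<open>h\<close> by the moment bound. So uniqueness applies.
\<close>

theorem integral_limit_of_simple:
  assumes bound: "moment_bound p a" and f: "has_levy_integral M \<Lambda> \<pi> levy_space f X"
    and h: "\<And>n. levy_simple (h n)"
    and h_lim: "AE z in control. (\<lambda>n. h n z) \<longlonglongrightarrow> f z"
    and h_Cauchy: "\<And>e. 0 < e \<Longrightarrow> \<exists>N. \<forall>n\<ge>N. \<forall>m\<ge>N. (\<integral>z. \<bar>h n z - h m z\<bar> ^ p \<partial>control) < e"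
  shows "(\<lambda>n. ky_fan (simple_int (h n)) X) \<longlonglongrightarrow> 0"
proof -
  from bound have p: "1 \<le> p" and a: "0 \<le> a" and int: "\<And>g. levy_simple g \<Longrightarrow> integrable M (simple_int g)"
    and mom: "\<And>g. levy_simple g \<Longrightarrow>
      (expectation (\<lambda>\<omega>. \<bar>simple_int g \<omega>\<bar>)) ^ p \<le> a * (\<integral>z. \<bar>g z\<bar> ^ p \<partial>control)"
    by (auto simp: moment_bound_def)
  from f have X [measurable]: "X \<in> borel_measurable M" by (simp add: has_levy_integral_def)
  from f obtain g where g: "\<And>n. levy_simple (g n)"
    and g_lim: "AE z in control. (\<lambda>n. g n z) \<longlonglongrightarrow> f z"
    and gB: "\<And>B. B \<in> sets borel \<Longrightarrow> B \<subseteq> levy_space \<Longrightarrow>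
       \<exists>Z\<in>borel_measurable M. converges_in_probability M (\<lambda>n. levy_simple_integral \<Lambda> B (g n)) Z"
    and gX: "converges_in_probability M (\<lambda>n. levy_simple_integral \<Lambda> levy_space (g n)) X"
    unfolding has_levy_integral_def by blast
  have meas_B: "levy_simple_integral \<Lambda> B (g n) \<in> borel_measurable M" if "B \<in> sets borel" for B n
    unfolding levy_simple_integral_def[abs_def]
  proof (intro borel_measurable_sum borel_measurable_times borel_measurable_const measurable_Lambda)
    fix y assume "y \<in> range (g n) - {0}"
    then have *: "g n -` {y} \<in> bounded_borel_sets" by (intro levy_simple_vimage[OF g]) auto
    show "B \<inter> g n -` {y} \<in> bounded_borel_sets"
      using that * by (intro bounded_borel_subset[OF *]) (auto simp: bounded_borel_sets_def)
  qed
  define k where "k n z = g n z - h n z" for n z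
  have k: "levy_simple (k n)" for n unfolding k_def[abs_def] by (rule levy_simple_diff[OF g h])
  have k_lim: "AE z in control. (\<lambda>n. k n z) \<longlonglongrightarrow> 0"
    using g_lim h_lim
  proof eventually_elim
    case (elim z)
    from tendsto_diff[OF this] show ?case by (simp add: k_def)
  qed
  note si [measurable] = measurable_simple_int[OF g] measurable_simple_int[OF h] measurable_simple_int[OF k]
  \<comment> \<open>uniqueness tests the difference on all Borel sets, so the Cauchy property is needed over each \<open>B\<close>\<close>
  have gB_eq: "ky_fan (levy_simple_integral \<Lambda> (B \<inter> levy_space) (g n)) Z
      = ky_fan (simple_int (\<lambda>z. g n z * indicator B z)) Z"
    if [measurable]: "B \<in> sets borel" "Z \<in> borel_measurable M" for B n Z
  proof (rule ky_fan_cong_AE)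
    have "AE \<omega> in M. levy_simple_integral \<Lambda> (B \<inter> levy_space) (g n) \<omega> =
        simple_int (\<lambda>z. g n z * indicator (B \<inter> levy_space) z) \<omega>"
      by (rule levy_simple_integral_eq_simple_int[OF g]) measurable
    then show "AE \<omega> in M. levy_simple_integral \<Lambda> (B \<inter> levy_space) (g n) \<omega> =
        simple_int (\<lambda>z. g n z * indicator B z) \<omega>"
      unfolding levy_simple_restrict_levy_space[OF g] .
    show "levy_simple_integral \<Lambda> (B \<inter> levy_space) (g n) \<in> borel_measurable M"
      by (rule meas_B) measurable
  qed (use measurable_simple_int[OF levy_simple_indicator[OF g that(1)]] in auto)
  have g_Cauchy: "\<exists>Z\<in>borel_measurable M. (\<lambda>n. ky_fan (simple_int (\<lambda>z. g n z * indicator B z)) Z) \<longlonglongrightarrow> 0"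
    if B [measurable]: "B \<in> sets borel" for B
  proof -
    have BL: "B \<inter> levy_space \<in> sets borel" by measurable
    from gB[OF BL] obtain Z where Z: "Z \<in> borel_measurable M"
      "converges_in_probability M (\<lambda>n. levy_simple_integral \<Lambda> (B \<inter> levy_space) (g n)) Z" by blast
    have "(\<lambda>n. ky_fan (levy_simple_integral \<Lambda> (B \<inter> levy_space) (g n)) Z) \<longlonglongrightarrow> 0"
      by (rule ky_fan_tendsto_0[OF Z(2) meas_B[OF BL] Z(1)])
    then show ?thesis using Z(1) gB_eq[OF B Z(1)] by auto
  qed
  have h_dist: "ky_fan (simple_int (\<lambda>z. h n z * indicator B z)) (simple_int (\<lambda>z. h m z * indicator B z)) ^ p
      \<le> a * (\<integral>z. \<bar>h n z - h m z\<bar> ^ p \<partial>control)" if B [measurable]: "B \<in> sets borel" for B n m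
  proof -
    let ?n = "\<lambda>z. h n z * indicator B z" and ?m = "\<lambda>z. h m z * indicator B z"
    have s: "levy_simple ?n" "levy_simple ?m" by (rule levy_simple_indicator[OF h B])+
    note d = levy_simple_diff[OF s]
    have ae: "AE \<omega> in M. simple_int (\<lambda>z. ?n z - ?m z) \<omega> = simple_int ?n \<omega> - simple_int ?m \<omega>"
      by (rule simple_int_diff[OF s])
    have "ky_fan (simple_int ?n) (simple_int ?m) \<le> expectation (\<lambda>\<omega>. \<bar>simple_int ?n \<omega> - simple_int ?m \<omega>\<bar>)"
      using int[OF s(1)] int[OF s(2)] s by (intro ky_fan_le_L1) auto
    also have "\<dots> = expectation (\<lambda>\<omega>. \<bar>simple_int (\<lambda>z. ?n z - ?m z) \<omega>\<bar>)"
    proof (rule integral_cong_AE)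
      show "AE \<omega> in M. \<bar>simple_int ?n \<omega> - simple_int ?m \<omega>\<bar> = \<bar>simple_int (\<lambda>z. ?n z - ?m z) \<omega>\<bar>"
        using ae by eventually_elim simp
    qed (use measurable_simple_int[OF s(1)] measurable_simple_int[OF s(2)] measurable_simple_int[OF d] in auto)
    finally have "ky_fan (simple_int ?n) (simple_int ?m) ^ p
        \<le> (expectation (\<lambda>\<omega>. \<bar>simple_int (\<lambda>z. ?n z - ?m z) \<omega>\<bar>)) ^ p"
      using ky_fan_nonneg by (rule power_mono)
    also have "\<dots> \<le> a * (\<integral>z. \<bar>?n z - ?m z\<bar> ^ p \<partial>control)" by (rule mom[OF d])
    also have "\<dots> \<le> a * (\<integral>z. \<bar>h n z - h m z\<bar> ^ p \<partial>control)"
    proof (intro mult_left_mono[OF _ a] integral_mono)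
      show "integrable control (\<lambda>z. \<bar>?n z - ?m z\<bar> ^ p)" by (rule integrable_levy_simple_power[OF d p])
      show "integrable control (\<lambda>z. \<bar>h n z - h m z\<bar> ^ p)"
        by (rule integrable_levy_simple_power[OF levy_simple_diff[OF h h] p])
    qed (use p in \<open>auto simp: indicator_def\<close>)
    finally show ?thesis .
  qed
  have h_small: "\<exists>N. \<forall>n\<ge>N. \<forall>m\<ge>N.
      ky_fan (simple_int (\<lambda>z. h n z * indicator B z)) (simple_int (\<lambda>z. h m z * indicator B z)) < e"
    if B: "B \<in> sets borel" and e: "0 < e" for B e
  proof -
    have "0 < e ^ p / (a + 1)" using e a by simp
    from h_Cauchy[OF this] obtain N where
      N: "\<And>n m. n \<ge> N \<Longrightarrow> m \<ge> N \<Longrightarrow> (\<integral>z. \<bar>h n z - h m z\<bar> ^ p \<partial>control) < e ^ p / (a + 1)" by blast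
    have "ky_fan (simple_int (\<lambda>z. h n z * indicator B z)) (simple_int (\<lambda>z. h m z * indicator B z)) < e"
      if nm: "n \<ge> N" "m \<ge> N" for n m
    proof (rule power_less_imp_less_base)
      let ?I = "\<integral>z. \<bar>h n z - h m z\<bar> ^ p \<partial>control"
      have "0 \<le> ?I" by (intro Bochner_Integration.integral_nonneg) auto
      then have "a * ?I \<le> (a + 1) * ?I" by (simp add: distrib_right)
      also have "\<dots> < e ^ p" using N[OF nm] a by (simp add: pos_less_divide_eq mult.commute)
      finally show "ky_fan (simple_int (\<lambda>z. h n z * indicator B z)) (simple_int (\<lambda>z. h m z * indicator B z)) ^ p < e ^ p"
        using h_dist[OF B, of n m] by linarith
    qed (use e in simp)
    then show ?thesis by blast
  qed
  have "convergent (\<lambda>n. exp (CLINT z|control. exponent (u * (k n z * indicator B z))))"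
    if B [measurable]: "B \<in> sets borel" for u B
  proof -
    let ?G = "\<lambda>n. simple_int (\<lambda>z. g n z * indicator B z)"
    let ?H = "\<lambda>n. simple_int (\<lambda>z. h n z * indicator B z)"
    let ?K = "\<lambda>n. simple_int (\<lambda>z. k n z * indicator B z)"
    let ?c = "\<lambda>n. char (distr M borel (?K n)) u"
    have [measurable]: "?G n \<in> borel_measurable M" "?H n \<in> borel_measurable M" "?K n \<in> borel_measurable M" for n
      by (rule measurable_simple_int[OF levy_simple_indicator] g h k B)+
    obtain Z where Z [measurable]: "Z \<in> borel_measurable M" and GZ: "(\<lambda>n. ky_fan (?G n) Z) \<longlonglongrightarrow> 0"
      using g_Cauchy[OF B] by blast
    have ae: "AE \<omega> in M. ?K n \<omega> = ?G n \<omega> - ?H n \<omega>" for n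
      using simple_int_diff[OF levy_simple_indicator[OF g B] levy_simple_indicator[OF h B], of n n]
      by (simp add: k_def left_diff_distrib)
    have KK: "ky_fan (?K n) (?K m) \<le> ky_fan (?G n) Z + ky_fan (?G m) Z + ky_fan (?H n) (?H m)" for n m
    proof -
      have "ky_fan (?K n) (?K m) = ky_fan (\<lambda>\<omega>. ?G n \<omega> - ?H n \<omega>) (\<lambda>\<omega>. ?G m \<omega> - ?H m \<omega>)"
        by (rule ky_fan_cong_AE[OF ae ae]) measurable
      also have "\<dots> \<le> ky_fan (?G n) (?G m) + ky_fan (?H n) (?H m)"
        by (rule ky_fan_diff_le) measurable
      also have "ky_fan (?G n) (?G m) \<le> ky_fan (?G n) Z + ky_fan Z (?G m)"
        by (rule ky_fan_triangle) measurable
      finally show ?thesis by (simp add: ky_fan_commute)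
    qed
    have "Cauchy ?c"
    proof (rule CauchyI)
      fix e :: real assume e: "0 < e"
      define d where "d = e / (3 * (3 + \<bar>u\<bar>))"
      have d: "0 < d" using e by (simp add: d_def add_pos_nonneg)
      obtain N1 where N1: "\<And>n. n \<ge> N1 \<Longrightarrow> ky_fan (?G n) Z < d"
        using LIMSEQ_D[OF GZ d] ky_fan_nonneg by auto
      obtain N2 where N2: "\<And>n m. n \<ge> N2 \<Longrightarrow> m \<ge> N2 \<Longrightarrow> ky_fan (?H n) (?H m) < d"
        using h_small[OF B d] by blast
      have "norm (?c n - ?c m) < e" if "n \<ge> max N1 N2" "m \<ge> max N1 N2" for n m
      proof -
        have "norm (?c n - ?c m) \<le> (2 + \<bar>u\<bar>) * ky_fan (?K n) (?K m)"
          by (rule norm_char_diff_le_ky_fan) measurable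
        also have "\<dots> \<le> (2 + \<bar>u\<bar>) * (3 * d)"
          using KK[of n m] N1[of n] N1[of m] N2[of n m] that by (intro mult_left_mono) auto
        also have "\<dots> < (3 + \<bar>u\<bar>) * (3 * d)" using d by (intro mult_strict_right_mono) auto
        also have "\<dots> = e" using abs_ge_zero[of u] by (simp add: d_def field_simps)
        finally show ?thesis .
      qed
      then show "\<exists>N. \<forall>m\<ge>N. \<forall>n\<ge>N. norm (?c m - ?c n) < e" by blast
    qed
    then have "convergent ?c" by (rule Cauchy_convergent)
    then show ?thesis by (simp add: char_simple_int[OF levy_simple_indicator[OF k B]])
  qed
  then have "(\<lambda>n. char (distr M borel (simple_int (k n))) u) \<longlonglongrightarrow> 1" for u
    using uniqueness_char[OF k k_lim, of u] by (simp add: char_simple_int[OF k])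
  then have K0: "(\<lambda>n. ky_fan (simple_int (k n)) (\<lambda>_. 0)) \<longlonglongrightarrow> 0"
    by (intro ky_fan_0_of_char) auto
  have G0: "(\<lambda>n. ky_fan (simple_int (g n)) X) \<longlonglongrightarrow> 0"
    using ky_fan_tendsto_0[OF gX meas_B[OF levy_space_borel] X] gB_eq[of UNIV X] by simp
  have le: "ky_fan (simple_int (h n)) X \<le> ky_fan (simple_int (k n)) (\<lambda>_. 0) + ky_fan (simple_int (g n)) X" for n
  proof -
    have "ky_fan (simple_int (h n)) (simple_int (g n)) = ky_fan (simple_int (k n)) (\<lambda>_. 0)"
      unfolding ky_fan_def
    proof (rule integral_cong_AE)
      show "AE \<omega> in M. min 1 \<bar>simple_int (h n) \<omega> - simple_int (g n) \<omega>\<bar> = min 1 \<bar>simple_int (k n) \<omega> - 0\<bar>"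
        using simple_int_diff[OF g h, of n n]
        by eventually_elim (simp add: k_def[abs_def] abs_minus_commute)
    qed auto
    then show ?thesis
      using ky_fan_triangle[of "simple_int (h n)" "simple_int (g n)" X] by simp
  qed
  show ?thesis
  proof (rule tendsto_sandwich[OF _ _ tendsto_const])
    show "(\<lambda>n. ky_fan (simple_int (k n)) (\<lambda>_. 0) + ky_fan (simple_int (g n)) X) \<longlonglongrightarrow> 0"
      using tendsto_add[OF K0 G0] by simp
  qed (auto simp: le ky_fan_nonneg)
qed

end

section \<open>Second moments of centred integrals\<close>

lemma tendsto_scaled_cos:
  "(\<lambda>n. 2 * (1 - cos (x / real (Suc n))) * (real (Suc n))\<^sup>2) \<longlonglongrightarrow> x\<^sup>2"
proof -
  have "((\<lambda>h. sin (x / 2 * h)) has_real_derivative x / 2) (at 0)"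
    by (auto intro!: derivative_eq_intros)
  then have "((\<lambda>h. sin (x / 2 * h) / h) \<longlongrightarrow> x / 2) (at 0)"
    by (simp add: DERIV_def)
  moreover have "filterlim (\<lambda>n. inverse (real (Suc n))) (at 0) sequentially"
    using LIMSEQ_inverse_real_of_nat by (auto simp: filterlim_at)
  ultimately have "(\<lambda>n. sin (x / 2 * inverse (real (Suc n))) / inverse (real (Suc n))) \<longlonglongrightarrow> x / 2"
    by (rule filterlim_compose)
  then have "(\<lambda>n. 4 * (sin (x / 2 * inverse (real (Suc n))) / inverse (real (Suc n)))\<^sup>2) \<longlonglongrightarrow> 4 * (x / 2)\<^sup>2"
    by (rule tendsto_mult[OF tendsto_const tendsto_power])
  moreover have "4 * (sin (x / 2 * inverse (real (Suc n))) / inverse (real (Suc n)))\<^sup>2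
      = 2 * (1 - cos (x / real (Suc n))) * (real (Suc n))\<^sup>2" for n
  proof -
    have eq: "2 * (x / 2 * inverse (real (Suc n))) = x / real (Suc n)"
      by (simp only: divide_inverse) (simp del: of_nat_Suc)
    have "cos (x / real (Suc n)) = 1 - 2 * (sin (x / 2 * inverse (real (Suc n))))\<^sup>2"
      using cos_double_sin[of "x / 2 * inverse (real (Suc n))"] unfolding eq .
    moreover have "4 * (s / inverse N)\<^sup>2 = 2 * (1 - (1 - 2 * s\<^sup>2)) * N\<^sup>2" for s N :: real
      by (simp add: divide_inverse power_mult_distrib)
    ultimately show ?thesis by (simp only:)
  qed
  ultimately show ?thesis by (simp add: power_divide)
qed

context prob_space
begin

lemma Re_char_distr:
  assumes [measurable]: "X \<in> borel_measurable M"
  shows "Re (char (distr M borel X) u) = expectation (\<lambda>\<omega>. cos (u * X \<omega>))"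
proof -
  have "complex_integrable M (\<lambda>\<omega>. iexp (u * X \<omega>))" by (rule integrable_const_bound[of _ 1]) auto
  then have "Re (CLINT \<omega>|M. iexp (u * X \<omega>)) = expectation (\<lambda>\<omega>. Re (iexp (u * X \<omega>)))"
    by (rule integral_Re[symmetric])
  then show ?thesis by (simp add: char_def integral_distr Re_exp)
qed

text \<open>
  Fatou's lemma for \<open>2 * (1 - cos (u * X)) / u\<^sup>2\<close>, which tends to \<open>X\<^sup>2\<close> as \<open>u \<rightarrow> 0\<close>.
\<close>

lemma second_moment_le_of_char:
  assumes [measurable]: "X \<in> borel_measurable M"
    and bound: "\<And>u. norm (1 - char (distr M borel X) u) \<le> A * u\<^sup>2 / 2"
  shows "(\<integral>\<^sup>+\<omega>. ennreal ((X \<omega>)\<^sup>2) \<partial>M) \<le> ennreal A"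
proof -
  let ?f = "\<lambda>n \<omega>. 2 * (1 - cos (X \<omega> / real (Suc n))) * (real (Suc n))\<^sup>2"
  have le: "(\<integral>\<^sup>+\<omega>. ennreal (?f n \<omega>) \<partial>M) \<le> ennreal A" for n
  proof -
    let ?u = "1 / real (Suc n)"
    have ic: "integrable M (\<lambda>\<omega>. cos (X \<omega> / real (Suc n)))" by (rule integrable_const_bound[of _ 1]) auto
    have "(\<integral>\<^sup>+\<omega>. ennreal (?f n \<omega>) \<partial>M) = ennreal (expectation (?f n))"
      using ic by (intro nn_integral_eq_integral) (auto intro!: AE_I2 mult_nonneg_nonneg)
    also have "expectation (?f n) = 2 * (1 - Re (char (distr M borel X) ?u)) * (real (Suc n))\<^sup>2"
      using ic by (simp add: Re_char_distr prob_space del: of_nat_Suc)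
    also have "\<dots> \<le> 2 * (A * ?u\<^sup>2 / 2) * (real (Suc n))\<^sup>2"
      using bound[of ?u] abs_Re_le_cmod[of "1 - char (distr M borel X) ?u"]
      by (intro mult_right_mono mult_left_mono) auto
    also have "\<dots> = A" by (simp add: power_divide del: of_nat_Suc)
    finally show ?thesis by (simp add: ennreal_leI)
  qed
  have "(\<integral>\<^sup>+\<omega>. ennreal ((X \<omega>)\<^sup>2) \<partial>M) = (\<integral>\<^sup>+\<omega>. liminf (\<lambda>n. ennreal (?f n \<omega>)) \<partial>M)"
  proof (intro nn_integral_cong)
    fix \<omega>
    have "(\<lambda>n. ennreal (?f n \<omega>)) \<longlonglongrightarrow> ennreal ((X \<omega>)\<^sup>2)"
      by (intro tendsto_ennrealI tendsto_scaled_cos)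
    then show "ennreal ((X \<omega>)\<^sup>2) = liminf (\<lambda>n. ennreal (?f n \<omega>))"
      by (rule lim_imp_Liminf[OF sequentially_bot, symmetric])
  qed
  also have "\<dots> \<le> liminf (\<lambda>n. \<integral>\<^sup>+\<omega>. ennreal (?f n \<omega>) \<partial>M)"
    by (rule nn_integral_liminf) measurable
  also have "\<dots> \<le> liminf (\<lambda>n::nat. ennreal A)"
    by (intro Liminf_mono always_eventually allI le)
  also have "\<dots> = ennreal A" by (simp add: Liminf_const)
  finally show ?thesis .
qed

lemma L1_le_of_second_moment:
  assumes [measurable]: "X \<in> borel_measurable M" and A: "0 \<le> A"
    and bound: "(\<integral>\<^sup>+\<omega>. ennreal ((X \<omega>)\<^sup>2) \<partial>M) \<le> ennreal A"
  shows "integrable M X" "(expectation (\<lambda>\<omega>. \<bar>X \<omega>\<bar>))\<^sup>2 \<le> A"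
proof -
  have sq: "integrable M (\<lambda>\<omega>. (X \<omega>)\<^sup>2)"
    using bound by (intro integrableI_bounded) (auto simp: order_le_less_trans)
  have sq': "integrable M (\<lambda>\<omega>. \<bar>X \<omega>\<bar>\<^sup>2)" using sq by simp
  show X: "integrable M X" by (rule square_integrable_imp_integrable[OF _ sq]) simp
  have "0 \<le> variance (\<lambda>\<omega>. \<bar>X \<omega>\<bar>)" by (rule variance_positive)
  also have "\<dots> = expectation (\<lambda>\<omega>. \<bar>X \<omega>\<bar>\<^sup>2) - (expectation (\<lambda>\<omega>. \<bar>X \<omega>\<bar>))\<^sup>2"
    by (rule variance_eq) (use X sq' in auto)
  finally have "(expectation (\<lambda>\<omega>. \<bar>X \<omega>\<bar>))\<^sup>2 \<le> expectation (\<lambda>\<omega>. (X \<omega>)\<^sup>2)" by simp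
  moreover have "ennreal (expectation (\<lambda>\<omega>. (X \<omega>)\<^sup>2)) \<le> ennreal A"
    using bound by (subst nn_integral_eq_integral[symmetric]) (auto simp: sq)
  ultimately show "(expectation (\<lambda>\<omega>. \<bar>X \<omega>\<bar>))\<^sup>2 \<le> A" using A by (simp add: ennreal_le_iff)
qed

end

context square_integrable_levy_basis
begin

text \<open>
  Under centering, drift and compensator combine to the full compensator \<open>\<i> * u * x\<close>, so the first order
  term of the exponent vanishes.
\<close>

lemma exponent_centered_le:
  assumes centered: "\<gamma> + (LINT x:{x. \<bar>x\<bar> > 1}|\<nu>. x) = 0"
  shows "norm (exponent u) \<le> (\<Sigma> + (LINT x|\<nu>. x\<^sup>2)) * (u\<^sup>2 / 2)"
proof -
  let ?big = "\<lambda>x. indicator {x. \<bar>x\<bar> > 1} x *\<^sub>R x :: real"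
  have sq: "\<bar>x\<bar> \<le> x\<^sup>2" if "\<bar>x\<bar> > 1" for x :: real
    using that mult_right_mono[of 1 "\<bar>x\<bar>" "\<bar>x\<bar>"] by (auto simp: power2_eq_square)
  have ib: "integrable \<nu> ?big"
    by (rule integrable_nu_of_square_bound[where K=1]) (use sq in \<open>auto simp: indicator_def\<close>)
  have i2: "complex_integrable \<nu> (\<lambda>x. \<i> * of_real (u * ?big x))"
    using ib by (intro integrable_mult_right integrable_of_real) auto
  have pw: "(iexp (u * x) - 1 - \<i> * of_real (u * x * indicator {0..1} \<bar>x\<bar>)) - \<i> * of_real (u * ?big x)
      = iexp (u * x) - 1 - \<i> * of_real (u * x)" for x
    by (cases "\<bar>x\<bar> \<le> 1") (auto simp: indicator_def)
  have i3: "complex_integrable \<nu> (\<lambda>x. iexp (u * x) - 1 - \<i> * of_real (u * x))"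
    using Bochner_Integration.integrable_diff[OF integrable_compensated[of u] i2] by (simp only: pw)
  have "(CLINT x|\<nu>. \<i> * of_real (u * ?big x)) = \<i> * of_real (u * (LINT x:{x. \<bar>x\<bar> > 1}|\<nu>. x))"
    by (simp only: integral_mult_right_zero integral_complex_of_real set_lebesgue_integral_def)
  also have "(LINT x:{x. \<bar>x\<bar> > 1}|\<nu>. x) = - \<gamma>" using centered by simp
  finally have drift: "(CLINT x|\<nu>. \<i> * of_real (u * ?big x)) = - (\<i> * of_real (\<gamma> * u))"
    by (simp add: mult.commute)
  have "(CLINT x|\<nu>. iexp (u * x) - 1 - \<i> * of_real (u * x))
     = (CLINT x|\<nu>. iexp (u * x) - 1 - \<i> * of_real (u * x * indicator {0..1} \<bar>x\<bar>))
       - (CLINT x|\<nu>. \<i> * of_real (u * ?big x))"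
    by (subst Bochner_Integration.integral_diff[OF integrable_compensated i2, symmetric]) (simp only: pw)
  then have eq: "exponent u = (CLINT x|\<nu>. iexp (u * x) - 1 - \<i> * of_real (u * x)) - of_real (\<Sigma> * u\<^sup>2 / 2)"
    unfolding levy_exponent_def drift by simp
  have "norm (CLINT x|\<nu>. iexp (u * x) - 1 - \<i> * of_real (u * x)) \<le> (\<integral>x. u\<^sup>2 / 2 * x\<^sup>2 \<partial>\<nu>)"
  proof (rule order_trans[OF integral_norm_bound integral_mono])
    fix x
    show "norm (iexp (u * x) - 1 - \<i> * of_real (u * x)) \<le> u\<^sup>2 / 2 * x\<^sup>2"
      using norm_iexp_minus_1_minus_le[of "u * x"] by (simp add: power_mult_distrib)
  qed (use i3 integrable_square_nu in auto)
  also have "\<dots> = u\<^sup>2 / 2 * (\<integral>x. x\<^sup>2 \<partial>\<nu>)" by simp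
  finally have "norm (exponent u) \<le> u\<^sup>2 / 2 * (\<integral>x. x\<^sup>2 \<partial>\<nu>) + norm (complex_of_real (\<Sigma> * u\<^sup>2 / 2))"
    unfolding eq using norm_triangle_ineq4 by (meson add_right_mono order_trans)
  also have "norm (complex_of_real (\<Sigma> * u\<^sup>2 / 2)) = \<Sigma> * u\<^sup>2 / 2"
    unfolding norm_of_real using Sigma_nonneg by simp
  finally show ?thesis by (simp add: algebra_simps)
qed

theorem moment_bound_centered:
  assumes centered: "\<gamma> + (LINT x:{x. \<bar>x\<bar> > 1}|\<nu>. x) = 0"
  shows "moment_bound 2 (\<Sigma> + (LINT x|\<nu>. x\<^sup>2))"
proof -
  define S where "S = \<Sigma> + (LINT x|\<nu>. x\<^sup>2)"
  have S: "0 \<le> S" using Sigma_nonneg by (simp add: S_def)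
  have "integrable M (simple_int g) \<and>
        (expectation (\<lambda>\<omega>. \<bar>simple_int g \<omega>\<bar>)) ^ 2 \<le> S * (\<integral>z. \<bar>g z\<bar> ^ 2 \<partial>control)"
    if g: "levy_simple g" for g
  proof -
    have g2: "integrable control (\<lambda>z. \<bar>g z\<bar>\<^sup>2)" by (rule integrable_levy_simple_power[OF g]) simp
    have I: "0 \<le> (\<integral>z. \<bar>g z\<bar>\<^sup>2 \<partial>control)" by simp
    have "norm (1 - char (distr M borel (simple_int g)) u) \<le> S * (\<integral>z. \<bar>g z\<bar>\<^sup>2 \<partial>control) * u\<^sup>2 / 2" for u
    proof -
      have "norm (char (distr M borel (simple_int g)) u - 1) \<le> norm (CLINT z|control. exponent (u * g z))"
        unfolding char_simple_int[OF g] by (rule norm_exp_minus_1_le[OF Re_integral_exponent_nonpos[OF g]])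
      also have "\<dots> \<le> (\<integral>z. S * u\<^sup>2 / 2 * \<bar>g z\<bar>\<^sup>2 \<partial>control)"
      proof (rule order_trans[OF integral_norm_bound integral_mono])
        show "integrable control (\<lambda>z. norm (exponent (u * g z)))"
          using integrable_exponent_simple[OF g] by (rule integrable_norm)
        fix z
        show "norm (exponent (u * g z)) \<le> S * u\<^sup>2 / 2 * \<bar>g z\<bar>\<^sup>2"
          using exponent_centered_le[OF centered, of "u * g z"] by (simp add: S_def power_mult_distrib)
      qed (use g2 in auto)
      also have "\<dots> = S * (\<integral>z. \<bar>g z\<bar>\<^sup>2 \<partial>control) * u\<^sup>2 / 2" by simp
      finally show ?thesis by (simp add: norm_minus_commute)
    qed
    from second_moment_le_of_char[OF measurable_simple_int[OF g] this]
    show ?thesis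
      using L1_le_of_second_moment[OF measurable_simple_int[OF g] mult_nonneg_nonneg[OF S I]] by blast
  qed
  then show ?thesis using S unfolding moment_bound_def S_def by simp
qed

end

section \<open>Absolute values through characteristic functions\<close>

lemma one_minus_cos_le: "1 - cos (x::real) \<le> x\<^sup>2 / 2"
proof -
  have "norm (iexp x - 1 - \<i> * of_real x) \<le> x\<^sup>2 / 2"
    by (rule norm_iexp_minus_1_minus_le)
  moreover have "\<bar>Re (iexp x - 1 - \<i> * of_real x)\<bar> \<le> norm (iexp x - 1 - \<i> * of_real x)"
    by (rule abs_Re_le_cmod)
  ultimately show ?thesis by (simp add: Re_exp)
qed

lemma integrable_inverse_1_plus_square:
  "integrable lborel (\<lambda>u::real. indicator {0<..} u * (1 / (1 + u\<^sup>2)))"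
proof -
  have "interval_lebesgue_integrable lborel 0 \<infinity> (\<lambda>x. 1 / (1 + x\<^sup>2) :: real)"
    using integrable_I0i_1_div_plus_square .
  then show ?thesis
    by (simp add: interval_lebesgue_integrable_def set_integrable_def
        einterval_def greaterThan_def zero_ereal_def)
qed

text \<open>
  The integral has the value \<open>pi / 2\<close>, which cancels in every use.
\<close>

definition abs_const :: real where
  "abs_const = enn2real (\<integral>\<^sup>+u. ennreal ((1 - cos u) / u\<^sup>2) * indicator {0<..} u \<partial>lborel)"

lemma abs_const:
  shows abs_const_pos: "0 < abs_const"
    and nn_integral_abs_const: "(\<integral>\<^sup>+u. ennreal ((1 - cos u) / u\<^sup>2) * indicator {0<..} u \<partial>lborel) = ennreal abs_const"
proof -
  let ?I = "\<integral>\<^sup>+u. ennreal ((1 - cos u) / u\<^sup>2) * indicator {0<..} u \<partial>lborel"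
  have le: "(1 - cos u) / u\<^sup>2 \<le> 4 / (1 + u\<^sup>2)" if "0 < u" for u :: real
  proof (cases "u \<le> 1")
    case True
    have "(1 - cos u) / u\<^sup>2 \<le> 1 / 2"
      using one_minus_cos_le[of u] that by (simp add: field_simps)
    also have "\<dots> \<le> 4 / (1 + u\<^sup>2)"
      using True that power_le_one[of u 2] by (simp add: field_simps add_pos_nonneg)
    finally show ?thesis .
  next
    case False
    then have u: "1 \<le> u\<^sup>2" by simp
    have "(1 - cos u) / u\<^sup>2 \<le> 2 / u\<^sup>2"
      using that by (intro divide_right_mono) auto
    also have "\<dots> \<le> 4 / (1 + u\<^sup>2)"
      using u that by (simp add: field_simps add_pos_nonneg)
    finally show ?thesis .
  qed
  have "?I \<le> (\<integral>\<^sup>+u. ennreal (4 * (indicator {0<..} u * (1 / (1 + u\<^sup>2)))) \<partial>lborel)"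
    by (intro nn_integral_mono) (auto simp: indicator_def le intro!: ennreal_leI)
  also have "\<dots> < \<infinity>"
    using integrable_mult_right[OF integrable_inverse_1_plus_square, of 4]
    by (subst nn_integral_eq_integral) auto
  finally have fin: "?I < \<infinity>" .
  then show *: "?I = ennreal abs_const" unfolding abs_const_def by (simp add: less_top)
  have c: "cos 1 < (1::real)" using cos_monotone_0_pi[of 0 1] pi_gt3 by simp
  have "ennreal ((1 - cos 1) / 4) = (\<integral>\<^sup>+u. ennreal ((1 - cos 1) / 4) * indicator {1..2::real} u \<partial>lborel)"
    by (subst nn_integral_cmult_indicator) auto
  also have "\<dots> \<le> ?I"
  proof (intro nn_integral_mono)
    fix u :: real
    have "(1 - cos 1) / 4 \<le> (1 - cos u) / u\<^sup>2" if u: "1 \<le> u" "u \<le> 2"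
    proof -
      have "cos u \<le> cos 1" using u pi_gt3 by (intro cos_monotone_0_pi_le) auto
      moreover have "u\<^sup>2 \<le> 2\<^sup>2" using u by (intro power_mono) auto
      ultimately show ?thesis using u c by (intro frac_le) auto
    qed
    then show "ennreal ((1 - cos 1) / 4) * indicator {1..2} u \<le> ennreal ((1 - cos u) / u\<^sup>2) * indicator {0<..} u"
      by (auto simp: indicator_def intro!: ennreal_leI)
  qed
  finally have "ennreal ((1 - cos 1) / 4) \<le> ennreal abs_const" unfolding * .
  moreover have "0 < ennreal ((1 - cos 1) / 4)" using c by simp
  ultimately have "0 < ennreal abs_const" by (rule order.strict_trans2[rotated])
  then show "0 < abs_const" by simp
qed

text \<open>
  Substitution of \<open>\<bar>x\<bar> * u\<close>.
\<close>

lemma nn_integral_one_minus_cos: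
  "(\<integral>\<^sup>+u. ennreal ((1 - cos (u * x)) / u\<^sup>2) * indicator {0<..} u \<partial>lborel) = ennreal \<bar>x\<bar> * ennreal abs_const"
proof (cases "x = 0")
  case False
  let ?f = "\<lambda>v. ennreal ((1 - cos v) / v\<^sup>2) * indicator {0<..} v"
  let ?J = "\<integral>\<^sup>+u. ennreal ((1 - cos (u * x)) / u\<^sup>2) * indicator {0<..} u \<partial>lborel"
  have eq: "?f (0 + \<bar>x\<bar> * u) = ennreal (1 / x\<^sup>2) * (ennreal ((1 - cos (u * x)) / u\<^sup>2) * indicator {0<..} u)" for u
  proof -
    have "cos (\<bar>x\<bar> * u) = cos (u * x)" by (cases "x < 0") (auto simp: mult.commute)
    then show ?thesis
      using False by (auto simp: indicator_def zero_less_mult_iff power_mult_distrib mult.commute simp flip: ennreal_mult')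
  qed
  have "ennreal abs_const = ennreal \<bar>x\<bar> * (\<integral>\<^sup>+u. ?f (0 + \<bar>x\<bar> * u) \<partial>lborel)"
    unfolding nn_integral_abs_const[symmetric]
    using nn_integral_real_affine[of ?f "\<bar>x\<bar>" 0] False by simp
  also have "\<dots> = ennreal \<bar>x\<bar> * (ennreal (1 / x\<^sup>2) * ?J)"
    unfolding eq by (subst nn_integral_cmult) auto
  finally have "ennreal \<bar>x\<bar> * ennreal abs_const = (ennreal \<bar>x\<bar> * ennreal \<bar>x\<bar> * ennreal (1 / x\<^sup>2)) * ?J"
    by (simp only: mult.assoc)
  also have "ennreal \<bar>x\<bar> * ennreal \<bar>x\<bar> * ennreal (1 / x\<^sup>2) = ennreal (\<bar>x\<bar> * \<bar>x\<bar> * (1 / x\<^sup>2))"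
    by (simp only: ennreal_mult'[OF abs_ge_zero] ennreal_mult'[OF mult_nonneg_nonneg[OF abs_ge_zero abs_ge_zero]])
  also have "\<bar>x\<bar> * \<bar>x\<bar> * (1 / x\<^sup>2) = 1" using False by (simp add: power2_eq_square abs_mult_self_eq)
  finally show ?thesis by simp
qed simp

text \<open>
  Tonelli's theorem. It is applied to a random variable, where the inner integral is
  \<open>1 - Re\<close> of its characteristic function, and to the identity under the Levy measure.
\<close>

lemma (in sigma_finite_measure) nn_integral_abs_as_cos:
  assumes [measurable]: "X \<in> borel_measurable M"
  shows "(\<integral>\<^sup>+\<omega>. ennreal \<bar>X \<omega>\<bar> \<partial>M) * ennreal abs_const
    = (\<integral>\<^sup>+u. ennreal (1 / u\<^sup>2) * indicator {0<..} u * (\<integral>\<^sup>+\<omega>. ennreal (1 - cos (u * X \<omega>)) \<partial>M) \<partial>lborel)"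
proof -
  interpret P: pair_sigma_finite M lborel ..
  have "(\<integral>\<^sup>+\<omega>. ennreal \<bar>X \<omega>\<bar> \<partial>M) * ennreal abs_const = (\<integral>\<^sup>+\<omega>. ennreal \<bar>X \<omega>\<bar> * ennreal abs_const \<partial>M)"
    by (rule nn_integral_multc[symmetric]) simp
  also have "\<dots> = (\<integral>\<^sup>+\<omega>. (\<integral>\<^sup>+u. ennreal ((1 - cos (u * X \<omega>)) / u\<^sup>2) * indicator {0<..} u \<partial>lborel) \<partial>M)"
    by (simp only: nn_integral_one_minus_cos)
  also have "\<dots> = (\<integral>\<^sup>+u. (\<integral>\<^sup>+\<omega>. ennreal ((1 - cos (u * X \<omega>)) / u\<^sup>2) * indicator {0<..} u \<partial>M) \<partial>lborel)"
    by (rule P.Fubini'[symmetric]) measurable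
  also have "\<dots> = (\<integral>\<^sup>+u. ennreal (1 / u\<^sup>2) * indicator {0<..} u * (\<integral>\<^sup>+\<omega>. ennreal (1 - cos (u * X \<omega>)) \<partial>M) \<partial>lborel)"
  proof (rule nn_integral_cong)
    fix u :: real
    have "(\<integral>\<^sup>+\<omega>. ennreal ((1 - cos (u * X \<omega>)) / u\<^sup>2) * indicator {0<..} u \<partial>M)
        = (\<integral>\<^sup>+\<omega>. (ennreal (1 / u\<^sup>2) * indicator {0<..} u) * ennreal (1 - cos (u * X \<omega>)) \<partial>M)"
      by (intro nn_integral_cong) (auto simp: indicator_def simp flip: ennreal_mult')
    also have "\<dots> = ennreal (1 / u\<^sup>2) * indicator {0<..} u * (\<integral>\<^sup>+\<omega>. ennreal (1 - cos (u * X \<omega>)) \<partial>M)"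
      by (rule nn_integral_cmult) measurable
    finally show "(\<integral>\<^sup>+\<omega>. ennreal ((1 - cos (u * X \<omega>)) / u\<^sup>2) * indicator {0<..} u \<partial>M) = \<dots>" .
  qed
  finally show ?thesis .
qed

text \<open>
  Splits the contribution of an infinitely divisible law to its first moment: \<open>- a\<close> is linear in the
  size of the set and yields the moment of the Levy measure, and the second term is of smaller order.
\<close>

lemma one_minus_Re_exp_le:
  assumes "a \<le> 0"
  shows "1 - exp a * cos b \<le> - a + min (b\<^sup>2 / 2) (2::real)"
proof -
  have e: "1 + a \<le> exp a" "exp a \<le> 1" using assms by auto
  have "exp a * (1 - cos b) \<le> 1 * (1 - cos b)" using e by (intro mult_right_mono) auto
  also have "\<dots> \<le> min (b\<^sup>2 / 2) 2" using one_minus_cos_le[of b] cos_ge_minus_one[of b] by (simp add: min_def)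
  finally have "exp a * (1 - cos b) \<le> min (b\<^sup>2 / 2) 2" .
  moreover have "1 - exp a * cos b = (1 - exp a) + exp a * (1 - cos b)" by (simp add: right_diff_distrib)
  ultimately show ?thesis using e(1) by linarith
qed

section \<open>First moments of integrals of finite variation\<close>

context square_integrable_levy_basis
begin

text \<open>
  Chebyshev's inequality away from \<open>0\<close>, and \<open>{0}\<close> is a null set.
\<close>

lemma sigma_finite_nu: "sigma_finite_measure \<nu>"
proof
  let ?A = "\<lambda>n. {x::real. 1 / real (Suc n) \<le> \<bar>x\<bar>}"
  have "emeasure \<nu> (?A n) \<noteq> \<infinity>" for n
  proof -
    have "indicator (?A n) x \<le> ennreal ((real (Suc n))\<^sup>2 * x\<^sup>2)" for x
    proof (cases "x \<in> ?A n")
      case True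
      then have "1 \<le> real (Suc n) * \<bar>x\<bar>" by (simp add: field_simps)
      then have "1 \<le> (real (Suc n) * \<bar>x\<bar>)\<^sup>2" by (rule one_le_power)
      then show ?thesis using True by (simp add: power_mult_distrib del: of_nat_Suc)
    qed simp
    then have "(\<integral>\<^sup>+x. indicator (?A n) x \<partial>\<nu>) \<le> (\<integral>\<^sup>+x. ennreal ((real (Suc n))\<^sup>2 * x\<^sup>2) \<partial>\<nu>)"
      by (rule nn_integral_mono)
    moreover have "(\<integral>\<^sup>+x. indicator (?A n) x \<partial>\<nu>) = emeasure \<nu> (?A n)"
      by (rule nn_integral_indicator) (simp add: sets_nu)
    ultimately have "emeasure \<nu> (?A n) \<le> (\<integral>\<^sup>+x. ennreal ((real (Suc n))\<^sup>2 * x\<^sup>2) \<partial>\<nu>)" by simp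
    also have "\<dots> < \<infinity>"
      using integrable_square_nu by (subst nn_integral_eq_integral) auto
    finally show ?thesis by simp
  qed
  moreover have "\<exists>n. x \<in> ?A n" if x0: "x \<noteq> 0" for x
  proof -
    obtain n where "inverse (real (Suc n)) < \<bar>x\<bar>" using reals_Archimedean[of "\<bar>x\<bar>"] x0 by auto
    then show ?thesis by (auto simp: inverse_eq_divide intro!: exI[of _ n])
  qed
  ultimately show "\<exists>A. countable A \<and> A \<subseteq> sets \<nu> \<and> \<Union> A = space \<nu> \<and> (\<forall>a\<in>A. emeasure \<nu> a \<noteq> \<infinity>)"
    using nu_zero by (intro exI[of _ "insert {0} (range ?A)"]) auto
qed

end

locale finite_variation_levy_basis = square_integrable_levy_basis +
  assumes fv: "integrable \<nu> (\<lambda>x. \<bar>x\<bar>)" and no_gauss: "\<Sigma> = 0"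
begin

sublocale nu: sigma_finite_measure \<nu> by (rule sigma_finite_nu)

definition drift :: real where "drift = \<gamma> - (LINT x:{x. \<bar>x\<bar> \<le> 1}|\<nu>. x)"

definition jump_mean :: real where "jump_mean = (LINT x|\<nu>. \<bar>x\<bar>)"

definition jump_exponent :: "real \<Rightarrow> complex" where
  "jump_exponent u = (CLINT x|\<nu>. iexp (u * x) - 1)"

lemma jump_mean_nonneg: "0 \<le> jump_mean"
  by (simp add: jump_mean_def)

lemma integrable_jump_integrand: "complex_integrable \<nu> (\<lambda>x. iexp (u * x) - 1)"
proof (rule Bochner_Integration.integrable_bound)
  show "integrable \<nu> (\<lambda>x. \<bar>u\<bar> * \<bar>x\<bar>)" using fv by simp
  show "AE x in \<nu>. norm (iexp (u * x) - 1) \<le> norm (\<bar>u\<bar> * \<bar>x\<bar>)"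
  proof (intro AE_I2)
    fix x show "norm (iexp (u * x) - 1) \<le> norm (\<bar>u\<bar> * \<bar>x\<bar>)"
      using norm_iexp_minus_1_le[of "u * x"] by (simp add: abs_mult)
  qed
qed measurable

lemma exponent_finite_variation: "exponent u = \<i> * of_real (drift * u) + jump_exponent u"
proof -
  let ?s = "\<lambda>x. indicator {x. \<bar>x\<bar> \<le> 1} x *\<^sub>R x :: real"
  have small: "integrable \<nu> ?s"
    by (rule Bochner_Integration.integrable_bound[OF fv]) (auto simp: indicator_def)
  have i2: "complex_integrable \<nu> (\<lambda>x. \<i> * of_real (u * ?s x))"
    using small by (intro integrable_mult_right integrable_of_real) auto
  have "(CLINT x|\<nu>. iexp (u * x) - 1 - \<i> * of_real (u * x * indicator {0..1} \<bar>x\<bar>))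
      = (CLINT x|\<nu>. (iexp (u * x) - 1) - \<i> * of_real (u * ?s x))"
    by (intro Bochner_Integration.integral_cong) (auto simp: indicator_def)
  also have "\<dots> = jump_exponent u - (CLINT x|\<nu>. \<i> * of_real (u * ?s x))"
    unfolding jump_exponent_def by (rule Bochner_Integration.integral_diff[OF integrable_jump_integrand i2])
  also have "(CLINT x|\<nu>. \<i> * of_real (u * ?s x)) = \<i> * of_real (u * (LINT x:{x. \<bar>x\<bar> \<le> 1}|\<nu>. x))"
    by (simp only: integral_mult_right_zero integral_complex_of_real set_lebesgue_integral_def)
  finally show ?thesis
    by (simp add: levy_exponent_def no_gauss drift_def algebra_simps)
qed

lemma Re_jump_exponent: "Re (jump_exponent u) = - (\<integral>x. 1 - cos (u * x) \<partial>\<nu>)"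
proof -
  have "Re (jump_exponent u) = (\<integral>x. Re (iexp (u * x) - 1) \<partial>\<nu>)"
    unfolding jump_exponent_def by (rule integral_Re[OF integrable_jump_integrand, symmetric])
  also have "\<dots> = (\<integral>x. - (1 - cos (u * x)) \<partial>\<nu>)"
    by (intro Bochner_Integration.integral_cong) (auto simp: Re_exp)
  finally show ?thesis by (simp only: Bochner_Integration.integral_minus)
qed

lemma Re_jump_exponent_nonpos: "Re (jump_exponent u) \<le> 0"
  unfolding Re_jump_exponent by simp

lemma Im_jump_exponent: "Im (jump_exponent u) = (\<integral>x. sin (u * x) \<partial>\<nu>)"
proof -
  have "Im (jump_exponent u) = (\<integral>x. Im (iexp (u * x) - 1) \<partial>\<nu>)"
    unfolding jump_exponent_def by (rule integral_Im[OF integrable_jump_integrand, symmetric])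
  then show ?thesis by (simp add: Im_exp)
qed

lemma measurable_Im_jump [measurable]: "(\<lambda>u. Im (jump_exponent u)) \<in> borel_measurable borel"
  unfolding Im_jump_exponent by measurable

lemma integrable_sin_nu: "integrable \<nu> (\<lambda>x. sin (u * x))"
  by (rule Bochner_Integration.integrable_bound[OF integrable_mult_right[OF fv, of u]])
     (auto simp: abs_mult intro!: AE_I2 order_trans[OF abs_sin_x_le_abs_x])

lemma abs_Im_jump_le: "\<bar>Im (jump_exponent u)\<bar> \<le> jump_mean * \<bar>u\<bar>"
proof -
  have "\<bar>Im (jump_exponent u)\<bar> \<le> (\<integral>x. \<bar>u\<bar> * \<bar>x\<bar> \<partial>\<nu>)"
    unfolding Im_jump_exponent real_norm_def[symmetric]
  proof (rule order_trans[OF integral_norm_bound integral_mono])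
    show "norm (sin (u * x)) \<le> norm u * norm x" for x
      using abs_sin_x_le_abs_x[of "u * x"] by (simp add: abs_mult)
  qed (use integrable_sin_nu fv in auto)
  then show ?thesis by (simp add: jump_mean_def mult.commute)
qed

text \<open>
  The first moment of \<open>\<Lambda> B\<close> is an integral over \<open>u\<close> of \<open>1 - Re\<close> of a characteristic function. This bounds
  the error of replacing that function by its linear part, \<open>e\<close> being the control measure of \<open>B\<close>.
\<close>

definition remainder :: "real \<Rightarrow> ennreal" where
  "remainder e = (\<integral>\<^sup>+u. ennreal (1 / u\<^sup>2) * indicator {0<..} u
     * ennreal (min ((e * Im (jump_exponent u))\<^sup>2 / 2) 2) \<partial>lborel)"

text \<open>
  The imaginary part is the integral of \<open>sin (u * x)\<close>, and \<open>sin (u * x) / u\<close> tends to \<open>0\<close> while being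
  dominated by \<open>\<bar>x\<bar>\<close>.
\<close>

lemma Im_jump_sublinear:
  assumes "0 < v"
  shows "((\<lambda>s. Im (jump_exponent (v * s)) / s) \<longlongrightarrow> 0) at_top"
proof -
  have "((\<lambda>s. \<integral>x. sin (v * s * x) / s \<partial>\<nu>) \<longlongrightarrow> (\<integral>x. 0 \<partial>\<nu>)) at_top"
  proof (rule integral_dominated_convergence_at_top[where w="\<lambda>x. v * \<bar>x\<bar>"])
    show "integrable \<nu> (\<lambda>x. v * \<bar>x\<bar>)" using fv by simp
    show "\<forall>\<^sub>F s in at_top. AE x in \<nu>. norm (sin (v * s * x) / s) \<le> v * \<bar>x\<bar>"
      using eventually_gt_at_top[of 0]
    proof eventually_elim
      case (elim s)
      have "norm (sin (v * s * x) / s) \<le> v * \<bar>x\<bar>" for x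
        using abs_sin_x_le_abs_x[of "v * s * x"] elim assms by (simp add: abs_mult field_simps)
      then show ?case by simp
    qed
    show "AE x in \<nu>. ((\<lambda>s. sin (v * s * x) / s) \<longlongrightarrow> 0) at_top"
    proof (intro AE_I2)
      fix x
      have "((\<lambda>s::real. 1 / s) \<longlongrightarrow> 0) at_top" by (rule tendsto_divide_0[OF tendsto_const]) (auto intro: filterlim_at_top_imp_at_infinity filterlim_ident)
      moreover have "\<forall>\<^sub>F s in at_top. norm (sin (v * s * x) / s) \<le> 1 / s"
        using eventually_gt_at_top[of 0] by eventually_elim (simp add: divide_right_mono)
      ultimately show "((\<lambda>s. sin (v * s * x) / s) \<longlongrightarrow> 0) at_top"
        by (rule Lim_null_comparison[rotated])
    qed
  qed measurable
  then show ?thesis by (simp add: Im_jump_exponent)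
qed

text \<open>
  After the substitution \<open>u = v / e\<close> the remainder is \<open>e\<close> times an integral whose integrand tends to \<open>0\<close>
  by sublinearity of the imaginary part, dominated by a multiple of \<open>1 / (1 + v\<^sup>2)\<close>. Bounding the
  imaginary part by \<open>jump_mean * \<bar>u\<bar>\<close> alone would only give order \<open>e\<close>, which would spoil the constant.
\<close>

lemma remainder_small:
  assumes \<eta>: "0 < \<eta>"
  shows "\<exists>\<delta>>0. \<forall>e. 0 \<le> e \<longrightarrow> e < \<delta> \<longrightarrow> remainder e \<le> ennreal (\<eta> * e)"
proof -
  let ?g = "\<lambda>s v. indicator {0<..} v * (1 / v\<^sup>2 * min ((Im (jump_exponent (v * s)) / s)\<^sup>2 / 2) 2) :: real"
  let ?w = "\<lambda>v. (jump_mean\<^sup>2 + 4) * (indicator {0<..} v * (1 / (1 + v\<^sup>2))) :: real"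
  have dom: "norm (?g s v) \<le> ?w v" if s: "0 < s" for s v
  proof (cases "0 < v")
    case True
    have "\<bar>Im (jump_exponent (v * s)) / s\<bar> \<le> jump_mean * v"
      using abs_Im_jump_le[of "v * s"] True s by (simp add: field_simps)
    then have b: "(Im (jump_exponent (v * s)) / s)\<^sup>2 \<le> (jump_mean * v)\<^sup>2"
      by (rule abs_le_square_iff[THEN iffD1, OF order_trans]) simp
    have "1 / v\<^sup>2 * min ((Im (jump_exponent (v * s)) / s)\<^sup>2 / 2) 2 \<le> (jump_mean\<^sup>2 + 4) * (1 / (1 + v\<^sup>2))"
    proof (cases "v \<le> 1")
      case v1: True
      have "1 / v\<^sup>2 * min ((Im (jump_exponent (v * s)) / s)\<^sup>2 / 2) 2 \<le> 1 / v\<^sup>2 * ((jump_mean * v)\<^sup>2 / 2)"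
        using b by (intro mult_left_mono) auto
      also have "\<dots> = jump_mean\<^sup>2 * (1 / 2)" using True by (simp add: power_mult_distrib)
      also have "\<dots> \<le> (jump_mean\<^sup>2 + 4) * (1 / (1 + v\<^sup>2))"
      proof (rule mult_mono)
        have "v\<^sup>2 \<le> 1" using True v1 by (intro power_le_one) auto
        then show "1 / 2 \<le> 1 / (1 + v\<^sup>2)"
          by (intro divide_left_mono) (auto intro!: mult_pos_pos add_pos_nonneg)
      qed auto
      finally show ?thesis .
    next
      case False
      then have v1: "1 \<le> v\<^sup>2" by simp
      have "1 / v\<^sup>2 * min ((Im (jump_exponent (v * s)) / s)\<^sup>2 / 2) 2 \<le> 1 / v\<^sup>2 * 2"
        by (intro mult_left_mono) auto
      also have "1 / v\<^sup>2 * 2 = 4 * (1 / (2 * v\<^sup>2))" by simp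
      also have "\<dots> \<le> 4 * (1 / (1 + v\<^sup>2))"
        using v1 by (intro mult_left_mono divide_left_mono) (auto intro!: mult_pos_pos add_pos_nonneg)
      also have "\<dots> \<le> (jump_mean\<^sup>2 + 4) * (1 / (1 + v\<^sup>2))" by (intro mult_right_mono) auto
      finally show ?thesis .
    qed
    then show ?thesis using True by simp
  qed simp
  have meas [measurable]: "?g s \<in> borel_measurable borel" for s by measurable
  have int: "integrable lborel (?g s)" if "0 < s" for s
  proof (rule Bochner_Integration.integrable_bound)
    show "integrable lborel ?w" by (rule integrable_mult_right[OF integrable_inverse_1_plus_square])
    show "AE v in lborel. norm (?g s v) \<le> norm (?w v)"
      by (intro AE_I2) (rule order_trans[OF dom[OF that]], simp only: real_norm_def abs_ge_self)
  qed measurable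
  have "((\<lambda>s. \<integral>v. ?g s v \<partial>lborel) \<longlongrightarrow> integral\<^sup>L lborel (\<lambda>v::real. 0)) at_top"
  proof (rule integral_dominated_convergence_at_top[where w="?w"])
    show "integrable lborel ?w" by (rule integrable_mult_right[OF integrable_inverse_1_plus_square])
    show "\<forall>\<^sub>F s in at_top. AE v in lborel. norm (?g s v) \<le> ?w v"
      using eventually_gt_at_top[of 0] by eventually_elim (use dom in blast)
    show "AE v in lborel. ((\<lambda>s. ?g s v) \<longlongrightarrow> 0) at_top"
    proof (intro AE_I2)
      fix v :: real
      show "((\<lambda>s. ?g s v) \<longlongrightarrow> 0) at_top"
      proof (cases "0 < v")
        case True
        have "((\<lambda>s. 1 / v\<^sup>2 * min ((Im (jump_exponent (v * s)) / s)\<^sup>2 / 2) 2) \<longlongrightarrow> 1 / v\<^sup>2 * min (0\<^sup>2 / 2) 2) at_top"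
          by (intro tendsto_mult[OF tendsto_const] tendsto_min tendsto_divide tendsto_power Im_jump_sublinear True tendsto_const) simp
        then show ?thesis using True by simp
      qed simp
    qed
  qed measurable
  then have lim: "((\<lambda>s. \<integral>v. ?g s v \<partial>lborel) \<longlongrightarrow> 0) at_top" by simp
  have "\<forall>\<^sub>F s in at_top. (\<integral>v. ?g s v \<partial>lborel) < \<eta>"
    by (rule order_tendstoD(2)[OF lim \<eta>])
  then obtain S where S: "\<And>s. s \<ge> S \<Longrightarrow> (\<integral>v. ?g s v \<partial>lborel) < \<eta>"
    by (auto simp: eventually_at_top_linorder)
  define \<delta> where "\<delta> = 1 / max S 1"
  have "remainder e \<le> ennreal (\<eta> * e)" if e: "0 \<le> e" "e < \<delta>" for e
  proof (cases "e = 0")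
    case False
    with e have e0: "0 < e" by simp
    have m: "0 < max S 1" by simp
    have "e * max S 1 < 1" using e(2) unfolding \<delta>_def pos_less_divide_eq[OF m] .
    then have "max S 1 < 1 / e" unfolding pos_less_divide_eq[OF e0] by (simp only: mult.commute)
    then have s: "S \<le> 1 / e" "0 < 1 / e" using e0 by auto
    have "remainder e = ennreal \<bar>1 / e\<bar> * (\<integral>\<^sup>+v. ennreal (1 / (0 + 1 / e * v)\<^sup>2) * indicator {0<..} (0 + 1 / e * v)
     * ennreal (min ((e * Im (jump_exponent (0 + 1 / e * v)))\<^sup>2 / 2) 2) \<partial>lborel)"
      unfolding remainder_def by (rule nn_integral_real_affine) (use e0 in auto)
    also have "\<dots> = ennreal (1 / e) * (\<integral>\<^sup>+v. ennreal (e\<^sup>2 * ?g (1 / e) v) \<partial>lborel)"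
    proof (intro arg_cong2[where f="(*)"] nn_integral_cong)
      fix v :: real
      show "ennreal (1 / (0 + 1 / e * v)\<^sup>2) * indicator {0<..} (0 + 1 / e * v)
          * ennreal (min ((e * Im (jump_exponent (0 + 1 / e * v)))\<^sup>2 / 2) 2) = ennreal (e\<^sup>2 * ?g (1 / e) v)"
      proof (cases "0 < v")
        case True
        have "1 / (1 / e * v)\<^sup>2 = e\<^sup>2 * (1 / v\<^sup>2)" using e0 by (simp add: power_divide)
        then show ?thesis using True e0
          by (simp add: mult.commute mult.left_commute flip: ennreal_mult)
      qed (use e0 in \<open>auto simp: indicator_def zero_less_divide_iff\<close>)
    qed (use e0 in auto)
    also have "(\<integral>\<^sup>+v. ennreal (e\<^sup>2 * ?g (1 / e) v) \<partial>lborel) = ennreal (e\<^sup>2 * (\<integral>v. ?g (1 / e) v \<partial>lborel))"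
    proof -
      have "(\<integral>\<^sup>+v. ennreal (e\<^sup>2 * ?g (1 / e) v) \<partial>lborel) = ennreal (\<integral>v. e\<^sup>2 * ?g (1 / e) v \<partial>lborel)"
        by (rule nn_integral_eq_integral[OF integrable_mult_right[OF int[OF s(2)]]]) simp
      then show ?thesis by (simp only: integral_mult_right_zero)
    qed
    also have "ennreal (1 / e) * \<dots> = ennreal (e * (\<integral>v. ?g (1 / e) v \<partial>lborel))"
      using e0 by (subst ennreal_mult'[symmetric]) (auto simp: power2_eq_square)
    also have "\<dots> \<le> ennreal (\<eta> * e)"
      using S[OF s(1)] e0 by (intro ennreal_leI) (simp add: mult.commute)
    finally show ?thesis .
  qed (simp add: remainder_def)
  moreover have "0 < \<delta>" by (simp add: \<delta>_def)
  ultimately show ?thesis by blast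
qed

text \<open>
  The deterministic drift is removed first; what is left has characteristic exponent
  \<open>e * jump_exponent\<close>, with nonpositive real part.
\<close>

lemma L1_Lambda_le_remainder:
  assumes B: "B \<in> bounded_borel_sets"
  defines "e \<equiv> measure control B"
  shows "(\<integral>\<^sup>+\<omega>. ennreal \<bar>\<Lambda> B \<omega> - e * drift\<bar> \<partial>M) * ennreal abs_const
    \<le> ennreal (e * jump_mean) * ennreal abs_const + remainder e"
proof -
  have e: "0 \<le> e" by (simp add: e_def)
  note [measurable] = measurable_Lambda[OF B]
  define X where "X \<omega> = \<Lambda> B \<omega> - e * drift" for \<omega>
  have [measurable]: "X \<in> borel_measurable M" unfolding X_def by measurable
  let ?a = "\<lambda>u. e * Re (jump_exponent u)" and ?b = "\<lambda>u. e * Im (jump_exponent u)"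
  have char: "char (distr M borel X) u = exp (of_real e * jump_exponent u)" for u
  proof -
    have "char (distr M borel X) u = (CLINT \<omega>|M. iexp (u * \<Lambda> B \<omega>) * iexp (- (u * (e * drift))))"
      by (auto simp: char_def integral_distr X_def exp_add[symmetric] algebra_simps intro!: Bochner_Integration.integral_cong)
    also have "\<dots> = char (distr M borel (\<Lambda> B)) u * iexp (- (u * (e * drift)))"
      by (simp add: char_def integral_distr)
    also have "\<dots> = exp (of_real e * jump_exponent u)"
      by (simp add: char_Lambda[OF B] exponent_finite_variation e_def exp_add[symmetric] algebra_simps)
    finally show ?thesis .
  qed
  have cosX: "(\<integral>\<^sup>+\<omega>. ennreal (1 - cos (u * X \<omega>)) \<partial>M) \<le> ennreal (- ?a u) + ennreal (min ((?b u)\<^sup>2 / 2) 2)" for u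
  proof -
    have ic: "integrable M (\<lambda>\<omega>. cos (u * X \<omega>))" by (rule integrable_const_bound[of _ 1]) auto
    have "(\<integral>\<^sup>+\<omega>. ennreal (1 - cos (u * X \<omega>)) \<partial>M) = ennreal (expectation (\<lambda>\<omega>. 1 - cos (u * X \<omega>)))"
      using ic by (intro nn_integral_eq_integral) auto
    also have "expectation (\<lambda>\<omega>. 1 - cos (u * X \<omega>)) = 1 - Re (char (distr M borel X) u)"
      using ic by (simp add: Re_char_distr prob_space)
    also have "\<dots> = 1 - exp (?a u) * cos (?b u)" by (simp add: char Re_exp)
    also have "\<dots> \<le> - ?a u + min ((?b u)\<^sup>2 / 2) 2"
      using Re_jump_exponent_nonpos[of u] e by (intro one_minus_Re_exp_le) (simp add: mult_nonneg_nonpos)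
    finally show ?thesis
      using Re_jump_exponent_nonpos[of u] e
      by (subst ennreal_plus[symmetric]) (auto simp: mult_nonneg_nonpos intro: ennreal_leI)
  qed
  have nu_cos: "ennreal (- ?a u) = ennreal e * (\<integral>\<^sup>+x. ennreal (1 - cos (u * x)) \<partial>\<nu>)" for u
  proof -
    have "integrable \<nu> (\<lambda>x. 1 - cos (u * x))"
      using integrable_Re[OF integrable_jump_integrand[of u]] integrable_minus[of \<nu> "\<lambda>x. Re (iexp (u * x) - 1)"]
      by (simp add: Re_exp)
    then have "(\<integral>\<^sup>+x. ennreal (1 - cos (u * x)) \<partial>\<nu>) = ennreal (\<integral>x. 1 - cos (u * x) \<partial>\<nu>)"
      by (intro nn_integral_eq_integral) auto
    then show ?thesis using e by (simp add: Re_jump_exponent ennreal_mult')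
  qed
  have ReM [measurable]: "(\<lambda>u. \<integral>\<^sup>+x. ennreal (1 - cos (u * x)) \<partial>\<nu>) \<in> borel_measurable borel" by measurable
  let ?W = "\<lambda>u. ennreal (1 / u\<^sup>2) * indicator {0<..} u"
  have "(\<integral>\<^sup>+\<omega>. ennreal \<bar>X \<omega>\<bar> \<partial>M) * ennreal abs_const
      = (\<integral>\<^sup>+u. ?W u * (\<integral>\<^sup>+\<omega>. ennreal (1 - cos (u * X \<omega>)) \<partial>M) \<partial>lborel)"
    by (rule nn_integral_abs_as_cos) measurable
  also have "\<dots> \<le> (\<integral>\<^sup>+u. ?W u * (ennreal e * (\<integral>\<^sup>+x. ennreal (1 - cos (u * x)) \<partial>\<nu>))
      + ?W u * ennreal (min ((?b u)\<^sup>2 / 2) 2) \<partial>lborel)"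
    unfolding distrib_left[symmetric] nu_cos[symmetric] by (intro nn_integral_mono mult_left_mono cosX) auto
  also have "\<dots> = (\<integral>\<^sup>+u. ?W u * (ennreal e * (\<integral>\<^sup>+x. ennreal (1 - cos (u * x)) \<partial>\<nu>)) \<partial>lborel) + remainder e"
    unfolding remainder_def by (rule nn_integral_add) measurable
  also have "(\<integral>\<^sup>+u. ?W u * (ennreal e * (\<integral>\<^sup>+x. ennreal (1 - cos (u * x)) \<partial>\<nu>)) \<partial>lborel)
      = ennreal e * (\<integral>\<^sup>+u. ?W u * (\<integral>\<^sup>+x. ennreal (1 - cos (u * x)) \<partial>\<nu>) \<partial>lborel)"
    by (subst nn_integral_cmult[symmetric]) (auto intro!: nn_integral_cong simp: ac_simps)
  also have "(\<integral>\<^sup>+u. ?W u * (\<integral>\<^sup>+x. ennreal (1 - cos (u * x)) \<partial>\<nu>) \<partial>lborel) = (\<integral>\<^sup>+x. ennreal \<bar>x\<bar> \<partial>\<nu>) * ennreal abs_const"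
    by (rule nu.nn_integral_abs_as_cos[symmetric]) measurable
  also have "(\<integral>\<^sup>+x. ennreal \<bar>x\<bar> \<partial>\<nu>) = ennreal jump_mean"
    unfolding jump_mean_def using fv by (intro nn_integral_eq_integral) auto
  finally show ?thesis using e by (simp add: X_def ennreal_mult' mult.assoc)
qed

lemma L1_Lambda_small:
  assumes \<eta>: "0 < \<eta>"
  shows "\<exists>\<delta>>0. \<forall>B\<in>bounded_borel_sets. measure control B < \<delta> \<longrightarrow>
    (\<integral>\<^sup>+\<omega>. ennreal \<bar>\<Lambda> B \<omega>\<bar> \<partial>M) \<le> ennreal ((\<bar>drift\<bar> + jump_mean + \<eta>) * measure control B)"
proof -
  have "0 < \<eta> * abs_const" using \<eta> abs_const_pos by simp
  from remainder_small[OF this] obtain \<delta> where \<delta>: "\<delta> > 0"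
    "\<And>e. 0 \<le> e \<Longrightarrow> e < \<delta> \<Longrightarrow> remainder e \<le> ennreal (\<eta> * abs_const * e)" by blast
  have "(\<integral>\<^sup>+\<omega>. ennreal \<bar>\<Lambda> B \<omega>\<bar> \<partial>M) \<le> ennreal ((\<bar>drift\<bar> + jump_mean + \<eta>) * measure control B)"
    if B: "B \<in> bounded_borel_sets" and small: "measure control B < \<delta>" for B
  proof -
    define e where "e = measure control B"
    have e: "0 \<le> e" by (simp add: e_def)
    note [measurable] = measurable_Lambda[OF B]
    have "(\<integral>\<^sup>+\<omega>. ennreal \<bar>\<Lambda> B \<omega> - e * drift\<bar> \<partial>M) * ennreal abs_const
       \<le> ennreal (e * jump_mean) * ennreal abs_const + ennreal (\<eta> * abs_const * e)"
      using L1_Lambda_le_remainder[OF B] \<delta>(2)[OF e] small by (auto simp: e_def intro: order_trans add_left_mono)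
    also have "\<dots> = ennreal (e * jump_mean + \<eta> * e) * ennreal abs_const"
      using e \<eta> abs_const_pos jump_mean_nonneg
      by (simp add: ennreal_mult'[symmetric] ennreal_plus[symmetric] algebra_simps del: ennreal_plus)
    finally have "(\<integral>\<^sup>+\<omega>. ennreal \<bar>\<Lambda> B \<omega> - e * drift\<bar> \<partial>M) \<le> ennreal (e * jump_mean + \<eta> * e)"
      using abs_const_pos by (subst (asm) ennreal_mult_le_mult_iff[of "ennreal abs_const", simplified mult.commute]) auto
    moreover have "(\<integral>\<^sup>+\<omega>. ennreal \<bar>\<Lambda> B \<omega>\<bar> \<partial>M) \<le> (\<integral>\<^sup>+\<omega>. ennreal (e * \<bar>drift\<bar>) + ennreal \<bar>\<Lambda> B \<omega> - e * drift\<bar> \<partial>M)"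
    proof (rule nn_integral_mono)
      fix \<omega>
      have "\<bar>\<Lambda> B \<omega>\<bar> \<le> e * \<bar>drift\<bar> + \<bar>\<Lambda> B \<omega> - e * drift\<bar>"
        using abs_triangle_ineq[of "e * drift" "\<Lambda> B \<omega> - e * drift"] e by (simp add: abs_mult)
      from ennreal_leI[OF this] e
      show "ennreal \<bar>\<Lambda> B \<omega>\<bar> \<le> ennreal (e * \<bar>drift\<bar>) + ennreal \<bar>\<Lambda> B \<omega> - e * drift\<bar>"
        by simp
    qed
    moreover have "(\<integral>\<^sup>+\<omega>. ennreal (e * \<bar>drift\<bar>) + ennreal \<bar>\<Lambda> B \<omega> - e * drift\<bar> \<partial>M)
       = ennreal (e * \<bar>drift\<bar>) + (\<integral>\<^sup>+\<omega>. ennreal \<bar>\<Lambda> B \<omega> - e * drift\<bar> \<partial>M)"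
      by (subst nn_integral_add) (auto simp: emeasure_space_1)
    ultimately have "(\<integral>\<^sup>+\<omega>. ennreal \<bar>\<Lambda> B \<omega>\<bar> \<partial>M) \<le> ennreal (e * \<bar>drift\<bar>) + ennreal (e * jump_mean + \<eta> * e)"
      by (metis add_left_mono order_trans)
    also have "\<dots> = ennreal ((\<bar>drift\<bar> + jump_mean + \<eta>) * e)"
      using e \<eta> jump_mean_nonneg by (subst ennreal_plus[symmetric]) (auto simp: algebra_simps)
    finally show ?thesis by (simp add: e_def)
  qed
  then show ?thesis using \<delta>(1) by blast
qed

end

context square_integrable_levy_basis
begin

text \<open>
  A bounded set is cut by the integer part of \<open>N\<close> times its time coordinate: a slice has control
  measure at most \<open>1 / N\<close> times the volume of a ball.
\<close>

lemma small_time_slices: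
  assumes B: "B \<in> bounded_borel_sets" and d: "0 < d"
  obtains J :: "int set" and C where "finite J" "\<And>j. j \<in> J \<Longrightarrow> C j \<in> bounded_borel_sets"
    "disjoint_family_on C J" "(\<Union>j\<in>J. C j) = B" "\<And>j. j \<in> J \<Longrightarrow> measure control (C j) < d"
proof -
  interpret P: prob_space \<pi> by (rule prob_space_pi)
  have bd: "bounded (snd ` B)" using B by (auto simp: bounded_borel_sets_def intro: bounded_snd)
  then obtain R where R: "snd ` B \<subseteq> ball 0 R" using bounded_subset_ballD[of "snd ` B" 0] by blast
  have Rt: "\<bar>fst (snd z)\<bar> \<le> R" and Rx: "norm (snd (snd z)) \<le> R" if "z \<in> B" for z
  proof -
    have "norm (snd z) < R" using R that by auto
    then show "\<bar>fst (snd z)\<bar> \<le> R" "norm (snd (snd z)) \<le> R"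
      using norm_fst_le[of "fst (snd z)" "snd (snd z)"] norm_snd_le[of "snd (snd z)" "fst (snd z)"] by auto
  qed
  define v where "v = measure lborel (cball (0 :: real ^ 'm) R)"
  have v: "emeasure lborel (cball (0 :: real ^ 'm) R) = ennreal v"
    unfolding v_def using emeasure_bounded_finite[OF bounded_cball, of "0 :: real ^ 'm" R]
    by (intro emeasure_eq_ennreal_measure) auto
  obtain N :: nat where N: "v / d < real N" using reals_Archimedean2 by blast
  have v0: "0 \<le> v" by (simp add: v_def)
  have Npos: "0 < real N" using N d v0 by (meson divide_nonneg_pos le_less_trans)
  define J where "J = {\<lfloor>- (real N * R)\<rfloor>..\<lfloor>real N * R\<rfloor>}"
  define C where "C j = B \<inter> {z. \<lfloor>real N * fst (snd z)\<rfloor> = j}" for j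
  have Bb [measurable]: "B \<in> sets borel" using B by (simp add: bounded_borel_sets_def)
  have Cb: "C j \<in> bounded_borel_sets" for j
  proof (rule bounded_borel_subset[OF B])
    have "{z \<in> space borel. \<lfloor>real N * fst (snd (z :: real \<times> real \<times> (real ^ 'm)))\<rfloor> = j} \<in> sets borel"
      unfolding borel_prod[symmetric] by measurable
    then show "C j \<in> sets borel" unfolding C_def by (intro sets.Int Bb) simp
  qed (auto simp: C_def)
  have "(\<Union>j\<in>J. C j) = B"
  proof (intro equalityI subsetI)
    fix z assume z: "z \<in> B"
    have "- (real N * R) \<le> real N * fst (snd z)" "real N * fst (snd z) \<le> real N * R"
      using Rt[OF z] Npos mult_left_mono[of "- R" "fst (snd z)" "real N"] by (auto simp: abs_le_iff)
    then show "z \<in> (\<Union>j\<in>J. C j)" using z by (auto simp: C_def J_def intro: floor_mono)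
  qed (auto simp: C_def)
  moreover have "measure control (C j) < d" for j
  proof -
    let ?I = "{real_of_int j / real N..(real_of_int j + 1) / real N}"
    have sub: "C j \<subseteq> UNIV \<times> (?I \<times> cball 0 R)"
    proof
      fix z assume z: "z \<in> C j"
      then have "real_of_int j \<le> real N * fst (snd z)" "real N * fst (snd z) \<le> real_of_int j + 1"
        by (auto simp: C_def floor_eq_iff)
      then have "fst (snd z) \<in> ?I" using Npos by (auto simp: field_simps)
      moreover have "snd (snd z) \<in> cball 0 R" using Rx[of z] z by (simp add: C_def)
      ultimately show "z \<in> UNIV \<times> (?I \<times> cball 0 R)" by (simp add: mem_Times_iff)
    qed
    have "emeasure control (C j) \<le> emeasure control (UNIV \<times> (?I \<times> cball 0 R))"
    proof (rule emeasure_mono[OF sub])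
      show "UNIV \<times> (?I \<times> cball 0 R) \<in> sets control"
        unfolding sets_control by (intro borel_closed closed_Times) auto
    qed
    also have "\<dots> = emeasure \<pi> UNIV * emeasure lborel (?I \<times> cball (0 :: real ^ 'm) R)"
      by (intro lborel.emeasure_pair_measure_Times) (auto intro!: borel_closed closed_Times)
    also have "\<dots> = emeasure (lborel \<Otimes>\<^sub>M lborel) (?I \<times> cball (0 :: real ^ 'm) R)"
      using P.emeasure_space_1 by (simp add: lborel_prod)
    also have "\<dots> = emeasure lborel ?I * emeasure lborel (cball (0 :: real ^ 'm) R)"
      by (intro lborel.emeasure_pair_measure_Times) auto
    also have "\<dots> = ennreal (1 / real N * v)"
      using Npos v0 v by (subst ennreal_mult) (auto simp: divide_right_mono diff_divide_distrib[symmetric])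
    finally have "measure control (C j) \<le> 1 / real N * v"
      unfolding measure_def by (rule enn2real_leI[rotated]) (use v0 in auto)
    also have "\<dots> < d" using N Npos d by (simp add: field_simps)
    finally show ?thesis .
  qed
  ultimately show ?thesis
    using that[of J C] Cb by (auto simp: J_def C_def disjoint_family_on_def)
qed

lemma measure_control_disjoint_Union:
  assumes "finite J" "\<And>j. j \<in> J \<Longrightarrow> C j \<in> bounded_borel_sets" "disjoint_family_on C J"
  shows "measure control (\<Union>j\<in>J. C j) = (\<Sum>j\<in>J. measure control (C j))"
proof (rule measure_finite_Union[OF assms(1) _ assms(3)])
  show "C ` J \<subseteq> sets control"
    using assms(2) unfolding sets_control by (auto simp: bounded_borel_sets_def)
  show "emeasure control (C j) \<noteq> \<infinity>" if "j \<in> J" for j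
    using emeasure_control_bounded_borel[OF assms(2)[OF that]] by simp
qed

end

context finite_variation_levy_basis
begin

text \<open>
  The triangle inequality over small slices removes the error term, because the main term is
  additive in the set.
\<close>

lemma L1_Lambda:
  assumes B: "B \<in> bounded_borel_sets"
  shows "(\<integral>\<^sup>+\<omega>. ennreal \<bar>\<Lambda> B \<omega>\<bar> \<partial>M) \<le> ennreal ((\<bar>drift\<bar> + jump_mean) * measure control B)"
proof -
  have le: "(\<integral>\<^sup>+\<omega>. ennreal \<bar>\<Lambda> B \<omega>\<bar> \<partial>M) \<le> ennreal ((\<bar>drift\<bar> + jump_mean + \<eta>) * measure control B)"
    if \<eta>: "0 < \<eta>" for \<eta>
  proof -
    let ?c = "\<bar>drift\<bar> + jump_mean + \<eta>"
    have c: "0 \<le> ?c" using \<eta> jump_mean_nonneg by simp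
    obtain \<delta> where \<delta>: "0 < \<delta>" "\<And>B. B \<in> bounded_borel_sets \<Longrightarrow> measure control B < \<delta> \<Longrightarrow>
        (\<integral>\<^sup>+\<omega>. ennreal \<bar>\<Lambda> B \<omega>\<bar> \<partial>M) \<le> ennreal (?c * measure control B)"
      using L1_Lambda_small[OF \<eta>] by blast
    obtain J :: "int set" and C where J: "finite J" and C: "\<And>j. j \<in> J \<Longrightarrow> C j \<in> bounded_borel_sets"
      and dis: "disjoint_family_on C J" and U: "(\<Union>j\<in>J. C j) = B"
      and small: "\<And>j. j \<in> J \<Longrightarrow> measure control (C j) < \<delta>"
      by (rule small_time_slices[OF B \<delta>(1)]) (rule that)
    have "(\<integral>\<^sup>+\<omega>. ennreal \<bar>\<Lambda> B \<omega>\<bar> \<partial>M) \<le> (\<integral>\<^sup>+\<omega>. (\<Sum>j\<in>J. ennreal \<bar>\<Lambda> (C j) \<omega>\<bar>) \<partial>M)"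
    proof (rule nn_integral_mono_AE)
      have "AE \<omega> in M. \<Lambda> (\<Union>j\<in>J. C j) \<omega> = (\<Sum>j\<in>J. \<Lambda> (C j) \<omega>)"
        using Lambda_finite_Union[of J C] J C dis by blast
      then show "AE \<omega> in M. ennreal \<bar>\<Lambda> B \<omega>\<bar> \<le> (\<Sum>j\<in>J. ennreal \<bar>\<Lambda> (C j) \<omega>\<bar>)"
        unfolding U by eventually_elim (simp add: sum_ennreal ennreal_leI sum_abs)
    qed
    also have "\<dots> = (\<Sum>j\<in>J. \<integral>\<^sup>+\<omega>. ennreal \<bar>\<Lambda> (C j) \<omega>\<bar> \<partial>M)"
      using C by (intro nn_integral_sum) auto
    also have "\<dots> \<le> (\<Sum>j\<in>J. ennreal (?c * measure control (C j)))"
      using C small by (intro sum_mono \<delta>(2)) auto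
    also have "\<dots> = ennreal (?c * measure control B)"
      using c measure_control_disjoint_Union[of J C] J C dis U
      by (simp add: sum_ennreal sum_distrib_left)
    finally show ?thesis .
  qed
  have "((\<lambda>\<eta>. ennreal ((\<bar>drift\<bar> + jump_mean + \<eta>) * measure control B))
      \<longlongrightarrow> ennreal ((\<bar>drift\<bar> + jump_mean + 0) * measure control B)) (at_right 0)"
    by (intro tendsto_ennrealI tendsto_intros)
  then show ?thesis
    using le by (intro tendsto_lowerbound[where F="at_right 0"])
      (auto simp: eventually_at_right_less intro: eventually_mono[OF eventually_at_right_less])
qed

theorem moment_bound_finite_variation: "moment_bound 1 (\<bar>drift\<bar> + jump_mean)"
proof -
  let ?c = "\<bar>drift\<bar> + jump_mean"
  have c: "0 \<le> ?c" using jump_mean_nonneg by simp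
  have "integrable M (simple_int g) \<and>
        (expectation (\<lambda>\<omega>. \<bar>simple_int g \<omega>\<bar>)) \<le> ?c * (\<integral>z. \<bar>g z\<bar> \<partial>control)"
    if g: "levy_simple g" for g
  proof -
    let ?R = "range g - {0}"
    have int_g: "(\<integral>z. \<bar>g z\<bar> \<partial>control) = (\<Sum>y\<in>?R. measure control (g -` {y}) * \<bar>y\<bar>)"
      using has_bochner_integral_levy_simple[OF g, of abs] by (simp add: has_bochner_integral_iff)
    have R: "finite ?R" and gb: "\<And>y. y \<in> ?R \<Longrightarrow> g -` {y} \<in> bounded_borel_sets"
      using levy_simple_finite[OF g] levy_simple_vimage[OF g] by auto
    have "(\<integral>\<^sup>+\<omega>. ennreal \<bar>simple_int g \<omega>\<bar> \<partial>M) \<le> (\<integral>\<^sup>+\<omega>. (\<Sum>y\<in>?R. ennreal \<bar>y\<bar> * ennreal \<bar>\<Lambda> (g -` {y}) \<omega>\<bar>) \<partial>M)"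
    proof (rule nn_integral_mono)
      fix \<omega>
      have "\<bar>simple_int g \<omega>\<bar> \<le> (\<Sum>y\<in>?R. \<bar>y\<bar> * \<bar>\<Lambda> (g -` {y}) \<omega>\<bar>)"
        unfolding levy_simple_integral_def using sum_abs[of "\<lambda>y. y * \<Lambda> (g -` {y}) \<omega>" ?R] by (simp add: abs_mult)
      then show "ennreal \<bar>simple_int g \<omega>\<bar> \<le> (\<Sum>y\<in>?R. ennreal \<bar>y\<bar> * ennreal \<bar>\<Lambda> (g -` {y}) \<omega>\<bar>)"
        by (simp add: ennreal_mult'[symmetric] sum_ennreal ennreal_leI)
    qed
    also have "\<dots> = (\<Sum>y\<in>?R. ennreal \<bar>y\<bar> * (\<integral>\<^sup>+\<omega>. ennreal \<bar>\<Lambda> (g -` {y}) \<omega>\<bar> \<partial>M))"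
    proof -
      have meas: "(\<lambda>\<omega>. ennreal \<bar>\<Lambda> (g -` {y}) \<omega>\<bar>) \<in> borel_measurable M" if "y \<in> ?R" for y
        using measurable_Lambda[OF gb[OF that]] by measurable
      have "(\<integral>\<^sup>+\<omega>. (\<Sum>y\<in>?R. ennreal \<bar>y\<bar> * ennreal \<bar>\<Lambda> (g -` {y}) \<omega>\<bar>) \<partial>M)
          = (\<Sum>y\<in>?R. \<integral>\<^sup>+\<omega>. ennreal \<bar>y\<bar> * ennreal \<bar>\<Lambda> (g -` {y}) \<omega>\<bar> \<partial>M)"
        by (intro nn_integral_sum borel_measurable_times_ennreal borel_measurable_const meas)
      also have "\<dots> = (\<Sum>y\<in>?R. ennreal \<bar>y\<bar> * (\<integral>\<^sup>+\<omega>. ennreal \<bar>\<Lambda> (g -` {y}) \<omega>\<bar> \<partial>M))"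
        by (intro sum.cong refl nn_integral_cmult meas)
      finally show ?thesis .
    qed
    also have "\<dots> \<le> (\<Sum>y\<in>?R. ennreal \<bar>y\<bar> * ennreal (?c * measure control (g -` {y})))"
      using gb by (intro sum_mono mult_left_mono L1_Lambda) auto
    also have "\<dots> = ennreal (?c * (\<integral>z. \<bar>g z\<bar> \<partial>control))"
      using c unfolding int_g by (simp add: ennreal_mult'[symmetric] sum_ennreal sum_distrib_left ac_simps)
    finally have bd: "(\<integral>\<^sup>+\<omega>. ennreal \<bar>simple_int g \<omega>\<bar> \<partial>M) \<le> ennreal (?c * (\<integral>z. \<bar>g z\<bar> \<partial>control))" .
    have int: "integrable M (simple_int g)"
      using bd by (intro integrableI_bounded measurable_simple_int[OF g]) (auto simp: order_le_less_trans)
    have "ennreal (expectation (\<lambda>\<omega>. \<bar>simple_int g \<omega>\<bar>)) \<le> ennreal (?c * (\<integral>z. \<bar>g z\<bar> \<partial>control))"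
      using bd int by (subst nn_integral_eq_integral[symmetric]) auto
    then show ?thesis using int c by (simp add: ennreal_le_iff mult_nonneg_nonneg)
  qed
  then show ?thesis using c unfolding moment_bound_def by simp
qed

end

section \<open>Monotone approximation and independence on disjoint supports\<close>

context square_integrable_levy_basis
begin

lemma AE_levy_space: "AE z in control. z \<in> levy_space"
proof (rule AE_I)
  let ?N = "{..0} \<times> UNIV :: (real \<times> real \<times> (real ^ 'm)) set"
  show "{z \<in> space control. z \<notin> levy_space} \<subseteq> ?N"
    by (auto simp: levy_space_def)
  show "?N \<in> sets control" unfolding sets_control by (intro borel_closed closed_Times) auto
  have "emeasure control ?N = emeasure \<pi> {..0} * emeasure lborel (UNIV :: (real \<times> (real ^ 'm)) set)"
    by (intro lborel.emeasure_pair_measure_Times) auto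
  then show "emeasure control ?N = 0" by (simp add: pi_nonpos)
qed

text \<open>
  The standard increasing approximation, cut off by bounded subsets of the state space. Monotonicity
  gives \<open>\<bar>h n - h m\<bar> \<le> f - h (min n m)\<close>, hence the Cauchy property.
\<close>

lemma levy_simple_approximation:
  fixes f :: "real \<times> real \<times> (real ^ 'm) \<Rightarrow> real"
  assumes f [measurable]: "f \<in> borel_measurable borel" and nn: "\<And>z. 0 \<le> f z"
    and p: "1 \<le> p" and int: "integrable control (\<lambda>z. f z ^ p)"
  obtains h where "\<And>n. levy_simple (h n)" "\<And>n z. 0 \<le> h n z" "\<And>n z. h n z \<le> f z"
    "AE z in control. (\<lambda>n. h n z) \<longlonglongrightarrow> f z"
    "\<And>e. 0 < e \<Longrightarrow> \<exists>N. \<forall>n\<ge>N. \<forall>m\<ge>N. (\<integral>z. \<bar>h n z - h m z\<bar> ^ p \<partial>control) < e"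
proof -
  obtain s where inc: "incseq s" and s: "\<And>i. simple_function borel (s i)"
    and bdd: "\<And>z. bdd_above (range (\<lambda>i. s i z))" and s0: "\<And>i z. 0 \<le> s i z" and fs: "f = (SUP i. s i)"
    using borel_measurable_implies_simple_function_sequence_real[OF f nn] by blast
  have fz: "f z = (SUP i. s i z)" for z unfolding fs by (simp add: image_comp)
  have s_le: "s i z \<le> f z" for i z unfolding fz by (rule cSUP_upper[OF _ bdd]) simp
  have s_lim: "(\<lambda>i. s i z) \<longlonglongrightarrow> f z" for z
    unfolding fz using inc by (intro LIMSEQ_incseq_SUP bdd) (auto simp: incseq_def intro: le_funD)
  define D where "D n = (levy_space \<inter> cball 0 (real n) :: (real \<times> real \<times> (real ^ 'm)) set)" for n :: nat
  have Db: "D n \<in> bounded_borel_sets" for n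
    unfolding D_def bounded_borel_sets_def using levy_space_borel
    by (auto intro!: bounded_Int sets.Int)
  have Dm [measurable]: "D n \<in> sets borel" for n using Db[of n] by (simp add: bounded_borel_sets_def)
  define h where "h n z = s n z * indicator (D n) z" for n z
  have [measurable]: "s n \<in> borel_measurable borel" for n by (rule borel_measurable_simple_function[OF s])
  have h: "levy_simple (h n)" for n
  proof (rule levy_simpleI[OF _ _ Db[of n]])
    show "h n \<in> borel_measurable borel" unfolding h_def[abs_def] by measurable
    have "range (h n) \<subseteq> insert 0 (s n ` space borel)" by (auto simp: h_def indicator_def)
    then show "finite (range (h n))"
      using simple_functionD(1)[OF s[of n]] by (meson finite_insert finite_subset)
  qed (simp add: h_def)
  have h0: "0 \<le> h n z" and hf: "h n z \<le> f z" for n z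
    using s0[of n z] s_le[of n z] nn[of z] by (auto simp: h_def indicator_def)
  have h_mono: "h n z \<le> h m z" if "n \<le> m" for n m z
  proof -
    have "s n z \<le> s m z" using inc that by (auto simp: incseq_def intro: le_funD)
    moreover have "D n \<subseteq> D m" using that by (auto simp: D_def)
    ultimately show ?thesis using s0 by (auto simp: h_def indicator_def)
  qed
  have h_lim: "AE z in control. (\<lambda>n. h n z) \<longlonglongrightarrow> f z"
    using AE_levy_space
  proof eventually_elim
    case (elim z)
    obtain N :: nat where "norm z \<le> real N" using real_arch_simple by blast
    then have "h n z = s n z" if "n \<ge> N" for n
      using elim that by (auto simp: h_def D_def)
    then have "eventually (\<lambda>n. s n z = h n z) sequentially"
      by (auto simp: eventually_sequentially intro!: exI[of _ N])
    with s_lim[of z] show ?case by (rule Lim_transform_eventually)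
  qed
  have [measurable]: "h n \<in> borel_measurable borel" for n by (rule levy_simple_measurable[OF h])
  have mc: "g \<in> borel_measurable borel \<Longrightarrow> g \<in> borel_measurable control" for g :: "_ \<Rightarrow> real"
    using measurable_cong_sets[OF sets_control refl] by blast
  have int_d: "integrable control (\<lambda>z. (f z - h n z) ^ p)" for n
    by (rule Bochner_Integration.integrable_bound[OF int])
       (auto intro!: mc AE_I2 power_mono simp: power_abs hf h0 nn)
  have lim_d: "(\<lambda>n. \<integral>z. (f z - h n z) ^ p \<partial>control) \<longlonglongrightarrow> 0"
  proof -
    have "(\<lambda>n. \<integral>z. (f z - h n z) ^ p \<partial>control) \<longlonglongrightarrow> (\<integral>z. 0 \<partial>control)"
    proof (rule integral_dominated_convergence[where w="\<lambda>z. f z ^ p"])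
      show "AE z in control. (\<lambda>n. (f z - h n z) ^ p) \<longlonglongrightarrow> 0"
        using h_lim
      proof eventually_elim
        case (elim z)
        have "(\<lambda>n. (f z - h n z) ^ p) \<longlonglongrightarrow> (f z - f z) ^ p" by (intro tendsto_intros elim)
        moreover have "(f z - f z) ^ p = 0" using p by simp
        ultimately show ?case by (simp only:)
      qed
      show "AE z in control. norm ((f z - h n z) ^ p) \<le> f z ^ p" for n
        by (intro AE_I2) (simp add: power_abs power_mono hf h0)
    qed (use int int_d in \<open>auto intro!: mc\<close>)
    then show ?thesis by simp
  qed
  have "\<exists>N. \<forall>n\<ge>N. \<forall>m\<ge>N. (\<integral>z. \<bar>h n z - h m z\<bar> ^ p \<partial>control) < e" if e: "0 < e" for e
  proof -
    obtain N where N: "\<And>n. n \<ge> N \<Longrightarrow> (\<integral>z. (f z - h n z) ^ p \<partial>control) < e"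
      using order_tendstoD(2)[OF lim_d e] by (auto simp: eventually_sequentially)
    have main: "(\<integral>z. \<bar>h n z - h m z\<bar> ^ p \<partial>control) < e" if nm: "N \<le> n" "n \<le> m" for n m
    proof -
      have "(\<integral>z. \<bar>h n z - h m z\<bar> ^ p \<partial>control) \<le> (\<integral>z. (f z - h n z) ^ p \<partial>control)"
      proof (rule integral_mono[OF _ int_d])
        show "integrable control (\<lambda>z. \<bar>h n z - h m z\<bar> ^ p)"
          by (rule integrable_levy_simple_power[OF levy_simple_diff[OF h h] p])
        fix z show "\<bar>h n z - h m z\<bar> ^ p \<le> (f z - h n z) ^ p"
          using h_mono[OF nm(2), of z] hf[of m z] by (intro power_mono) auto
      qed
      with N[OF nm(1)] show ?thesis by simp
    qed
    have "(\<integral>z. \<bar>h n z - h m z\<bar> ^ p \<partial>control) < e" if "n \<ge> N" "m \<ge> N" for n m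
      using main[of n m] main[of m n] that by (cases "n \<le> m") (auto simp: abs_minus_commute)
    then show ?thesis by blast
  qed
  with h h0 hf h_lim show ?thesis by (rule that)
qed

text \<open>
  On a common refinement, a cell on which \<open>w\<close> is not \<open>0\<close> carries the value \<open>0\<close> for each \<open>g i\<close>. So the two
  sides are functions of the values of the basis on two disjoint families of cells.
\<close>

lemma simple_int_disjoint_uncorrelated:
  fixes u :: nat
  assumes g: "\<And>i. i < u \<Longrightarrow> levy_simple (g i)" and w: "levy_simple w"
    and disj: "\<And>i z. i < u \<Longrightarrow> g i z = 0 \<or> w z = 0"
    and F [measurable]: "F \<in> borel_measurable (\<Pi>\<^sub>M i\<in>{..<u}. (borel :: real measure))"
    and Fb: "\<And>x. x \<in> space (\<Pi>\<^sub>M i\<in>{..<u}. (borel :: real measure)) \<Longrightarrow> \<bar>F x :: real\<bar> \<le> bF"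
    and G [measurable]: "G \<in> borel_measurable borel" and Gb: "\<And>x. \<bar>G x :: real\<bar> \<le> bG"
  shows "expectation (\<lambda>\<omega>. F (\<lambda>i\<in>{..<u}. simple_int (g i) \<omega>) * G (simple_int w \<omega>))
    = expectation (\<lambda>\<omega>. F (\<lambda>i\<in>{..<u}. simple_int (g i) \<omega>)) * expectation (\<lambda>\<omega>. G (simple_int w \<omega>))"
proof -
  define k where "k i = (if i < u then g i else w)" for i
  have k: "levy_simple (k i)" if "i \<in> {..u}" for i using that g w by (simp add: k_def)
  obtain J :: "(nat \<Rightarrow> real) set" and C where J: "finite J" and C: "\<And>v. v \<in> J \<Longrightarrow> C v \<in> bounded_borel_sets"
    and dis: "disjoint_family_on C J" and ne: "\<And>v. v \<in> J \<Longrightarrow> C v \<noteq> {}"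
    and val: "\<And>v z i. v \<in> J \<Longrightarrow> z \<in> C v \<Longrightarrow> i \<in> {..u} \<Longrightarrow> k i z = v i"
    and rep: "\<And>i. i \<in> {..u} \<Longrightarrow> k i = (\<lambda>z. \<Sum>v\<in>J. v i * indicator (C v) z)"
    by (rule common_refinement[OF finite_atMost k]) (assumption, rule that)
  have part: "AE \<omega> in M. simple_int (k i) \<omega> = (\<Sum>v\<in>J. v i * \<Lambda> (C v) \<omega>)" if "i \<in> {..u}" for i
    using levy_simple_integral_partition[of J C "k i" "\<lambda>v. v i" UNIV] J C dis rep[OF that] by auto
  \<comment> \<open>the cells that carry \<open>w\<close>, which has index \<open>u\<close> in the family\<close>
  define K2 where "K2 = {v \<in> J. v u \<noteq> 0}"
  define K1 where "K1 = J - K2"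
  have K: "K1 \<inter> K2 = {}" "K1 \<subseteq> J" "K2 \<subseteq> J" by (auto simp: K1_def K2_def)
  have K2_0: "v i = 0" if v: "v \<in> K2" and i: "i < u" for v i
  proof -
    obtain z where z: "z \<in> C v" using ne[of v] v by (auto simp: K2_def)
    have "w z \<noteq> 0" using val[of v z u] v z by (auto simp: K2_def k_def)
    then have "g i z = 0" using disj[OF i, of z] by auto
    then show ?thesis using val[of v z i] v z i by (auto simp: K2_def k_def)
  qed
  define Y1 where "Y1 x = (\<lambda>i\<in>{..<u}. \<Sum>v\<in>K1. v i * x v)" for x :: "(nat \<Rightarrow> real) \<Rightarrow> real"
  define Y2 where "Y2 x = (\<Sum>v\<in>K2. v u * x v)" for x :: "(nat \<Rightarrow> real) \<Rightarrow> real"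
  have Y1 [measurable]: "Y1 \<in> measurable (Pi\<^sub>M K1 (\<lambda>_. borel)) (\<Pi>\<^sub>M i\<in>{..<u}. borel)"
    unfolding Y1_def by measurable
  have Y2 [measurable]: "Y2 \<in> borel_measurable (Pi\<^sub>M K2 (\<lambda>_. borel))"
    unfolding Y2_def by measurable
  let ?L1 = "\<lambda>\<omega>. \<lambda>v\<in>K1. \<Lambda> (C v) \<omega>" and ?L2 = "\<lambda>\<omega>. \<lambda>v\<in>K2. \<Lambda> (C v) \<omega>"
  have "indep_vars (\<lambda>_. borel) (\<lambda>v. \<Lambda> (C v)) J" using indep_vars_Lambda[of J C] J C dis by blast
  then have ind: "indep_var (Pi\<^sub>M K1 (\<lambda>_. borel)) ?L1 (Pi\<^sub>M K2 (\<lambda>_. borel)) ?L2"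
    by (rule indep_var_restrict[OF _ K])
  have ind': "indep_var borel ((\<lambda>x. F (Y1 x)) \<circ> ?L1) borel ((\<lambda>x. G (Y2 x)) \<circ> ?L2)"
    by (rule indep_var_compose[OF ind]) measurable
  have m1: "?L1 \<in> measurable M (Pi\<^sub>M K1 (\<lambda>_. borel))" and m2: "?L2 \<in> measurable M (Pi\<^sub>M K2 (\<lambda>_. borel))"
    using indep_var_rv1[OF ind] indep_var_rv2[OF ind] by auto
  have sp: "Y1 (?L1 \<omega>) \<in> space (\<Pi>\<^sub>M i\<in>{..<u}. (borel :: real measure))" for \<omega> by (simp add: Y1_def space_PiM)
  have i1: "integrable M ((\<lambda>x. F (Y1 x)) \<circ> ?L1)"
    using m1 by (intro integrable_const_bound[of _ bF] AE_I2) (auto simp: sp Fb o_def intro: measurable_compose)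
  have i2: "integrable M ((\<lambda>x. G (Y2 x)) \<circ> ?L2)"
    using m2 by (intro integrable_const_bound[of _ bG] AE_I2) (auto simp: Gb o_def intro: measurable_compose)
  have eq: "expectation (\<lambda>\<omega>. F (Y1 (?L1 \<omega>)) * G (Y2 (?L2 \<omega>)))
      = expectation (\<lambda>\<omega>. F (Y1 (?L1 \<omega>))) * expectation (\<lambda>\<omega>. G (Y2 (?L2 \<omega>)))"
    using indep_var_lebesgue_integral[OF ind' i1 i2] by (simp add: o_def)
  have "AE \<omega> in M. \<forall>i\<in>{..<u}. simple_int (g i) \<omega> = (\<Sum>v\<in>K1. v i * \<Lambda> (C v) \<omega>)"
  proof (intro AE_finite_allI)
    fix i assume "i \<in> {..<u}"
    then have i: "i < u" by simp
    from part[of i] i have "AE \<omega> in M. simple_int (g i) \<omega> = (\<Sum>v\<in>J. v i * \<Lambda> (C v) \<omega>)" by (simp add: k_def)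
    moreover have "(\<Sum>v\<in>J. v i * \<Lambda> (C v) \<omega>) = (\<Sum>v\<in>K1. v i * \<Lambda> (C v) \<omega>)" for \<omega>
      by (rule sum.mono_neutral_right) (use J K K2_0[OF _ i] in \<open>auto simp: K1_def\<close>)
    ultimately show "AE \<omega> in M. simple_int (g i) \<omega> = (\<Sum>v\<in>K1. v i * \<Lambda> (C v) \<omega>)" by simp
  qed simp
  then have ae1: "AE \<omega> in M. (\<lambda>i\<in>{..<u}. simple_int (g i) \<omega>) = Y1 (?L1 \<omega>)"
    by eventually_elim (auto simp: Y1_def intro!: restrict_ext sum.cong)
  have "AE \<omega> in M. simple_int w \<omega> = (\<Sum>v\<in>J. v u * \<Lambda> (C v) \<omega>)" using part[of u] by (simp add: k_def)
  moreover have "(\<Sum>v\<in>J. v u * \<Lambda> (C v) \<omega>) = Y2 (?L2 \<omega>)" for \<omega>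
    unfolding Y2_def by (rule sum.mono_neutral_cong_right) (use J K in \<open>auto simp: K2_def\<close>)
  ultimately have ae2: "AE \<omega> in M. simple_int w \<omega> = Y2 (?L2 \<omega>)" by simp
  have mg: "(\<lambda>\<omega>. \<lambda>i\<in>{..<u}. simple_int (g i) \<omega>) \<in> measurable M (\<Pi>\<^sub>M i\<in>{..<u}. borel)"
    by (rule measurable_restrict) (use g in auto)
  note [measurable] = measurable_compose[OF mg F] measurable_simple_int[OF w]
    measurable_compose[OF measurable_compose[OF m1 Y1] F] measurable_compose[OF m2 Y2]
  have "expectation (\<lambda>\<omega>. F (\<lambda>i\<in>{..<u}. simple_int (g i) \<omega>) * G (simple_int w \<omega>)) =
      expectation (\<lambda>\<omega>. F (Y1 (?L1 \<omega>)) * G (Y2 (?L2 \<omega>)))"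
  proof (rule integral_cong_AE)
    show "AE \<omega> in M. F (\<lambda>i\<in>{..<u}. simple_int (g i) \<omega>) * G (simple_int w \<omega>) = F (Y1 (?L1 \<omega>)) * G (Y2 (?L2 \<omega>))"
      using ae1 ae2 by eventually_elim simp
  qed measurable
  moreover have "expectation (\<lambda>\<omega>. F (\<lambda>i\<in>{..<u}. simple_int (g i) \<omega>)) = expectation (\<lambda>\<omega>. F (Y1 (?L1 \<omega>)))"
  proof (rule integral_cong_AE)
    show "AE \<omega> in M. F (\<lambda>i\<in>{..<u}. simple_int (g i) \<omega>) = F (Y1 (?L1 \<omega>))"
      using ae1 by eventually_elim simp
  qed measurable
  moreover have "expectation (\<lambda>\<omega>. G (simple_int w \<omega>)) = expectation (\<lambda>\<omega>. G (Y2 (?L2 \<omega>)))"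
  proof (rule integral_cong_AE)
    show "AE \<omega> in M. G (simple_int w \<omega>) = G (Y2 (?L2 \<omega>))"
      using ae2 by eventually_elim simp
  qed measurable
  ultimately show ?thesis using eq by simp
qed

end

text \<open>
  A generator that is stable under intersections and whose indicators are limits of products of
  continuous functions.
\<close>

lemma sets_PiM_atMost_boxes:
  "sets (\<Pi>\<^sub>M i\<in>{..<u::nat}. (borel :: real measure))
    = sigma_sets (\<Pi>\<^sub>E i\<in>{..<u}. UNIV) (range (\<lambda>a :: nat \<Rightarrow> real. \<Pi>\<^sub>E i\<in>{..<u}. {..a i}))"
proof -
  let ?P = "{{f \<in> (\<Pi>\<^sub>E i\<in>{..<u}. UNIV). \<forall>i\<in>j. f i \<in> A i} |
      A j. j \<in> {{..<u}} \<and> A \<in> Pi j (\<lambda>_. range (\<lambda>a::real. {..a}))}"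
  have "sets (\<Pi>\<^sub>M i\<in>{..<u}. sigma UNIV (range (\<lambda>a::real. {..a})))
      = sets (sigma (\<Pi>\<^sub>E i\<in>{..<u}. UNIV) ?P)"
  proof (rule sets_PiM_sigma)
    fix i :: nat
    have "UNIV = \<Union> (range (\<lambda>n::nat. {..real n}))" using real_arch_simple by blast
    then show "\<exists>S\<subseteq>range (\<lambda>a::real. {..a}). countable S \<and> UNIV = \<Union>S"
      by (intro exI[of _ "range (\<lambda>n::nat. {..real n})"]) auto
  qed auto
  moreover have "?P = range (\<lambda>a :: nat \<Rightarrow> real. \<Pi>\<^sub>E i\<in>{..<u}. {..a i})"
  proof (intro equalityI subsetI)
    fix B assume "B \<in> ?P"
    then obtain A where A: "\<And>i. i < u \<Longrightarrow> A i \<in> range (\<lambda>a::real. {..a})"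
      and B: "B = {f \<in> (\<Pi>\<^sub>E i\<in>{..<u}. UNIV). \<forall>i\<in>{..<u}. f i \<in> A i}" by auto
    have "\<forall>i. \<exists>a. i < u \<longrightarrow> A i = {..a}" using A by blast
    then obtain a where "\<forall>i. i < u \<longrightarrow> A i = {..a i}" by (rule choice[THEN exE])
    then have "B = (\<Pi>\<^sub>E i\<in>{..<u}. {..a i})" unfolding B by (auto simp: PiE_iff extensional_def)
    then show "B \<in> range (\<lambda>a :: nat \<Rightarrow> real. \<Pi>\<^sub>E i\<in>{..<u}. {..a i})" by simp
  next
    fix B assume "B \<in> range (\<lambda>a :: nat \<Rightarrow> real. \<Pi>\<^sub>E i\<in>{..<u}. {..a i})"
    then obtain a :: "nat \<Rightarrow> real" where B: "B = (\<Pi>\<^sub>E i\<in>{..<u}. {..a i})" by (rule rangeE)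
    have eq: "B = {f \<in> (\<Pi>\<^sub>E i\<in>{..<u}. UNIV). \<forall>i\<in>{..<u}. f i \<in> {..a i}}"
      unfolding B by (auto simp: PiE_iff extensional_def)
    have A: "(\<lambda>i. {..a i}) \<in> Pi {..<u} (\<lambda>_. range (\<lambda>a::real. {..a}))" by (intro Pi_I rangeI)
    show "B \<in> ?P"
      by (rule CollectI, rule exI[where x="\<lambda>i. {..a i}"], rule exI[where x="{..<u}"])
         (intro conjI eq singletonI A)
  qed
  ultimately have "sets (\<Pi>\<^sub>M i\<in>{..<u}. (borel :: real measure)) =
      sets (sigma (\<Pi>\<^sub>E i\<in>{..<u}. UNIV) (range (\<lambda>a :: nat \<Rightarrow> real. \<Pi>\<^sub>E i\<in>{..<u}. {..a i})))"
    by (simp only: borel_eq_atMost)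
  then show ?thesis by (subst (asm) sets_measure_of) auto
qed

text \<open>
  Factorization passes to limits in probability for products of continuous functions, from these
  to indicators of boxes, and by uniqueness of measures to all bounded Borel \<open>F\<close>. Borel functions
  cannot be treated directly, as \<open>F (X n)\<close> need not converge to \<open>F Y\<close>.
\<close>

lemma (in prob_space) uncorrelated_limit:
  fixes u :: nat and X :: "nat \<Rightarrow> nat \<Rightarrow> 'a \<Rightarrow> real"
  assumes X: "\<And>n i. i < u \<Longrightarrow> X n i \<in> borel_measurable M"
    and Y: "\<And>i. i < u \<Longrightarrow> Y i \<in> borel_measurable M"
    and conv: "\<And>i. i < u \<Longrightarrow> (\<lambda>n. ky_fan (X n i) (Y i)) \<longlonglongrightarrow> 0"
    and H [measurable]: "H \<in> borel_measurable M" and Hb: "\<And>\<omega>. \<bar>H \<omega> :: real\<bar> \<le> b"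
    and unc: "\<And>n F. F \<in> borel_measurable (\<Pi>\<^sub>M i\<in>{..<u}. (borel :: real measure)) \<Longrightarrow>
       (\<And>x. x \<in> space (\<Pi>\<^sub>M i\<in>{..<u}. (borel :: real measure)) \<Longrightarrow> \<bar>F x :: real\<bar> \<le> 1) \<Longrightarrow>
       expectation (\<lambda>\<omega>. F (\<lambda>i\<in>{..<u}. X n i \<omega>) * H \<omega>)
         = expectation (\<lambda>\<omega>. F (\<lambda>i\<in>{..<u}. X n i \<omega>)) * expectation H"
    and F [measurable]: "F \<in> borel_measurable (\<Pi>\<^sub>M i\<in>{..<u}. (borel :: real measure))"
    and Fb: "\<And>x. x \<in> space (\<Pi>\<^sub>M i\<in>{..<u}. (borel :: real measure)) \<Longrightarrow> \<bar>F x :: real\<bar> \<le> bF"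
  shows "expectation (\<lambda>\<omega>. F (\<lambda>i\<in>{..<u}. Y i \<omega>) * H \<omega>)
    = expectation (\<lambda>\<omega>. F (\<lambda>i\<in>{..<u}. Y i \<omega>)) * expectation H"
proof -
  let ?\<Pi> = "\<Pi>\<^sub>M i\<in>{..<u}. (borel :: real measure)"
  define Z where "Z \<omega> = (\<lambda>i\<in>{..<u}. Y i \<omega>)" for \<omega>
  have Z [measurable]: "Z \<in> measurable M ?\<Pi>"
    unfolding Z_def by (rule measurable_restrict) (use Y in auto)
  note XY [measurable] = X Y
  obtain r :: "nat \<Rightarrow> nat" where r: "strict_mono r"
    and ae: "AE \<omega> in M. \<forall>i\<in>{..<u}. (\<lambda>n. X (r n) i \<omega>) \<longlonglongrightarrow> Y i \<omega>"
  proof -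
    define D where "D n \<omega> = (\<Sum>i<u. min 1 \<bar>X n i \<omega> - Y i \<omega>\<bar>)" for n \<omega>
    have mi: "integrable M (\<lambda>\<omega>. min 1 \<bar>X n i \<omega> - Y i \<omega>\<bar>)" if "i < u" for n i
      by (intro integrable_min_1 borel_measurable_diff X Y that)
    have "(\<lambda>n. \<Sum>i<u. ky_fan (X n i) (Y i)) \<longlonglongrightarrow> (\<Sum>i<u. 0)" by (intro tendsto_sum conv) simp
    moreover have "(\<integral>\<omega>. norm (D n \<omega>) \<partial>M) = (\<Sum>i<u. ky_fan (X n i) (Y i))" for n
    proof -
      have "(\<integral>\<omega>. norm (D n \<omega>) \<partial>M) = (\<integral>\<omega>. (\<Sum>i<u. min 1 \<bar>X n i \<omega> - Y i \<omega>\<bar>) \<partial>M)"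
        by (intro Bochner_Integration.integral_cong) (auto simp: D_def intro!: abs_of_nonneg sum_nonneg)
      then show ?thesis
        unfolding ky_fan_def using mi by (subst (asm) Bochner_Integration.integral_sum) auto
    qed
    moreover have "integrable M (D n)" for n unfolding D_def[abs_def] using mi by auto
    ultimately obtain r :: "nat \<Rightarrow> nat" where r: "strict_mono r" "AE \<omega> in M. (\<lambda>n. D (r n) \<omega>) \<longlonglongrightarrow> 0"
      using tendsto_L1_AE_subseq[of M D] by auto
    have "AE \<omega> in M. \<forall>i\<in>{..<u}. (\<lambda>n. X (r n) i \<omega>) \<longlonglongrightarrow> Y i \<omega>"
      using r(2)
    proof eventually_elim
      case (elim \<omega>)
      show ?case
      proof
        fix i assume i: "i \<in> {..<u}"
        have le: "min 1 \<bar>X n i \<omega> - Y i \<omega>\<bar> \<le> D n \<omega>" for n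
          unfolding D_def using i by (intro member_le_sum) auto
        have min0: "(\<lambda>n. min 1 \<bar>X (r n) i \<omega> - Y i \<omega>\<bar>) \<longlonglongrightarrow> 0"
          by (rule tendsto_sandwich[OF _ _ tendsto_const elim]) (auto simp: le)
        have "\<forall>\<^sub>F n in sequentially. min 1 \<bar>X (r n) i \<omega> - Y i \<omega>\<bar> < 1"
          by (rule order_tendstoD(2)[OF min0]) simp
        then have "\<forall>\<^sub>F n in sequentially. min 1 \<bar>X (r n) i \<omega> - Y i \<omega>\<bar> = \<bar>X (r n) i \<omega> - Y i \<omega>\<bar>"
          by eventually_elim auto
        with min0 have "(\<lambda>n. \<bar>X (r n) i \<omega> - Y i \<omega>\<bar>) \<longlonglongrightarrow> 0" by (rule Lim_transform_eventually)
        then show "(\<lambda>n. X (r n) i \<omega>) \<longlonglongrightarrow> Y i \<omega>"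
          by (simp add: tendsto_rabs_zero_iff LIM_zero_iff)
      qed
    qed
    with r(1) show thesis by (rule that)
  qed
  define \<phi> where "\<phi> k a x = max 0 (min 1 (1 - real k * (x - a)))" for k :: nat and a x :: real
  have \<phi>01: "0 \<le> \<phi> k a x" "\<phi> k a x \<le> 1" for k a x by (auto simp: \<phi>_def)
  have \<phi>m [measurable]: "\<phi> k a \<in> borel_measurable borel" for k a unfolding \<phi>_def[abs_def] by measurable
  have prod01: "0 \<le> (\<Prod>i<u. \<phi> k (a i) (x i))" "(\<Prod>i<u. \<phi> k (a i) (x i)) \<le> 1" for k a x
    by (auto intro!: prod_nonneg prod_le_1 \<phi>01)
  have step1: "expectation (\<lambda>\<omega>. (\<Prod>i<u. \<phi> k (a i) (Y i \<omega>)) * H \<omega>)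
      = expectation (\<lambda>\<omega>. \<Prod>i<u. \<phi> k (a i) (Y i \<omega>)) * expectation H" for k and a :: "nat \<Rightarrow> real"
  proof -
    let ?p = "\<lambda>n \<omega>. \<Prod>i<u. \<phi> k (a i) (X (r n) i \<omega>)" and ?q = "\<lambda>\<omega>. \<Prod>i<u. \<phi> k (a i) (Y i \<omega>)"
    have pm [measurable]: "?p n \<in> borel_measurable M" for n
      by (intro borel_measurable_prod measurable_compose[OF X \<phi>m]) simp
    have qm [measurable]: "?q \<in> borel_measurable M"
      by (intro borel_measurable_prod measurable_compose[OF Y \<phi>m]) simp
    have lim: "AE \<omega> in M. (\<lambda>n. ?p n \<omega>) \<longlonglongrightarrow> ?q \<omega>"
      using ae unfolding \<phi>_def by eventually_elim (intro tendsto_intros, auto)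
    have "(\<lambda>n. expectation (?p n)) \<longlonglongrightarrow> expectation ?q"
      by (rule integral_dominated_convergence[where w="\<lambda>_. 1"])
         (use lim prod01 in auto)
    then have 1: "(\<lambda>n. expectation (?p n) * expectation H) \<longlonglongrightarrow> expectation ?q * expectation H"
      by (intro tendsto_intros)
    have 2: "(\<lambda>n. expectation (\<lambda>\<omega>. ?p n \<omega> * H \<omega>)) \<longlonglongrightarrow> expectation (\<lambda>\<omega>. ?q \<omega> * H \<omega>)"
    proof (rule integral_dominated_convergence[where w="\<lambda>_. b"])
      show "AE \<omega> in M. (\<lambda>n. ?p n \<omega> * H \<omega>) \<longlonglongrightarrow> ?q \<omega> * H \<omega>"
        using lim by eventually_elim (erule tendsto_mult[OF _ tendsto_const])
      show "AE \<omega> in M. norm (?p n \<omega> * H \<omega>) \<le> b" for n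
      proof (intro AE_I2)
        fix \<omega>
        have "\<bar>?p n \<omega>\<bar> * \<bar>H \<omega>\<bar> \<le> 1 * b" using prod01[of k a "\<lambda>i. X (r n) i \<omega>"] Hb by (intro mult_mono) auto
        then show "norm (?p n \<omega> * H \<omega>) \<le> b" by (simp add: abs_mult)
      qed
    qed auto
    have "expectation (\<lambda>\<omega>. ?p n \<omega> * H \<omega>) = expectation (?p n) * expectation H" for n
    proof -
      have m: "(\<lambda>x. \<Prod>i<u. \<phi> k (a i) (x i)) \<in> borel_measurable ?\<Pi>" by measurable
      show ?thesis using unc[OF m, of "r n"] prod01[of k a] by (auto simp: abs_le_iff)
    qed
    with 2 have "(\<lambda>n. expectation (?p n) * expectation H) \<longlonglongrightarrow> expectation (\<lambda>\<omega>. ?q \<omega> * H \<omega>)" by simp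
    then show ?thesis using 1 by (rule LIMSEQ_unique)
  qed
  have \<phi>_lim: "(\<lambda>k. \<phi> k a x) \<longlonglongrightarrow> indicator {..a} x" for a x
  proof (cases "x \<le> a")
    case True
    then have "\<phi> k a x = 1" for k by (simp add: \<phi>_def mult_nonneg_nonpos)
    then show ?thesis using True by simp
  next
    case False
    obtain N :: nat where N: "1 / (x - a) < real N" using reals_Archimedean2 by blast
    have "\<phi> k a x = 0" if "k \<ge> N" for k
    proof -
      have "1 < real N * (x - a)" using N False by (simp add: pos_divide_less_eq)
      also have "\<dots> \<le> real k * (x - a)" using that False by (intro mult_right_mono) auto
      finally show ?thesis by (simp add: \<phi>_def)
    qed
    then have "eventually (\<lambda>k. \<phi> k a x = 0) sequentially" by (auto simp: eventually_sequentially)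
    then show ?thesis using False by (simp add: tendsto_eventually)
  qed
  define box where "box a = (\<Pi>\<^sub>E i\<in>{..<u}. {..a i})" for a :: "nat \<Rightarrow> real"
  have box_ind: "(\<Prod>i<u. indicator {..a i} (Y i \<omega>)) = (indicator (box a) (Z \<omega>) :: real)" for a \<omega>
    by (auto simp: box_def Z_def indicator_def PiE_iff prod_zero_iff)
  have box_m [measurable]: "box a \<in> sets ?\<Pi>" for a unfolding box_def by measurable
  have step2: "expectation (\<lambda>\<omega>. indicator (box a) (Z \<omega>) * H \<omega>)
      = expectation (\<lambda>\<omega>. indicator (box a) (Z \<omega>)) * expectation H" for a
  proof -
    let ?p = "\<lambda>k \<omega>. \<Prod>i<u. \<phi> k (a i) (Y i \<omega>)" and ?q = "\<lambda>\<omega>. indicator (box a) (Z \<omega>) :: real"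
    have pm [measurable]: "?p k \<in> borel_measurable M" for k
      by (intro borel_measurable_prod measurable_compose[OF Y \<phi>m]) simp
    have lim: "(\<lambda>k. ?p k \<omega>) \<longlonglongrightarrow> ?q \<omega>" for \<omega>
      unfolding box_ind[symmetric] by (intro tendsto_prod \<phi>_lim)
    have "(\<lambda>k. expectation (?p k)) \<longlonglongrightarrow> expectation ?q"
      by (rule integral_dominated_convergence[where w="\<lambda>_. 1"]) (use lim prod01 in auto)
    then have 1: "(\<lambda>k. expectation (?p k) * expectation H) \<longlonglongrightarrow> expectation ?q * expectation H"
      by (intro tendsto_intros)
    have 2: "(\<lambda>k. expectation (\<lambda>\<omega>. ?p k \<omega> * H \<omega>)) \<longlonglongrightarrow> expectation (\<lambda>\<omega>. ?q \<omega> * H \<omega>)"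
    proof (rule integral_dominated_convergence[where w="\<lambda>_. b"])
      show "AE \<omega> in M. (\<lambda>k. ?p k \<omega> * H \<omega>) \<longlonglongrightarrow> ?q \<omega> * H \<omega>"
        by (intro AE_I2 tendsto_intros lim)
      show "AE \<omega> in M. norm (?p k \<omega> * H \<omega>) \<le> b" for k
      proof (intro AE_I2)
        fix \<omega>
        have "\<bar>?p k \<omega>\<bar> * \<bar>H \<omega>\<bar> \<le> 1 * b" using prod01[of k a "\<lambda>i. Y i \<omega>"] Hb by (intro mult_mono) auto
        then show "norm (?p k \<omega> * H \<omega>) \<le> b" by (simp add: abs_mult)
      qed
    qed auto
    show ?thesis using 1 2 unfolding step1 by (rule LIMSEQ_unique[rotated])
  qed
  \<comment> \<open>a nonnegative weight, so that both sides of the factorization are measures in the box\<close>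
  define H' where "H' \<omega> = H \<omega> + b" for \<omega>
  have H'0: "0 \<le> H' \<omega>" for \<omega> using Hb[of \<omega>] by (simp add: H'_def abs_le_iff)
  have [measurable]: "H' \<in> borel_measurable M" unfolding H'_def by measurable
  have Hi: "integrable M H" using Hb by (intro integrable_const_bound[of _ b]) auto
  have mult_i: "integrable M (\<lambda>\<omega>. K (Z \<omega>) * H \<omega>)"
    if "K \<in> borel_measurable ?\<Pi>" "\<And>x. x \<in> space ?\<Pi> \<Longrightarrow> \<bar>K x :: real\<bar> \<le> bK" for K bK
  proof (rule integrable_const_bound[of _ "bK * b"])
    show "AE \<omega> in M. norm (K (Z \<omega>) * H \<omega>) \<le> bK * b"
    proof (intro AE_I2)
      fix \<omega> assume "\<omega> \<in> space M"
      then have "\<bar>K (Z \<omega>)\<bar> \<le> bK" using that(2) measurable_space[OF Z] by blast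
      then have "\<bar>K (Z \<omega>)\<bar> * \<bar>H \<omega>\<bar> \<le> bK * b" using Hb by (intro mult_mono) auto
      then show "norm (K (Z \<omega>) * H \<omega>) \<le> bK * b" by (simp add: abs_mult)
    qed
  qed (use that(1) in measurable)
  have K_i: "integrable M (\<lambda>\<omega>. K (Z \<omega>))"
    if "K \<in> borel_measurable ?\<Pi>" "\<And>x. x \<in> space ?\<Pi> \<Longrightarrow> \<bar>K x :: real\<bar> \<le> bK" for K bK
    by (rule integrable_const_bound[of _ bK])
       (use that measurable_space[OF Z] in \<open>auto intro!: measurable_compose[OF Z]\<close>)
  have shift: "expectation (\<lambda>\<omega>. K (Z \<omega>) * H' \<omega>) = expectation (\<lambda>\<omega>. K (Z \<omega>) * H \<omega>) + b * expectation (\<lambda>\<omega>. K (Z \<omega>))"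
    if "K \<in> borel_measurable ?\<Pi>" "\<And>x. x \<in> space ?\<Pi> \<Longrightarrow> \<bar>K x :: real\<bar> \<le> bK" for K bK
    using mult_i[OF that] K_i[OF that] by (simp add: H'_def distrib_left mult.commute)
  define c where "c = expectation H'"
  have c0: "0 \<le> c" unfolding c_def using H'0 by simp
  have c_eq: "c = expectation H + b" using Hi by (simp add: c_def H'_def[abs_def] prob_space)
  let ?N1 = "distr (density M (\<lambda>\<omega>. ennreal (H' \<omega>))) ?\<Pi> Z"
  let ?N2 = "distr (density M (\<lambda>\<omega>. ennreal c)) ?\<Pi> Z"
  have Zd: "Z \<in> measurable (density M f) ?\<Pi>" for f using Z by simp
  have e1: "emeasure ?N1 (box a) = ennreal (expectation (\<lambda>\<omega>. indicator (box a) (Z \<omega>) * H' \<omega>))" for a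
  proof -
    have "emeasure ?N1 (box a) = (\<integral>\<^sup>+\<omega>. ennreal (H' \<omega>) * indicator (Z -` box a \<inter> space M) \<omega> \<partial>M)"
      using Z by (simp add: emeasure_distr[OF Zd] emeasure_density)
    also have "\<dots> = (\<integral>\<^sup>+\<omega>. ennreal (indicator (box a) (Z \<omega>) * H' \<omega>) \<partial>M)"
      by (intro nn_integral_cong) (auto simp: indicator_def)
    also have "\<dots> = ennreal (expectation (\<lambda>\<omega>. indicator (box a) (Z \<omega>) * H' \<omega>))"
    proof (rule nn_integral_eq_integral)
      have "integrable M (\<lambda>\<omega>. indicator (box a) (Z \<omega>) * H \<omega> + indicator (box a) (Z \<omega>) * b)"
        by (intro Bochner_Integration.integrable_add integrable_mult_left mult_i[of _ 1] K_i[of _ 1]) (auto simp: indicator_def)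
      then show "integrable M (\<lambda>\<omega>. indicator (box a) (Z \<omega>) * H' \<omega>)" by (simp add: H'_def distrib_left)
    qed (auto simp: H'0)
    finally show ?thesis .
  qed
  have e2: "emeasure ?N2 (box a) = ennreal (c * expectation (\<lambda>\<omega>. indicator (box a) (Z \<omega>)))" for a
  proof -
    have "emeasure ?N2 (box a) = (\<integral>\<^sup>+\<omega>. ennreal c * indicator (Z -` box a \<inter> space M) \<omega> \<partial>M)"
      using Z by (simp add: emeasure_distr[OF Zd] emeasure_density)
    also have "\<dots> = (\<integral>\<^sup>+\<omega>. ennreal (c * indicator (box a) (Z \<omega>)) \<partial>M)"
      by (intro nn_integral_cong) (auto simp: indicator_def)
    also have "\<dots> = ennreal (expectation (\<lambda>\<omega>. c * indicator (box a) (Z \<omega>)))"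
      using c0 by (intro nn_integral_eq_integral integrable_mult_right K_i[of _ 1]) (auto simp: indicator_def)
    finally show ?thesis by simp
  qed
  have ind_m: "indicator (box a) \<in> borel_measurable ?\<Pi>" for a :: "nat \<Rightarrow> real" by measurable
  have N_eq: "?N1 = ?N2"
  proof (rule measure_eqI_generator_eq[where E="range box" and \<Omega>="\<Pi>\<^sub>E i\<in>{..<u}. UNIV" and A="\<lambda>n. box (\<lambda>_. real n)"])
    show "Int_stable (range box)"
    proof (rule Int_stableI_image)
      fix a a' :: "nat \<Rightarrow> real"
      have "box a \<inter> box a' = box (\<lambda>i. min (a i) (a' i))"
        unfolding box_def PiE_Int by (rule PiE_cong) auto
      then show "\<exists>k\<in>UNIV. box a \<inter> box a' = box k" by blast
    qed
    show "emeasure ?N1 B = emeasure ?N2 B" if "B \<in> range box" for B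
    proof -
      from that obtain a where B: "B = box a" by auto
      have "expectation (\<lambda>\<omega>. indicator (box a) (Z \<omega>) * H' \<omega>) = c * expectation (\<lambda>\<omega>. indicator (box a) (Z \<omega>))"
        using shift[OF ind_m[of a], of 1] step2[of a] by (simp add: c_eq algebra_simps indicator_def)
      then show ?thesis unfolding B e1 e2 by simp
    qed
    show "sets ?N1 = sigma_sets (\<Pi>\<^sub>E i\<in>{..<u}. UNIV) (range box)"
      "sets ?N2 = sigma_sets (\<Pi>\<^sub>E i\<in>{..<u}. UNIV) (range box)"
      using sets_PiM_atMost_boxes[of u] by (auto simp: box_def[abs_def])
    show "(\<Union>n. box (\<lambda>_. real n)) = (\<Pi>\<^sub>E i\<in>{..<u}. UNIV)"
    proof (intro equalityI subsetI)
      fix x :: "nat \<Rightarrow> real" assume x: "x \<in> (\<Pi>\<^sub>E i\<in>{..<u}. UNIV)"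
      obtain n :: nat where n: "(\<Sum>i<u. \<bar>x i\<bar>) \<le> real n" using real_arch_simple by blast
      have "x i \<le> real n" if "i < u" for i
      proof -
        have "\<bar>x i\<bar> \<le> (\<Sum>i<u. \<bar>x i\<bar>)" using that by (intro member_le_sum) auto
        then show ?thesis using n by linarith
      qed
      then show "x \<in> (\<Union>n. box (\<lambda>_. real n))" using x by (auto simp: box_def PiE_iff)
    qed (auto simp: box_def PiE_iff)
    show "emeasure ?N1 (box (\<lambda>_. real n)) \<noteq> \<infinity>" for n unfolding e1 by simp
  qed (auto simp: box_def)
  have "expectation (\<lambda>\<omega>. F (Z \<omega>) * H' \<omega>) = (\<integral>x. F x \<partial>?N1)"
    using H'0 by (subst integral_distr[OF Zd F], subst integral_density) (auto simp: mult.commute)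
  also have "\<dots> = (\<integral>x. F x \<partial>?N2)" by (simp only: N_eq)
  also have "\<dots> = c * expectation (\<lambda>\<omega>. F (Z \<omega>))"
    using c0 by (subst integral_distr[OF Zd F], subst integral_density) auto
  finally have "expectation (\<lambda>\<omega>. F (Z \<omega>) * H \<omega>) = expectation (\<lambda>\<omega>. F (Z \<omega>)) * expectation H"
    using shift[OF F Fb] by (simp add: c_eq algebra_simps)
  then show ?thesis by (simp add: Z_def)
qed

section \<open>Covariances and the far part of the kernel\<close>

context square_integrable_levy_basis
begin

text \<open>
  Let \<open>w n\<close> be the approximation \<open>h n\<close> of \<open>fp\<close> restricted to the complement of \<open>S\<close>. Its integral is
  independent of the variables \<open>Yq i\<close>, since the kernels \<open>fq i\<close> vanish wherever \<open>w n\<close> does not. Subtracting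
  \<open>G\<close> of this integral from \<open>G Yp\<close> does not change the covariance, and the difference is controlled by the
  distance of \<open>h n\<close> from its limit and the first moment of the integral over \<open>S\<close>.
\<close>

theorem covariance_bound:
  fixes u :: nat
  assumes bound: "moment_bound p a"
    and Yp: "has_levy_integral M \<Lambda> \<pi> levy_space fp Yp" and fp0: "\<And>z. 0 \<le> fp z"
    and fp_int: "integrable control (\<lambda>z. fp z ^ p)"
    and Yq: "\<And>i. i < u \<Longrightarrow> has_levy_integral M \<Lambda> \<pi> levy_space (fq i) (Yq i)"
    and fq0: "\<And>i z. i < u \<Longrightarrow> 0 \<le> fq i z"
    and fq_int: "\<And>i. i < u \<Longrightarrow> integrable control (\<lambda>z. fq i z ^ p)"
    and S: "S \<in> sets borel" and sep: "\<And>i z. i < u \<Longrightarrow> z \<notin> S \<Longrightarrow> fq i z = 0 \<or> fp z = 0"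
    and F: "F \<in> borel_measurable (\<Pi>\<^sub>M i\<in>{..<u}. (borel :: real measure))"
    and Fb: "\<And>x. x \<in> space (\<Pi>\<^sub>M i\<in>{..<u}. (borel :: real measure)) \<Longrightarrow> \<bar>F x :: real\<bar> \<le> bF"
    and G: "G \<in> borel_measurable borel" and Gb: "\<And>x. \<bar>G x\<bar> \<le> bG"
    and GL: "\<And>x y. \<bar>G x - G y\<bar> \<le> L * \<bar>x - y :: real\<bar>" and L: "0 \<le> L"
    and K: "0 \<le> K" and far: "a * (\<integral>z. (fp z * indicator S z) ^ p \<partial>control) \<le> K ^ p"
  shows "\<bar>covariance M (\<lambda>\<omega>. F (\<lambda>i\<in>{..<u}. Yq i \<omega>)) (\<lambda>\<omega>. G (Yp \<omega>))\<bar> \<le> 2 * bF * (L * K)"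
proof -
  from bound have p: "1 \<le> p" and a: "0 \<le> a" and int: "\<And>g. levy_simple g \<Longrightarrow> integrable M (simple_int g)"
    and mom: "\<And>g. levy_simple g \<Longrightarrow>
      (expectation (\<lambda>\<omega>. \<bar>simple_int g \<omega>\<bar>)) ^ p \<le> a * (\<integral>z. \<bar>g z\<bar> ^ p \<partial>control)"
    by (auto simp: moment_bound_def)
  have Ypm [measurable]: "Yp \<in> borel_measurable M" and fpm [measurable]: "fp \<in> borel_measurable borel"
    using Yp by (auto simp: has_levy_integral_def)
  have Yqm: "Yq i \<in> borel_measurable M" and fqm: "fq i \<in> borel_measurable borel" if "i < u" for i
    using Yq[OF that] by (auto simp: has_levy_integral_def)
  note [measurable] = F G S
  \<comment> \<open>approximations from below inherit the separation of the kernels outside \<open>S\<close>\<close>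
  obtain h where h: "\<And>n. levy_simple (h n)" and h0: "\<And>n z. 0 \<le> h n z" and hf: "\<And>n z. h n z \<le> fp z"
    and h_lim: "AE z in control. (\<lambda>n. h n z) \<longlonglongrightarrow> fp z"
    and h_C: "\<And>e. 0 < e \<Longrightarrow> \<exists>N. \<forall>n\<ge>N. \<forall>m\<ge>N. (\<integral>z. \<bar>h n z - h m z\<bar> ^ p \<partial>control) < e"
    using levy_simple_approximation[OF fpm fp0 p fp_int] by blast
  have h_conv: "(\<lambda>n. ky_fan (simple_int (h n)) Yp) \<longlonglongrightarrow> 0"
    by (rule integral_limit_of_simple[OF bound Yp h h_lim h_C])
  have "\<forall>i. \<exists>g. i < u \<longrightarrow> (\<forall>n. levy_simple (g n)) \<and> (\<forall>n z. 0 \<le> g n z) \<and> (\<forall>n z. g n z \<le> fq i z) \<and>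
      (\<lambda>n. ky_fan (simple_int (g n)) (Yq i)) \<longlonglongrightarrow> 0"
  proof
    fix i
    show "\<exists>g. i < u \<longrightarrow> (\<forall>n. levy_simple (g n)) \<and> (\<forall>n z. 0 \<le> g n z) \<and> (\<forall>n z. g n z \<le> fq i z) \<and>
        (\<lambda>n. ky_fan (simple_int (g n)) (Yq i)) \<longlonglongrightarrow> 0"
    proof (cases "i < u")
      case True
      obtain g where g: "\<And>n. levy_simple (g n)" "\<And>n z. 0 \<le> g n z" "\<And>n z. g n z \<le> fq i z"
        "AE z in control. (\<lambda>n. g n z) \<longlonglongrightarrow> fq i z"
        "\<And>e. 0 < e \<Longrightarrow> \<exists>N. \<forall>n\<ge>N. \<forall>m\<ge>N. (\<integral>z. \<bar>g n z - g m z\<bar> ^ p \<partial>control) < e"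
        using levy_simple_approximation[OF fqm[OF True] fq0[OF True] p fq_int[OF True]] by blast
      have "(\<lambda>n. ky_fan (simple_int (g n)) (Yq i)) \<longlonglongrightarrow> 0"
        by (rule integral_limit_of_simple[OF bound Yq[OF True] g(1) g(4) g(5)])
      with g(1-3) show ?thesis by blast
    qed simp
  qed
  then obtain g where "\<forall>i. i < u \<longrightarrow> (\<forall>n. levy_simple (g i n)) \<and> (\<forall>n z. 0 \<le> g i n z) \<and>
      (\<forall>n z. g i n z \<le> fq i z) \<and> (\<lambda>n. ky_fan (simple_int (g i n)) (Yq i)) \<longlonglongrightarrow> 0"
    by (rule choice[THEN exE])
  then have g: "\<And>i n. i < u \<Longrightarrow> levy_simple (g i n)" and g0: "\<And>i n z. i < u \<Longrightarrow> 0 \<le> g i n z"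
    and gf: "\<And>i n z. i < u \<Longrightarrow> g i n z \<le> fq i z"
    and g_conv: "\<And>i. i < u \<Longrightarrow> (\<lambda>n. ky_fan (simple_int (g i n)) (Yq i)) \<longlonglongrightarrow> 0"
    by blast+
  define w where "w n z = h n z * indicator (- S) z" for n z
  have S': "- S \<in> sets borel" using S by (simp add: borel_comp)
  have w: "levy_simple (w n)" for n unfolding w_def[abs_def] by (rule levy_simple_indicator[OF h S'])
  note [measurable] = measurable_simple_int[OF w] measurable_simple_int[OF h]
  define U where "U \<omega> = F (\<lambda>i\<in>{..<u}. Yq i \<omega>)" for \<omega>
  have Z: "(\<lambda>\<omega>. \<lambda>i\<in>{..<u}. Yq i \<omega>) \<in> measurable M (\<Pi>\<^sub>M i\<in>{..<u}. borel)"
    by (rule measurable_restrict) (use Yqm in auto)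
  have Um [measurable]: "U \<in> borel_measurable M" unfolding U_def by (rule measurable_compose[OF Z F])
  have Ub: "\<bar>U \<omega>\<bar> \<le> bF" for \<omega> unfolding U_def by (rule Fb) (simp add: space_PiM)
  have Ui: "integrable M U" using Ub by (intro integrable_const_bound[of _ bF]) auto
  have unc: "expectation (\<lambda>\<omega>. U \<omega> * G (simple_int (w n) \<omega>)) = expectation U * expectation (\<lambda>\<omega>. G (simple_int (w n) \<omega>))" for n
    unfolding U_def
  proof (rule uncorrelated_limit[where X="\<lambda>k i. simple_int (g i k)" and Y=Yq, OF _ _ g_conv])
    show "simple_int (g i k) \<in> borel_measurable M" if "i < u" for k i
      by (rule measurable_simple_int[OF g[OF that]])
    show "Yq i \<in> borel_measurable M" if "i < u" for i by (rule Yqm[OF that])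
    show "(\<lambda>\<omega>. G (simple_int (w n) \<omega>)) \<in> borel_measurable M" by measurable
    show "\<bar>G (simple_int (w n) \<omega>)\<bar> \<le> bG" for \<omega> by (rule Gb)
    fix k and F' :: "(nat \<Rightarrow> real) \<Rightarrow> real"
    assume F': "F' \<in> borel_measurable (\<Pi>\<^sub>M i\<in>{..<u}. (borel :: real measure))"
      "\<And>x. x \<in> space (\<Pi>\<^sub>M i\<in>{..<u}. (borel :: real measure)) \<Longrightarrow> \<bar>F' x\<bar> \<le> 1"
    show "expectation (\<lambda>\<omega>. F' (\<lambda>i\<in>{..<u}. simple_int (g i k) \<omega>) * G (simple_int (w n) \<omega>))
       = expectation (\<lambda>\<omega>. F' (\<lambda>i\<in>{..<u}. simple_int (g i k) \<omega>)) * expectation (\<lambda>\<omega>. G (simple_int (w n) \<omega>))"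
    proof (rule simple_int_disjoint_uncorrelated[OF g w _ F' G Gb])
      fix i z assume i: "i < u"
      show "g i k z = 0 \<or> w n z = 0"
      proof (cases "z \<in> S")
        case False
        from sep[OF i this] show ?thesis
          using g0[OF i, of k z] gf[OF i, of k z] h0[of n z] hf[of n z] by (auto simp: w_def)
      qed (simp add: w_def)
    qed
  qed (use F Fb in auto)
  \<comment> \<open>the two integrals differ by the integral of \<open>h n\<close> over \<open>S\<close>, to which the moment bound applies\<close>
  have far_L1: "expectation (\<lambda>\<omega>. \<bar>simple_int (h n) \<omega> - simple_int (w n) \<omega>\<bar>) \<le> K" for n
  proof (rule power_le_imp_le_base)
    have p': "p = Suc (p - 1)" using p by simp
    have d: "levy_simple (\<lambda>z. h n z - w n z)" by (rule levy_simple_diff[OF h w])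
    note [measurable] = measurable_simple_int[OF d]
    have "expectation (\<lambda>\<omega>. \<bar>simple_int (h n) \<omega> - simple_int (w n) \<omega>\<bar>)
        = expectation (\<lambda>\<omega>. \<bar>simple_int (\<lambda>z. h n z - w n z) \<omega>\<bar>)"
    proof (rule integral_cong_AE)
      show "AE \<omega> in M. \<bar>simple_int (h n) \<omega> - simple_int (w n) \<omega>\<bar> = \<bar>simple_int (\<lambda>z. h n z - w n z) \<omega>\<bar>"
        using simple_int_diff[OF h w, of n n] by eventually_elim simp
    qed measurable
    then have "(expectation (\<lambda>\<omega>. \<bar>simple_int (h n) \<omega> - simple_int (w n) \<omega>\<bar>)) ^ p
        \<le> a * (\<integral>z. \<bar>h n z - w n z\<bar> ^ p \<partial>control)"
      using mom[OF d] by simp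
    also have "\<dots> \<le> a * (\<integral>z. (fp z * indicator S z) ^ p \<partial>control)"
    proof (intro mult_left_mono[OF integral_mono a])
      show "integrable control (\<lambda>z. \<bar>h n z - w n z\<bar> ^ p)" by (rule integrable_levy_simple_power[OF d p])
      have "integrable control (\<lambda>z. fp z ^ p * indicator S z)"
        by (rule integrable_real_mult_indicator[OF _ fp_int]) (use S in \<open>simp only: sets_control\<close>)
      moreover have "(fp z * indicator S z) ^ p = fp z ^ p * indicator S z" for z
        using p by (auto simp: indicator_def)
      ultimately show "integrable control (\<lambda>z. (fp z * indicator S z) ^ p)" by simp
      fix z
      show "\<bar>h n z - w n z\<bar> ^ p \<le> (fp z * indicator S z) ^ p"
        using h0[of n z] hf[of n z] fp0[of z] by (intro power_mono) (auto simp: w_def indicator_def)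
    qed
    also have "\<dots> \<le> K ^ p" by (rule far)
    finally show "(expectation (\<lambda>\<omega>. \<bar>simple_int (h n) \<omega> - simple_int (w n) \<omega>\<bar>)) ^ Suc (p - 1) \<le> K ^ Suc (p - 1)"
      using p' by simp
  qed (rule K)
  have bF: "0 \<le> bF" using Ub[of undefined] by (rule order_trans[OF abs_ge_zero])
  have bG: "0 \<le> bG" using Gb[of 0] by (rule order_trans[OF abs_ge_zero])
  let ?D = "\<lambda>\<omega>. G (Yp \<omega>)" and ?W = "\<lambda>n \<omega>. G (simple_int (w n) \<omega>)"
  have Di: "integrable M ?D" and Wi: "integrable M (?W n)" for n
    using Gb by (auto intro!: integrable_const_bound[of _ bG])
  have prod_i: "integrable M (\<lambda>\<omega>. U \<omega> * V \<omega>)" if [measurable]: "V \<in> borel_measurable M" and Vb: "\<And>\<omega>. \<bar>V \<omega>\<bar> \<le> bG" for V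
  proof (rule integrable_const_bound[of _ "bF * bG"])
    show "AE \<omega> in M. norm (U \<omega> * V \<omega>) \<le> bF * bG"
      using Ub Vb bF by (intro AE_I2) (auto simp: abs_mult intro!: mult_mono)
  qed measurable
  have bound_n: "\<bar>covariance M U ?D\<bar> \<le> 2 * bF * ((2 * bG + L) * ky_fan (simple_int (h n)) Yp + L * K)" for n
  proof -
    let ?E = "expectation (\<lambda>\<omega>. \<bar>?D \<omega> - ?W n \<omega>\<bar>)"
    have DWi: "integrable M (\<lambda>\<omega>. \<bar>?D \<omega> - ?W n \<omega>\<bar>)" using Di Wi by auto
    have UD: "integrable M (\<lambda>\<omega>. U \<omega> * ?D \<omega>)" "integrable M (\<lambda>\<omega>. U \<omega> * ?W n \<omega>)"
      by (rule prod_i; use Gb in auto)+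
    have "covariance M U ?D = expectation (\<lambda>\<omega>. U \<omega> * ?D \<omega>) - expectation U * expectation ?D"
    proof -
      have "covariance M U ?D = expectation (\<lambda>\<omega>. U \<omega> * ?D \<omega> - expectation ?D * U \<omega> - expectation U * ?D \<omega> + expectation U * expectation ?D)"
        unfolding covariance_def by (intro Bochner_Integration.integral_cong) (auto simp: algebra_simps)
      also have "\<dots> = expectation (\<lambda>\<omega>. U \<omega> * ?D \<omega>) - expectation ?D * expectation U - expectation U * expectation ?D + expectation U * expectation ?D"
        using UD(1) Ui Di by (simp add: prob_space)
      finally show ?thesis by simp
    qed
    also have "\<dots> = expectation (\<lambda>\<omega>. U \<omega> * (?D \<omega> - ?W n \<omega>)) - expectation U * expectation (\<lambda>\<omega>. ?D \<omega> - ?W n \<omega>)"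
      using UD Di Wi[of n] unc[of n] by (simp add: right_diff_distrib)
    finally have "\<bar>covariance M U ?D\<bar> \<le> \<bar>expectation (\<lambda>\<omega>. U \<omega> * (?D \<omega> - ?W n \<omega>))\<bar> + \<bar>expectation U * expectation (\<lambda>\<omega>. ?D \<omega> - ?W n \<omega>)\<bar>"
      using abs_triangle_ineq4 by simp
    also have "\<bar>expectation (\<lambda>\<omega>. U \<omega> * (?D \<omega> - ?W n \<omega>))\<bar> \<le> expectation (\<lambda>\<omega>. bF * \<bar>?D \<omega> - ?W n \<omega>\<bar>)"
      unfolding real_norm_def[symmetric]
    proof (rule order_trans[OF integral_norm_bound integral_mono])
      show "integrable M (\<lambda>\<omega>. norm (U \<omega> * (?D \<omega> - ?W n \<omega>)))"
        using Bochner_Integration.integrable_diff[OF UD] by (simp add: right_diff_distrib)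
      show "integrable M (\<lambda>\<omega>. bF * norm (?D \<omega> - ?W n \<omega>))" using DWi by simp
      show "norm (U \<omega> * (?D \<omega> - ?W n \<omega>)) \<le> bF * norm (?D \<omega> - ?W n \<omega>)" for \<omega>
        unfolding norm_mult using Ub[of \<omega>] by (intro mult_right_mono) auto
    qed
    also have "\<dots> = bF * ?E" by simp
    also have "\<bar>expectation U * expectation (\<lambda>\<omega>. ?D \<omega> - ?W n \<omega>)\<bar> \<le> bF * ?E"
      unfolding abs_mult
    proof (intro mult_mono)
      show "\<bar>expectation U\<bar> \<le> bF"
      proof -
        have "\<bar>expectation U\<bar> \<le> expectation (\<lambda>\<omega>. \<bar>U \<omega>\<bar>)" by (rule integral_abs_bound)
        also have "\<dots> \<le> expectation (\<lambda>_. bF)" using Ui Ub by (intro integral_mono) auto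
        finally show ?thesis by (simp add: prob_space)
      qed
      show "\<bar>expectation (\<lambda>\<omega>. ?D \<omega> - ?W n \<omega>)\<bar> \<le> ?E" by (rule integral_abs_bound)
    qed (use bF in auto)
    finally have cov: "\<bar>covariance M U ?D\<bar> \<le> 2 * bF * ?E" by simp
    let ?k = "\<lambda>\<omega>. min 1 \<bar>simple_int (h n) \<omega> - Yp \<omega>\<bar>" and ?d = "\<lambda>\<omega>. \<bar>simple_int (h n) \<omega> - simple_int (w n) \<omega>\<bar>"
    have ki: "integrable M ?k" by (rule integrable_min_1) measurable
    have di: "integrable M ?d" using int[OF h] int[OF w] by auto
    have "?E \<le> expectation (\<lambda>\<omega>. (2 * bG + L) * ?k \<omega> + L * ?d \<omega>)"
    proof (rule integral_mono[OF DWi])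
      show "integrable M (\<lambda>\<omega>. (2 * bG + L) * ?k \<omega> + L * ?d \<omega>)" using ki di by auto
      fix \<omega>
      have "\<bar>?D \<omega> - G (simple_int (h n) \<omega>)\<bar> \<le> (2 * bG + L) * ?k \<omega>"
      proof (cases "\<bar>simple_int (h n) \<omega> - Yp \<omega>\<bar> \<le> 1")
        case True
        have "\<bar>?D \<omega> - G (simple_int (h n) \<omega>)\<bar> \<le> L * \<bar>simple_int (h n) \<omega> - Yp \<omega>\<bar>"
          using GL[of "Yp \<omega>" "simple_int (h n) \<omega>"] by (simp add: abs_minus_commute)
        also have "\<dots> \<le> (2 * bG + L) * \<bar>simple_int (h n) \<omega> - Yp \<omega>\<bar>" using bG by (intro mult_right_mono) auto
        finally show ?thesis using True by (simp add: min_absorb2)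
      next
        case False
        have "\<bar>?D \<omega> - G (simple_int (h n) \<omega>)\<bar> \<le> 2 * bG + L"
          using Gb[of "Yp \<omega>"] Gb[of "simple_int (h n) \<omega>"] L by linarith
        then show ?thesis using False by (simp add: min_absorb1)
      qed
      moreover have "\<bar>G (simple_int (h n) \<omega>) - ?W n \<omega>\<bar> \<le> L * ?d \<omega>" by (rule GL)
      ultimately show "\<bar>?D \<omega> - ?W n \<omega>\<bar> \<le> (2 * bG + L) * ?k \<omega> + L * ?d \<omega>" by linarith
    qed
    also have "\<dots> = (2 * bG + L) * ky_fan (simple_int (h n)) Yp + L * expectation ?d"
      using ki di by (simp add: ky_fan_def)
    also have "\<dots> \<le> (2 * bG + L) * ky_fan (simple_int (h n)) Yp + L * K"
      using far_L1[of n] L by (intro add_left_mono mult_left_mono) auto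
    finally have "2 * bF * ?E \<le> 2 * bF * ((2 * bG + L) * ky_fan (simple_int (h n)) Yp + L * K)"
      using bF by (intro mult_left_mono) auto
    with cov show ?thesis by linarith
  qed
  have "\<bar>covariance M U ?D\<bar> \<le> 2 * bF * ((2 * bG + L) * 0 + L * K)"
  proof (rule LIMSEQ_le_const)
    show "(\<lambda>n. 2 * bF * ((2 * bG + L) * ky_fan (simple_int (h n)) Yp + L * K)) \<longlonglongrightarrow> 2 * bF * ((2 * bG + L) * 0 + L * K)"
      by (intro tendsto_intros h_conv)
  qed (use bound_n in blast)
  then show ?thesis by (simp add: U_def[abs_def])
qed

end

section \<open>Overlap of ambit sets and the mass of the far part\<close>

text \<open>
  The maximum norm of \<open>p - q\<close> is attained by the time coordinate or bounded by the Euclidean norm of the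
  space coordinates; in the second case \<open>\<xi>\<close> is within \<open>c * (fst p - s)\<close> of both space coordinates.
\<close>

lemma ambit_overlap_far:
  fixes p q :: "real \<times> (real ^ 'm::{finite,linorder})"
  assumes q: "q \<in> lex_past p h" and c: "0 < c" and r: "r \<le> h" "2 * c * r \<le> h"
    and z: "(s, \<xi>) \<in> ambit_set c p" "(s, \<xi>) \<in> ambit_set c q"
  shows "s \<le> fst p - r"
proof -
  from z have s: "s \<le> fst p" "s \<le> fst q" and n: "norm (snd p - \<xi>) \<le> c * (fst p - s)" "norm (snd q - \<xi>) \<le> c * (fst q - s)"
    by (auto simp: ambit_set_def)
  from q have t: "fst q \<le> fst p" and h: "h \<le> infnorm (p - q)" by (auto simp: lex_past_def lex_less_def)
  have "infnorm (p - q) \<le> max (fst p - fst q) (norm (snd p - snd q))"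
    unfolding infnorm_Max
  proof (rule Max.boundedI)
    fix y assume "y \<in> (\<lambda>i. \<bar>(p - q) \<bullet> i\<bar>) ` Basis"
    then obtain b where b: "b \<in> Basis" and y: "y = \<bar>(p - q) \<bullet> b\<bar>" by auto
    from b show "y \<le> max (fst p - fst q) (norm (snd p - snd q))"
      unfolding y Basis_prod_def
    proof (elim UnE imageE)
      fix i :: real assume i: "b = (i, 0)" "i \<in> Basis"
      then show "\<bar>(p - q) \<bullet> b\<bar> \<le> max (fst p - fst q) (norm (snd p - snd q))"
        using t by (simp add: inner_prod_def)
    next
      fix j assume j: "b = (0, j)" "j \<in> Basis"
      then show "\<bar>(p - q) \<bullet> b\<bar> \<le> max (fst p - fst q) (norm (snd p - snd q))"
        using Basis_le_norm[OF j(2), of "snd p - snd q"] by (simp add: inner_prod_def)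
    qed
  qed auto
  with h have "h \<le> fst p - fst q \<or> h \<le> norm (snd p - snd q)" by (auto simp: max_def split: if_splits)
  then show ?thesis
  proof
    assume "h \<le> fst p - fst q"
    then show ?thesis using s r(1) by linarith
  next
    assume "h \<le> norm (snd p - snd q)"
    also have "\<dots> \<le> norm (snd p - \<xi>) + norm (snd q - \<xi>)"
      using norm_triangle_ineq4[of "snd p - \<xi>" "snd q - \<xi>"] by simp
    also have "\<dots> \<le> c * (fst p - s) + c * (fst p - s)"
      using n t c mult_left_mono[of "fst q - s" "fst p - s" c] by linarith
    finally have "2 * c * r \<le> 2 * c * (fst p - s)" using r(2) by (simp add: mult.assoc)
    then have "r \<le> fst p - s" using c by simp
    then show ?thesis by linarith
  qed
qed

text \<open>
  The upper incomplete gamma function at integer order.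
\<close>

lemma nn_integral_power_times_exp_atLeast:
  assumes a: "0 \<le> a"
  shows "(\<integral>\<^sup>+x. ennreal (x ^ m * exp (- x)) * indicator {a..} x \<partial>lborel)
    = ennreal (fact m * (\<Sum>j\<le>m. a ^ j / fact j) * exp (- a))"
proof -
  let ?F = "\<lambda>x::real. - (fact m * (\<Sum>j\<le>m. x ^ j / fact j) * exp (- x))"
  have der: "((\<lambda>x. (\<Sum>j\<le>n. x ^ j / fact j) * exp (- x)) has_real_derivative - (x ^ n / fact n * exp (- x))) (at x)" for n and x :: real
  proof (induction n)
    case 0
    then show ?case by (auto intro!: derivative_eq_intros)
  next
    case (Suc n)
    have "((\<lambda>x. x ^ Suc n / fact (Suc n) * exp (- x)) has_real_derivative
        x ^ n / fact n * exp (- x) - x ^ Suc n / fact (Suc n) * exp (- x)) (at x)"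
      by (auto intro!: derivative_eq_intros simp: fact_Suc divide_simps simp del: of_nat_Suc power_Suc)
    from DERIV_add[OF Suc this] show ?case by (simp add: distrib_right)
  qed
  have DF: "(?F has_real_derivative x ^ m * exp (- x)) (at x)" for x :: real
    using DERIV_cmult[OF der[where n=m], of "- fact m" x] by (simp add: mult.assoc)
  have "((\<lambda>x::real. - (fact m * (\<Sum>j\<le>m. x ^ j / exp x / fact j))) \<longlongrightarrow> - (fact m * (\<Sum>j\<le>m. 0 / fact j))) at_top"
    by (intro tendsto_intros tendsto_power_div_exp_0) auto
  then have lim: "(?F \<longlongrightarrow> 0) at_top"
    by (simp add: exp_minus divide_inverse sum_distrib_right sum_distrib_left mult_ac)
  have "(\<integral>\<^sup>+x. ennreal (x ^ m * exp (- x)) * indicator {a..} x \<partial>lborel) = ennreal (0 - ?F a)"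
    by (rule nn_integral_FTC_atLeast[OF _ DF _ lim]) (use a in auto)
  then show ?thesis by simp
qed

lemma nn_integral_power_times_exp_scaled:
  assumes b: "0 < b" and r: "0 \<le> r"
  shows "(\<integral>\<^sup>+x. ennreal (x ^ m * exp (- (b * x))) * indicator {r..} x \<partial>lborel)
    = ennreal (fact m / b ^ Suc m * (\<Sum>j\<le>m. (b * r) ^ j / fact j) * exp (- (b * r)))"
proof -
  let ?I = "\<integral>\<^sup>+x. ennreal (x ^ m * exp (- (b * x))) * indicator {r..} x \<partial>lborel"
  have "ennreal (fact m * (\<Sum>j\<le>m. (b * r) ^ j / fact j) * exp (- (b * r)))
     = (\<integral>\<^sup>+x. ennreal (x ^ m * exp (- x)) * indicator {b * r..} x \<partial>lborel)"
    using b r by (intro nn_integral_power_times_exp_atLeast[symmetric]) simp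
  also have "\<dots> = ennreal b * (\<integral>\<^sup>+x. ennreal ((0 + b * x) ^ m * exp (- (0 + b * x))) * indicator {b * r..} (0 + b * x) \<partial>lborel)"
    using b nn_integral_real_affine[of "\<lambda>x. ennreal (x ^ m * exp (- x)) * indicator {b * r..} x" b 0] by simp
  also have "\<dots> = ennreal b * (\<integral>\<^sup>+x. ennreal (b ^ m) * (ennreal (x ^ m * exp (- (b * x))) * indicator {r..} x) \<partial>lborel)"
  proof (rule arg_cong2[where f="(*)", OF refl], rule nn_integral_cong)
    fix x :: real
    have "(0 + b * x) ^ m * exp (- (0 + b * x)) = b ^ m * (x ^ m * exp (- (b * x)))"
      by (simp add: power_mult_distrib)
    moreover have "indicator {b * r..} (0 + b * x) = (indicator {r..} x :: ennreal)"
      using b by (simp add: indicator_def)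
    moreover have "ennreal (b ^ m * (x ^ m * exp (- (b * x)))) = ennreal (b ^ m) * ennreal (x ^ m * exp (- (b * x)))"
      using b by (intro ennreal_mult') simp
    ultimately show "ennreal ((0 + b * x) ^ m * exp (- (0 + b * x))) * indicator {b * r..} (0 + b * x)
        = ennreal (b ^ m) * (ennreal (x ^ m * exp (- (b * x))) * indicator {r..} x)"
      by (simp only: mult.assoc)
  qed
  also have "\<dots> = ennreal b * (ennreal (b ^ m) * ?I)" by (subst nn_integral_cmult) auto
  also have "\<dots> = ennreal (b ^ Suc m) * ?I" using b by (simp add: ennreal_mult' mult.assoc)
  finally have eq: "ennreal (fact m * (\<Sum>j\<le>m. (b * r) ^ j / fact j) * exp (- (b * r))) = ennreal (b ^ Suc m) * ?I" .
  have "?I = ennreal (1 / b ^ Suc m) * (ennreal (b ^ Suc m) * ?I)"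
    using b by (subst mult.assoc[symmetric], subst ennreal_mult'[symmetric]) auto
  also have "\<dots> = ennreal (1 / b ^ Suc m * (fact m * (\<Sum>j\<le>m. (b * r) ^ j / fact j) * exp (- (b * r))))"
    unfolding eq[symmetric] using b by (subst ennreal_mult'[symmetric]) auto
  finally show ?thesis by simp
qed

lemma nn_integral_powr_times_exp:
  assumes b: "0 < b" and s: "0 < s"
  shows "(\<integral>\<^sup>+l. ennreal (l powr (s - 1) * exp (- (b * l))) * indicator {0<..} l \<partial>lborel)
    = ennreal (Gamma s / b powr s)"
proof -
  let ?I = "\<integral>\<^sup>+l. ennreal (l powr (s - 1) * exp (- (b * l))) * indicator {0<..} l \<partial>lborel"
  let ?f = "\<lambda>t. ennreal (indicator {0..} t * t powr (s - 1) / exp t)"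
  have "ennreal (Gamma s) = (\<integral>\<^sup>+t. ?f t \<partial>lborel)" by (rule Gamma_conv_nn_integral_real[OF s])
  also have "\<dots> = ennreal b * (\<integral>\<^sup>+t. ?f (0 + b * t) \<partial>lborel)"
    using b nn_integral_real_affine[of ?f b 0] by simp
  also have "(\<integral>\<^sup>+t. ?f (0 + b * t) \<partial>lborel)
      = (\<integral>\<^sup>+t. ennreal (b powr (s - 1)) * (ennreal (t powr (s - 1) * exp (- (b * t))) * indicator {0<..} t) \<partial>lborel)"
  proof (intro nn_integral_cong)
    fix t :: real
    show "?f (0 + b * t) = ennreal (b powr (s - 1)) * (ennreal (t powr (s - 1) * exp (- (b * t))) * indicator {0<..} t)"
    proof (cases "0 < t")
      case True
      then show ?thesis using b by (simp add: powr_mult exp_minus divide_inverse mult.assoc flip: ennreal_mult')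
    next
      case False
      then show ?thesis using b by (cases "t = 0") (auto simp: indicator_def zero_le_mult_iff)
    qed
  qed
  also have "\<dots> = ennreal (b powr (s - 1)) * ?I" by (rule nn_integral_cmult) measurable
  finally have eq: "ennreal (Gamma s) = ennreal (b powr s) * ?I"
    using b by (simp add: mult.assoc[symmetric] ennreal_mult'[symmetric] powr_diff)
  have "?I = ennreal (1 / b powr s) * (ennreal (b powr s) * ?I)"
    using b by (subst mult.assoc[symmetric], subst ennreal_mult'[symmetric]) auto
  also have "\<dots> = ennreal (1 / b powr s * Gamma s)"
    unfolding eq[symmetric] by (subst ennreal_mult'[symmetric]) auto
  finally show ?thesis by simp
qed

definition far_set :: "real \<Rightarrow> real \<Rightarrow> (real \<times> real \<times> (real ^ 'm)) set" where
  "far_set t r = {z. fst (snd z) \<le> t - r}"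

lemma far_set_borel [measurable]: "far_set t r \<in> sets borel"
proof -
  have "closed (far_set t r)"
    unfolding far_set_def by (intro closed_Collect_le continuous_intros)
  then show ?thesis by (rule borel_closed)
qed

text \<open>
  The integral of the \<open>k\<close>-th power of the kernel over the far set, divided by the volume of the ball of
  radius \<open>c\<close>. The finite sum is that of the incomplete gamma function.
\<close>

definition far_mass :: "nat \<Rightarrow> real \<Rightarrow> real \<Rightarrow> nat \<Rightarrow> real \<Rightarrow> real" where
  "far_mass m \<alpha> \<beta> k r = fact m * \<beta> powr \<alpha> / real k ^ Suc m *
     (\<Sum>j=0..m. (real k * r) ^ j / (fact j * (real k * r + \<beta>) powr (\<alpha> - real m - 1 + real j)) *
        (Gamma (\<alpha> - real m - 1 + real j) / Gamma \<alpha>))"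

lemma far_mass_nonneg:
  assumes "\<alpha> > real m + 1" "\<beta> > 0" "0 \<le> r"
  shows "0 \<le> far_mass m \<alpha> \<beta> k r"
  unfolding far_mass_def using assms
  by (intro mult_nonneg_nonneg sum_nonneg divide_nonneg_nonneg Gamma_real_nonneg zero_le_power) auto

text \<open>
  Each term of the incomplete gamma function is a power of the rate times an exponential, which
  combines with the Gamma density to another Gamma integral; \<open>\<alpha> > m + 1\<close> makes the smallest exponent
  integrable at \<open>0\<close>.
\<close>

lemma nn_integral_gamma_times_tail:
  assumes \<alpha>: "\<alpha> > real m + 1" and \<beta>: "\<beta> > 0" and k: "0 < k" and r: "0 \<le> r"
  shows "(\<integral>\<^sup>+l. ennreal (gamma_density \<alpha> \<beta> l) *
      ennreal (fact m / (real k * l) ^ Suc m * (\<Sum>j\<le>m. (real k * l * r) ^ j / fact j) * exp (- (real k * l * r))) \<partial>lborel)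
    = ennreal (far_mass m \<alpha> \<beta> k r)"
proof -
  define b where "b = real k * r + \<beta>"
  have b: "0 < b" using \<beta> r by (simp add: b_def add_nonneg_pos)
  define s where "s j = \<alpha> - real m - 1 + real j" for j
  have s: "0 < s j" for j using \<alpha> by (simp add: s_def)
  have G: "0 < Gamma \<alpha>" using \<alpha> by (intro Gamma_real_pos) simp
  define C where "C j = \<beta> powr \<alpha> / Gamma \<alpha> * (fact m / real k ^ Suc m) * ((real k * r) ^ j / fact j)" for j
  have C: "0 \<le> C j" for j using G r by (simp add: C_def)
  have pw: "ennreal (gamma_density \<alpha> \<beta> l) *
      ennreal (fact m / (real k * l) ^ Suc m * (\<Sum>j\<le>m. (real k * l * r) ^ j / fact j) * exp (- (real k * l * r)))
    = (\<Sum>j\<le>m. ennreal (C j) * (ennreal (l powr (s j - 1) * exp (- (b * l))) * indicator {0<..} l))" for l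
  proof (cases "0 < l")
    case True
    have pl: "l powr (s j - 1) = l powr (\<alpha> - 1) * l ^ j / l ^ Suc m" for j
    proof -
      have "s j - 1 = (\<alpha> - 1 + real j) - real (Suc m)" by (simp add: s_def)
      then show ?thesis using True by (simp only: powr_diff powr_add powr_realpow)
    qed
    have e: "exp (- (b * l)) = exp (- \<beta> * l) * exp (- (real k * l * r))"
      by (simp add: b_def exp_add[symmetric] algebra_simps)
    have "gamma_density \<alpha> \<beta> l * (fact m / (real k * l) ^ Suc m * (\<Sum>j\<le>m. (real k * l * r) ^ j / fact j) * exp (- (real k * l * r)))
      = (\<Sum>j\<le>m. gamma_density \<alpha> \<beta> l * (fact m / (real k * l) ^ Suc m * ((real k * l * r) ^ j / fact j) * exp (- (real k * l * r))))"
      by (simp add: sum_distrib_left sum_distrib_right)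
    also have "\<dots> = (\<Sum>j\<le>m. C j * (l powr (s j - 1) * exp (- (b * l))))"
    proof (intro sum.cong refl)
      fix j
      have "gamma_density \<alpha> \<beta> l = \<beta> powr \<alpha> / Gamma \<alpha> * l powr (\<alpha> - 1) * exp (- \<beta> * l)"
        using True by (simp add: gamma_density_def)
      moreover have "(real k * l) ^ Suc m = real k ^ Suc m * l ^ Suc m" "(real k * l * r) ^ j = (real k * r) ^ j * l ^ j"
        by (simp_all only: power_mult_distrib mult.assoc mult.commute mult.left_commute)
      ultimately show "gamma_density \<alpha> \<beta> l * (fact m / (real k * l) ^ Suc m * ((real k * l * r) ^ j / fact j) * exp (- (real k * l * r)))
         = C j * (l powr (s j - 1) * exp (- (b * l)))"
        unfolding e pl C_def by (simp only: times_divide_eq_left times_divide_eq_right divide_divide_eq_left mult.assoc mult.commute mult.left_commute)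
    qed
    finally have eq: "gamma_density \<alpha> \<beta> l * (fact m / (real k * l) ^ Suc m * (\<Sum>j\<le>m. (real k * l * r) ^ j / fact j) * exp (- (real k * l * r)))
      = (\<Sum>j\<le>m. C j * (l powr (s j - 1) * exp (- (b * l))))" .
    have g: "0 \<le> gamma_density \<alpha> \<beta> l" using G by (simp add: gamma_density_def)
    show ?thesis
      unfolding ennreal_mult'[OF g, symmetric] eq using True C
      by (simp add: ennreal_mult'[symmetric] sum_ennreal)
  qed (simp add: gamma_density_def)
  have "(\<integral>\<^sup>+l. ennreal (gamma_density \<alpha> \<beta> l) *
      ennreal (fact m / (real k * l) ^ Suc m * (\<Sum>j\<le>m. (real k * l * r) ^ j / fact j) * exp (- (real k * l * r))) \<partial>lborel)
    = (\<Sum>j\<le>m. \<integral>\<^sup>+l. ennreal (C j) * (ennreal (l powr (s j - 1) * exp (- (b * l))) * indicator {0<..} l) \<partial>lborel)"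
    unfolding pw by (rule nn_integral_sum) measurable
  also have "\<dots> = (\<Sum>j\<le>m. ennreal (C j) * ennreal (Gamma (s j) / b powr s j))"
    by (intro sum.cong refl, subst nn_integral_cmult) (auto simp: nn_integral_powr_times_exp[OF b s])
  also have "\<dots> = ennreal (\<Sum>j\<le>m. C j * (Gamma (s j) / b powr s j))"
    using C s by (subst sum_ennreal[symmetric])
      (auto simp: ennreal_mult'[symmetric] intro!: mult_nonneg_nonneg divide_nonneg_nonneg Gamma_real_nonneg less_imp_le)
  also have "(\<Sum>j\<le>m. C j * (Gamma (s j) / b powr s j)) = far_mass m \<alpha> \<beta> k r"
    unfolding far_mass_def sum_distrib_left atMost_atLeast0[symmetric]
    by (intro sum.cong refl) (simp add: C_def s_def b_def mult_ac)
  finally show ?thesis .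
qed

lemma ambit_set_closed: "closed (ambit_set c p)"
  unfolding ambit_set_def case_prod_beta' by (intro closed_Collect_conj closed_Collect_le continuous_intros)

lemma measurable_mstou_kernel [measurable]:
  fixes p :: "real \<times> (real ^ 'm::finite)"
  shows "mstou_kernel c p \<in> borel_measurable borel"
proof -
  have [measurable]: "ambit_set c p \<in> sets borel" using ambit_set_closed by (rule borel_closed)
  have eq: "mstou_kernel c p = (\<lambda>z. exp (- fst z * (fst p - fst (snd z))) * indicator (ambit_set c p) (snd z))"
    by (auto simp: mstou_kernel_def fun_eq_iff)
  have "(\<lambda>z. indicator (ambit_set c p) (snd z) :: real) \<in> borel_measurable (borel :: (real \<times> real \<times> (real ^ 'm)) measure)"
    unfolding borel_prod[symmetric, where 'a=real and 'b="real \<times> (real ^ 'm)"] by measurable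
  then show ?thesis unfolding eq
    by (rule borel_measurable_times[rotated]) (intro borel_measurable_continuous_onI continuous_intros)
qed

lemma mstou_kernel_nonneg: "0 \<le> mstou_kernel c p z"
  by (cases z) (auto simp: mstou_kernel_def)

lemma mstou_kernel_future: "fst p < s \<Longrightarrow> mstou_kernel c p (l, s, \<xi>) = 0"
  by (auto simp: mstou_kernel_def ambit_set_def)

lemma mstou_kernel_slice:
  fixes p :: "real \<times> (real ^ 'm::finite)"
  assumes c: "0 < c" and k: "0 < k" and r: "0 \<le> r"
  defines "V \<equiv> measure lborel (cball (0 :: real ^ 'm) c)"
  shows "(\<integral>\<^sup>+\<xi>. ennreal ((mstou_kernel c p (l, s, \<xi>) * indicator (far_set (fst p) r) (l, s, \<xi>)) ^ k) \<partial>lborel)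
    = ennreal V * (ennreal ((fst p - s) ^ CARD('m) * exp (- (real k * l * (fst p - s)))) * indicator {r..} (fst p - s))"
proof (cases "r \<le> fst p - s")
  case True
  then have st: "0 \<le> fst p - s" using r by simp
  have ind: "(mstou_kernel c p (l, s, \<xi>) * indicator (far_set (fst p) r) (l, s, \<xi>)) ^ k
     = exp (- (real k * l * (fst p - s))) * indicator (cball (snd p) (c * (fst p - s))) \<xi>" for \<xi>
    using True st k
    by (auto simp: mstou_kernel_def ambit_set_def far_set_def indicator_def dist_norm exp_of_nat_mult[symmetric] mult.assoc)
  have "(\<integral>\<^sup>+\<xi>. ennreal ((mstou_kernel c p (l, s, \<xi>) * indicator (far_set (fst p) r) (l, s, \<xi>)) ^ k) \<partial>lborel)
     = (\<integral>\<^sup>+\<xi>. ennreal (exp (- (real k * l * (fst p - s)))) * indicator (cball (snd p) (c * (fst p - s))) \<xi> \<partial>lborel)"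
    unfolding ind by (intro nn_integral_cong) (auto simp: indicator_def)
  also have "\<dots> = ennreal (exp (- (real k * l * (fst p - s)))) * emeasure lborel (cball (snd p) (c * (fst p - s)))"
    by (rule nn_integral_cmult_indicator) simp
  also have "emeasure lborel (cball (snd p) (c * (fst p - s))) = ennreal (V * (fst p - s) ^ CARD('m))"
  proof -
    have "V = unit_ball_vol (real CARD('m)) * c ^ CARD('m)"
      unfolding V_def using c by (subst content_cball) auto
    then show ?thesis using c st by (subst emeasure_cball) (auto simp: power_mult_distrib mult.assoc)
  qed
  also have "ennreal (exp (- (real k * l * (fst p - s)))) * ennreal (V * (fst p - s) ^ CARD('m))
      = ennreal V * ennreal ((fst p - s) ^ CARD('m) * exp (- (real k * l * (fst p - s))))"
    using st by (simp add: ennreal_mult'[symmetric] V_def ennreal_mult''[symmetric] mult_ac)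
  finally show ?thesis using True by simp
next
  case False
  then have "(mstou_kernel c p (l, s, \<xi>) * indicator (far_set (fst p) r) (l, s, \<xi>)) ^ k = 0" for \<xi>
    using k by (simp add: far_set_def)
  note zero = this
  show ?thesis unfolding zero using False by simp
qed

lemma mstou_kernel_time_integral:
  fixes p :: "real \<times> (real ^ 'm::finite)"
  assumes c: "0 < c" and k: "0 < k" and r: "0 \<le> r" and l: "0 < l"
  defines "V \<equiv> measure lborel (cball (0 :: real ^ 'm) c)"
  shows "(\<integral>\<^sup>+w. ennreal ((mstou_kernel c p (l, w) * indicator (far_set (fst p) r) (l, w)) ^ k) \<partial>lborel)
    = ennreal V * ennreal (fact CARD('m) / (real k * l) ^ Suc CARD('m) *
        (\<Sum>j\<le>CARD('m). (real k * l * r) ^ j / fact j) * exp (- (real k * l * r)))"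
proof -
  let ?f = "\<lambda>z. ennreal ((mstou_kernel c p z * indicator (far_set (fst p) r) z) ^ k)"
  let ?g = "\<lambda>s. ennreal V * (ennreal ((fst p - s) ^ CARD('m) * exp (- (real k * l * (fst p - s)))) * indicator {r..} (fst p - s))"
  have "?f \<in> borel_measurable borel" by measurable
  moreover have "(\<lambda>w. (l, w)) \<in> borel_measurable borel" by (intro borel_measurable_continuous_onI continuous_intros)
  ultimately have "(\<lambda>w. ?f (l, w)) \<in> borel_measurable borel" by (rule measurable_compose[rotated])
  then have m: "(\<lambda>w. ?f (l, w)) \<in> borel_measurable (lborel \<Otimes>\<^sub>M lborel)" by (simp add: lborel_prod)
  have "(\<integral>\<^sup>+w. ?f (l, w) \<partial>lborel) = (\<integral>\<^sup>+w. ?f (l, w) \<partial>(lborel \<Otimes>\<^sub>M lborel))" by (simp only: lborel_prod)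
  also have "\<dots> = (\<integral>\<^sup>+s. \<integral>\<^sup>+\<xi>. ?f (l, s, \<xi>) \<partial>lborel \<partial>lborel)"
    by (rule lborel.nn_integral_fst[OF m, symmetric])
  also have "\<dots> = (\<integral>\<^sup>+s. ?g s \<partial>lborel)"
    unfolding V_def by (simp only: mstou_kernel_slice[OF c k r])
  also have "\<dots> = (\<integral>\<^sup>+s. ?g (fst p + (-1) * s) \<partial>lborel)"
    using nn_integral_real_affine[of ?g "-1" "fst p"] by simp
  also have "\<dots> = (\<integral>\<^sup>+s. ennreal V * (ennreal (s ^ CARD('m) * exp (- (real k * l * s))) * indicator {r..} s) \<partial>lborel)"
    by (intro nn_integral_cong) simp
  also have "\<dots> = ennreal V * (\<integral>\<^sup>+s. ennreal (s ^ CARD('m) * exp (- (real k * l * s))) * indicator {r..} s \<partial>lborel)"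
    by (rule nn_integral_cmult) measurable
  finally show ?thesis using nn_integral_power_times_exp_scaled[of "real k * l" r "CARD('m)"] k l r by simp
qed

text \<open>
  Tonelli's theorem in the order space, time, rate: the spatial slices are balls of radius
  \<open>c * (t - s)\<close>, the time integral is an incomplete gamma function, and the rate is Gamma distributed.
  The case \<open>r = 0\<close> shows that the powers of the kernel are integrable.
\<close>

lemma mstou_kernel_power_integral:
  fixes p :: "real \<times> (real ^ 'm::finite)"
  assumes c: "0 < c" and k: "0 < k" and r: "0 \<le> r"
    and \<alpha>: "\<alpha> > real CARD('m) + 1" and \<beta>: "\<beta> > 0"
  defines "V \<equiv> measure lborel (cball (0 :: real ^ 'm) c)"
    and "\<pi> \<equiv> density lborel (\<lambda>l. ennreal (gamma_density \<alpha> \<beta> l))"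
  shows "integrable (\<pi> \<Otimes>\<^sub>M lborel) (\<lambda>z. (mstou_kernel c p z * indicator (far_set (fst p) r) z) ^ k)"
    and "(\<integral>z. (mstou_kernel c p z * indicator (far_set (fst p) r) z) ^ k \<partial>(\<pi> \<Otimes>\<^sub>M lborel))
      = V * far_mass CARD('m) \<alpha> \<beta> k r"
proof -
  let ?h = "\<lambda>z. (mstou_kernel c p z * indicator (far_set (fst p) r) z) ^ k"
  have V: "0 \<le> V" by (simp add: V_def)
  have [measurable]: "gamma_density \<alpha> \<beta> \<in> borel_measurable borel"
    unfolding gamma_density_def[abs_def] by measurable
  have sets: "sets (\<pi> \<Otimes>\<^sub>M lborel) = sets (borel :: (real \<times> real \<times> (real ^ 'm)) measure)"
  proof -
    have "sets (\<pi> \<Otimes>\<^sub>M lborel) = sets (borel \<Otimes>\<^sub>M borel :: (real \<times> real \<times> (real ^ 'm)) measure)"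
      by (intro sets_pair_measure_cong) (auto simp: \<pi>_def)
    then show ?thesis by (simp only: borel_prod)
  qed
  have "?h \<in> borel_measurable borel" by measurable
  then have m: "?h \<in> borel_measurable (\<pi> \<Otimes>\<^sub>M lborel)" using measurable_cong_sets[OF sets refl] by blast
  have m': "(\<lambda>z. ennreal (?h z)) \<in> borel_measurable (\<pi> \<Otimes>\<^sub>M lborel)" using m by measurable
  have m2: "(\<lambda>l. \<integral>\<^sup>+w. ennreal (?h (l, w)) \<partial>lborel) \<in> borel_measurable \<pi>"
    by (rule lborel.borel_measurable_nn_integral_fst[OF m'])
  let ?t = "\<lambda>l. ennreal (fact CARD('m) / (real k * l) ^ Suc CARD('m) *
        (\<Sum>j\<le>CARD('m). (real k * l * r) ^ j / fact j) * exp (- (real k * l * r)))"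
  have "(\<integral>\<^sup>+z. ennreal (?h z) \<partial>(\<pi> \<Otimes>\<^sub>M lborel)) = (\<integral>\<^sup>+l. \<integral>\<^sup>+w. ennreal (?h (l, w)) \<partial>lborel \<partial>\<pi>)"
    by (rule lborel.nn_integral_fst[OF m', symmetric])
  also have "\<dots> = (\<integral>\<^sup>+l. ennreal (gamma_density \<alpha> \<beta> l) * (\<integral>\<^sup>+w. ennreal (?h (l, w)) \<partial>lborel) \<partial>lborel)"
    unfolding \<pi>_def by (rule nn_integral_density) (use m2 in \<open>auto simp: \<pi>_def\<close>)
  also have "\<dots> = (\<integral>\<^sup>+l. ennreal V * (ennreal (gamma_density \<alpha> \<beta> l) * ?t l) \<partial>lborel)"
  proof (rule nn_integral_cong)
    fix l :: real
    show "ennreal (gamma_density \<alpha> \<beta> l) * (\<integral>\<^sup>+w. ennreal (?h (l, w)) \<partial>lborel)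
      = ennreal V * (ennreal (gamma_density \<alpha> \<beta> l) * ?t l)"
    proof (cases "0 < l")
      case True
      then show ?thesis
        unfolding V_def by (subst mstou_kernel_time_integral[OF c k r True]) (simp only: mult_ac)
    qed (simp add: gamma_density_def)
  qed
  also have "\<dots> = ennreal V * (\<integral>\<^sup>+l. ennreal (gamma_density \<alpha> \<beta> l) * ?t l \<partial>lborel)"
    by (rule nn_integral_cmult) measurable
  also have "\<dots> = ennreal V * ennreal (far_mass CARD('m) \<alpha> \<beta> k r)"
    by (simp only: nn_integral_gamma_times_tail[OF \<alpha> \<beta> k r])
  also have "\<dots> = ennreal (V * far_mass CARD('m) \<alpha> \<beta> k r)"
    using V by (rule ennreal_mult'[symmetric])
  finally have nn: "(\<integral>\<^sup>+z. ennreal (?h z) \<partial>(\<pi> \<Otimes>\<^sub>M lborel)) = ennreal (V * far_mass CARD('m) \<alpha> \<beta> k r)" .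
  have ge: "AE z in \<pi> \<Otimes>\<^sub>M lborel. 0 \<le> ?h z"
    by (intro AE_I2 zero_le_power mult_nonneg_nonneg mstou_kernel_nonneg) auto
  have "0 \<le> V * far_mass CARD('m) \<alpha> \<beta> k r"
    by (rule mult_nonneg_nonneg[OF V far_mass_nonneg[OF \<alpha> \<beta> r]])
  from nn_integral_eq_integrable[OF m ge this] nn
  show "integrable (\<pi> \<Otimes>\<^sub>M lborel) ?h" "(\<integral>z. ?h z \<partial>(\<pi> \<Otimes>\<^sub>M lborel)) = V * far_mass CARD('m) \<alpha> \<beta> k r"
    by blast+
qed

lemma Lip_bound:
  assumes "L-lipschitz_on UNIV (G :: real \<Rightarrow> real)"
  shows "\<bar>G x - G y\<bar> \<le> Lip G * \<bar>x - y\<bar>" and "0 \<le> Lip G"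
proof -
  let ?S = "{\<bar>G x - G y\<bar> / \<bar>x - y\<bar> | x y. x \<noteq> y}"
  have bdd: "bdd_above ?S"
  proof (rule bdd_aboveI[of _ L])
    fix v assume "v \<in> ?S"
    then obtain x y where v: "v = \<bar>G x - G y\<bar> / \<bar>x - y\<bar>" "x \<noteq> y" by auto
    have "\<bar>G x - G y\<bar> \<le> L * \<bar>x - y\<bar>" using lipschitz_onD[OF assms, of x y] by (simp add: dist_real_def)
    then show "v \<le> L" using v by (simp add: pos_divide_le_eq)
  qed
  have up: "\<bar>G x - G y\<bar> / \<bar>x - y\<bar> \<le> Lip G" if "x \<noteq> y" for x y
    unfolding Lip_def by (rule cSup_upper[OF _ bdd]) (use that in blast)
  show "\<bar>G x - G y\<bar> \<le> Lip G * \<bar>x - y\<bar>"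
    using up[of x y] by (cases "x = y") (auto simp: pos_divide_le_eq)
  show "0 \<le> Lip G" using up[of 0 1] by (simp add: order_trans[OF abs_ge_zero])
qed

text \<open>
  The reduction of the dependence coefficient to the mass of the far part: the covariance bound is
  uniform in the number and position of the points of the past.
\<close>

theorem theta_lex_le:
  fixes \<Lambda> :: "(real \<times> real \<times> (real ^ 'm::{finite,linorder})) set \<Rightarrow> 'w \<Rightarrow> real"
    and Y :: "real \<times> (real ^ 'm::{finite,linorder}) \<Rightarrow> 'w \<Rightarrow> real"
  assumes basis: "square_integrable_levy_basis M \<Lambda> \<gamma> \<Sigma> \<nu> \<pi>"
    and bound: "square_integrable_levy_basis.moment_bound M \<Lambda> \<pi> k a"
    and Y: "\<And>p. has_levy_integral M \<Lambda> \<pi> levy_space (mstou_kernel c p) (Y p)"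
    and \<pi>: "\<pi> = density lborel (\<lambda>l. ennreal (gamma_density \<alpha> \<beta> l))"
    and c: "0 < c" and \<alpha>: "\<alpha> > real CARD('m) + 1" and \<beta>: "\<beta> > 0"
    and r: "0 \<le> r" "r \<le> h" "2 * c * r \<le> h"
    and K: "0 \<le> K" "a * (measure lborel (cball (0 :: real ^ 'm::{finite,linorder}) c) * far_mass CARD('m) \<alpha> \<beta> k r) \<le> K ^ k"
  shows "theta_lex M Y h \<le> ennreal (2 * K)"
  unfolding theta_lex_def
proof (rule SUP_least)
  fix u :: nat
  interpret square_integrable_levy_basis M \<Lambda> \<gamma> \<Sigma> \<nu> \<pi> by (rule basis)
  from bound have k: "0 < k" by (simp add: moment_bound_def)
  show "theta_lex_u M Y u h \<le> ennreal (2 * K)"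
    unfolding theta_lex_u_def
  proof (rule Sup_least)
    let ?Pi = "\<Pi>\<^sub>M i\<in>{..<u}. (borel :: real measure)"
    fix v assume "v \<in> {ennreal (\<bar>covariance M (\<lambda>\<omega>. F (\<lambda>i\<in>{..<u}. Y (q i) \<omega>)) (\<lambda>\<omega>. G (Y p \<omega>))\<bar>
              / (sup_norm_on (space ?Pi) F * Lip G)) | F G p q.
            F \<in> borel_measurable ?Pi \<and> bounded (F ` space ?Pi) \<and>
            bounded (range G) \<and> (\<exists>L. L-lipschitz_on UNIV G) \<and>
            sup_norm_on (space ?Pi) F * Lip G \<noteq> 0 \<and>
            inj_on q {..<u} \<and> q ` {..<u} \<subseteq> lex_past p h}"
    then obtain F G p q where v: "v = ennreal (\<bar>covariance M (\<lambda>\<omega>. F (\<lambda>i\<in>{..<u}. Y (q i) \<omega>)) (\<lambda>\<omega>. G (Y p \<omega>))\<bar>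
              / (sup_norm_on (space ?Pi) F * Lip G))"
      and F: "F \<in> borel_measurable ?Pi" and Fbd: "bounded (F ` space ?Pi)" and Gbd: "bounded (range G)"
      and GL: "\<exists>L. L-lipschitz_on UNIV G" and ne: "sup_norm_on (space ?Pi) F * Lip G \<noteq> 0"
      and q: "q ` {..<u} \<subseteq> lex_past p h" by blast
    define SF where "SF = sup_norm_on (space ?Pi) F"
    obtain b where b: "\<And>x. x \<in> space ?Pi \<Longrightarrow> \<bar>F x\<bar> \<le> b" using Fbd by (auto simp: bounded_iff)
    have Fb: "\<bar>F x\<bar> \<le> SF" if "x \<in> space ?Pi" for x
      unfolding SF_def sup_norm_on_def using that b by (intro cSUP_upper bdd_aboveI2[of _ _ b]) auto
    have "(\<lambda>i\<in>{..<u}. 0 :: real) \<in> space ?Pi" by (simp add: space_PiM)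
    then have SF: "0 \<le> SF" using Fb by (meson abs_ge_zero order_trans)
    obtain bG where Gb: "\<And>x. \<bar>G x\<bar> \<le> bG" using Gbd by (auto simp: bounded_iff)
    obtain L where L: "L-lipschitz_on UNIV G" using GL by blast
    have G: "G \<in> borel_measurable borel"
      by (rule borel_measurable_continuous_onI[OF lipschitz_on_continuous_on[OF L]])
    have kern_int: "integrable control (\<lambda>z. mstou_kernel c p' z ^ k)" for p' :: "real \<times> (real ^ 'm::{finite,linorder})"
    proof -
      have eq: "mstou_kernel c p' z * indicator (far_set (fst p') 0) z = mstou_kernel c p' z" for z
        by (cases z) (auto simp: far_set_def indicator_def mstou_kernel_future not_le)
      show ?thesis
        using mstou_kernel_power_integral(1)[OF c k order_refl \<alpha> \<beta>, of p'] unfolding eq \<pi> .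
    qed
    have "\<bar>covariance M (\<lambda>\<omega>. F (\<lambda>i\<in>{..<u}. Y (q i) \<omega>)) (\<lambda>\<omega>. G (Y p \<omega>))\<bar> \<le> 2 * SF * (Lip G * K)"
    proof (rule covariance_bound[OF bound Y mstou_kernel_nonneg kern_int Y mstou_kernel_nonneg kern_int
          far_set_borel _ F Fb G Gb Lip_bound[OF L] K(1)])
      fix i and z :: "real \<times> real \<times> (real ^ 'm::{finite,linorder})"
      assume i: "i < u" and z: "z \<notin> far_set (fst p) r"
      show "mstou_kernel c (q i) z = 0 \<or> mstou_kernel c p z = 0"
      proof (cases z)
        case (fields l s \<xi>)
        have "(s, \<xi>) \<notin> ambit_set c p \<or> (s, \<xi>) \<notin> ambit_set c (q i)"
          using ambit_overlap_far[of "q i" p h c r s \<xi>] q i z c r fields by (auto simp: far_set_def)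
        then show ?thesis using fields by (auto simp: mstou_kernel_def)
      qed
    next
      show "a * (\<integral>z. (mstou_kernel c p z * indicator (far_set (fst p) r) z) ^ k \<partial>control) \<le> K ^ k"
        using K(2) mstou_kernel_power_integral(2)[OF c k r(1) \<alpha> \<beta>, of p] by (simp add: \<pi>)
    qed
    then have "\<bar>covariance M (\<lambda>\<omega>. F (\<lambda>i\<in>{..<u}. Y (q i) \<omega>)) (\<lambda>\<omega>. G (Y p \<omega>))\<bar> \<le> 2 * K * (SF * Lip G)"
      by (simp add: mult_ac)
    moreover have "0 < SF * Lip G"
      using ne SF Lip_bound(2)[OF L] unfolding SF_def[symmetric] by (simp add: less_le)
    ultimately show "v \<le> ennreal (2 * K)"
      unfolding v SF_def[symmetric] by (intro ennreal_leI) (simp only: pos_divide_le_eq)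
  qed
qed

text \<open>
  Estimates \<open>k * r + \<beta>\<close> from below by \<open>k * r\<close>, after which every term of the sum has the same power of \<open>r\<close>.
\<close>

lemma far_mass_decay:
  assumes \<alpha>: "\<alpha> > real m + 1" and \<beta>: "\<beta> > 0" and k: "0 < k"
  shows "\<exists>D\<ge>0. \<forall>r>0. far_mass m \<alpha> \<beta> k r \<le> D * r powr (real m + 1 - \<alpha>)"
proof -
  define e where "e = \<alpha> - real m - 1"
  define B where "B j = Gamma (e + real j) / Gamma \<alpha> / fact j * real k powr (- e)" for j :: nat
  have e: "0 < e" using \<alpha> by (simp add: e_def)
  have G: "0 < Gamma \<alpha>" using \<alpha> by (intro Gamma_real_pos) simp
  have Gj: "0 \<le> Gamma (e + real j)" for j using e by (intro Gamma_real_nonneg) simp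
  have B: "0 \<le> B j" for j using G Gj by (simp add: B_def)
  let ?A = "fact m * \<beta> powr \<alpha> / real k ^ Suc m"
  have "far_mass m \<alpha> \<beta> k r \<le> (?A * (\<Sum>j=0..m. B j)) * r powr (- e)" if r: "0 < r" for r
  proof -
    have kr: "0 < real k * r" using k r by simp
    have "far_mass m \<alpha> \<beta> k r \<le> ?A * (\<Sum>j=0..m. B j * r powr (- e))"
      unfolding far_mass_def e_def[symmetric]
    proof (intro mult_left_mono sum_mono)
      fix j
      have "(real k * r) ^ j / (fact j * (real k * r + \<beta>) powr (e + real j)) \<le> (real k * r) ^ j / (fact j * (real k * r) powr (e + real j))"
        using kr \<beta> e k by (intro divide_left_mono mult_left_mono powr_mono2) (auto intro!: mult_pos_pos)
      also have "\<dots> = (real k * r) powr (- e) / fact j"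
        using kr by (simp add: powr_add powr_realpow powr_minus divide_simps)
      also have "(real k * r) powr (- e) = real k powr (- e) * r powr (- e)"
        using r by (simp add: powr_mult)
      finally have "(real k * r) ^ j / (fact j * (real k * r + \<beta>) powr (e + real j)) * (Gamma (e + real j) / Gamma \<alpha>)
        \<le> real k powr (- e) * r powr (- e) / fact j * (Gamma (e + real j) / Gamma \<alpha>)"
        using G Gj by (intro mult_right_mono) auto
      then show "(real k * r) ^ j / (fact j * (real k * r + \<beta>) powr (e + real j)) * (Gamma (e + real j) / Gamma \<alpha>)
        \<le> B j * r powr (- e)" by (simp add: B_def mult_ac)
    qed simp
    then show ?thesis by (simp add: sum_distrib_right mult.assoc)
  qed
  moreover have "0 \<le> ?A * (\<Sum>j=0..m. B j)" using B by (intro mult_nonneg_nonneg sum_nonneg) auto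
  moreover have "- e = real m + 1 - \<alpha>" by (simp add: e_def)
  ultimately show ?thesis by (metis (no_types, lifting))
qed

lemma theta_decay:
  assumes le: "\<And>h. 0 < h \<Longrightarrow> theta_lex M Y h \<le> ennreal (C * h powr e)" and e: "e < 0"
  shows "theta_lex_weakly_dependent M Y" "(\<lambda>h. enn2real (theta_lex M Y h)) \<in> O(\<lambda>h. h powr e)"
proof -
  have "((\<lambda>h::real. h powr e) \<longlongrightarrow> 0) at_top" using e by (intro tendsto_neg_powr filterlim_ident)
  then have "((\<lambda>h. ennreal (C * h powr e)) \<longlongrightarrow> ennreal (C * 0)) at_top"
    by (intro tendsto_ennrealI tendsto_mult tendsto_const)
  then have lim: "((\<lambda>h. ennreal (C * h powr e)) \<longlongrightarrow> 0) at_top" by simp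
  show "theta_lex_weakly_dependent M Y"
    unfolding theta_lex_weakly_dependent_def
  proof (rule tendsto_sandwich[OF _ _ tendsto_const lim])
    show "\<forall>\<^sub>F h in at_top. theta_lex M Y h \<le> ennreal (C * h powr e)"
      using eventually_gt_at_top[of 0] by eventually_elim (rule le)
  qed simp
  show "(\<lambda>h. enn2real (theta_lex M Y h)) \<in> O(\<lambda>h. h powr e)"
  proof (rule bigoI[of _ "\<bar>C\<bar>"])
    show "\<forall>\<^sub>F h in at_top. norm (enn2real (theta_lex M Y h)) \<le> \<bar>C\<bar> * norm (h powr e)"
      using eventually_gt_at_top[of 0]
    proof eventually_elim
      case (elim h)
      have "theta_lex M Y h \<le> ennreal (\<bar>C\<bar> * h powr e)"
        using le[OF elim] by (rule order_trans) (intro ennreal_leI mult_right_mono, auto)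
      then have "enn2real (theta_lex M Y h) \<le> \<bar>C\<bar> * h powr e" by (intro enn2real_leI) auto
      then show ?case by simp
    qed
  qed
qed

section \<open>The theta-lex coefficients\<close>

text \<open>
  With \<open>Q = sqrt ((c\<^sup>2 + 1) * (m + 1))\<close>, so that \<open>w = h / Q\<close>, the claims are \<open>Q \<ge> 1\<close>, \<open>Q \<ge> 2 * c\<close> for \<open>c \<le> 1\<close>, and
  \<open>Q \<ge> 2\<close> for \<open>c > 1\<close>. All follow from \<open>m \<ge> 1\<close>.
\<close>

lemma truncation_radius:
  fixes c h :: real and m :: nat
  assumes c: "0 < c" and m: "1 \<le> m" and h: "0 < h"
  defines "w \<equiv> 1 / sqrt (c\<^sup>2 + 1) * (h / sqrt (real m + 1))"
  shows "0 < w" "w \<le> h" "c \<le> 1 \<Longrightarrow> 2 * c * w \<le> h" "1 < c \<Longrightarrow> 2 * w \<le> h"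
proof -
  define Q where "Q = sqrt ((c\<^sup>2 + 1) * (real m + 1))"
  have c1: "1 \<le> c\<^sup>2 + 1" by simp
  have m2: "2 \<le> real m + 1" using m by simp
  have prod: "1 * 2 \<le> (c\<^sup>2 + 1) * (real m + 1)" using c1 m2 by (intro mult_mono) auto
  have w: "w = h / Q" by (simp add: w_def Q_def real_sqrt_mult)
  have Q1: "1 \<le> Q" unfolding Q_def using prod by simp
  then have Q0: "0 < Q" by linarith
  show "0 < w" using h Q0 by (simp add: w)
  have le: "x * w \<le> h" if "x \<le> Q" for x
  proof -
    have "x * (h / Q) \<le> Q * (h / Q)" using that h Q0 by (intro mult_right_mono) auto
    then show ?thesis using Q0 by (simp add: w)
  qed
  show "w \<le> h" using le[OF Q1] by simp
  show "2 * c * w \<le> h" if "c \<le> 1"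
  proof (rule le, unfold Q_def, rule real_le_rsqrt)
    have "c\<^sup>2 \<le> 1" using that c by (intro power_le_one) auto
    then have "(2 * c)\<^sup>2 \<le> (c\<^sup>2 + 1) * 2" by (simp add: power_mult_distrib)
    also have "\<dots> \<le> (c\<^sup>2 + 1) * (real m + 1)" using m2 by (intro mult_left_mono) auto
    finally show "(2 * c)\<^sup>2 \<le> (c\<^sup>2 + 1) * (real m + 1)" .
  qed
  show "2 * w \<le> h" if "1 < c"
  proof (rule le, unfold Q_def, rule real_le_rsqrt)
    have "1 \<le> c\<^sup>2" using that by (intro one_le_power) auto
    then have "2 * 2 \<le> (c\<^sup>2 + 1) * (real m + 1)" using m2 by (intro mult_mono) auto
    then show "2\<^sup>2 \<le> (c\<^sup>2 + 1) * (real m + 1)" by simp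
  qed
qed

theorem theorem3p30:
  fixes M :: "'w measure"
    and \<Lambda> :: "(real \<times> real \<times> (real ^ 'm::{finite,linorder})) set \<Rightarrow> 'w \<Rightarrow> real"
    and Y :: "real \<times> (real ^ 'm::{finite,linorder}) \<Rightarrow> 'w \<Rightarrow> real"
    and \<gamma> \<Sigma> c \<alpha> \<beta> :: real
    and \<nu> \<pi> :: "real measure"
    and m :: nat
    and \<psi> :: "real \<Rightarrow> real"
    and V \<Sigma>\<^sub>\<Lambda> \<gamma>\<^sub>0 \<gamma>\<^sub>a\<^sub>b\<^sub>s :: real
  assumes m: "m = CARD('m)"
    and c: "0 < c"
    and Y: "c_class_MSTOU M \<Lambda> \<gamma> \<Sigma> \<nu> \<pi> c Y"
    and \<alpha>: "\<alpha> > real m + 1"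
    and \<beta>: "\<beta> > 0"
    and \<pi>: "\<pi> = density lborel (\<lambda>l. ennreal (gamma_density \<alpha> \<beta> l))"
    and \<psi>: "\<psi> = (\<lambda>h. 1 / sqrt (c\<^sup>2 + 1) * (h / sqrt (real m + 1)))"
    and V: "V = measure lborel (cball (0 :: real ^ 'm::{finite,linorder}) c)"
    and \<Sigma>\<^sub>\<Lambda>: "\<Sigma>\<^sub>\<Lambda> = \<Sigma> + (LINT x|\<nu>. x\<^sup>2)"
    and \<gamma>\<^sub>0: "\<gamma>\<^sub>0 = \<gamma> - (LINT x:{x. \<bar>x\<bar> \<le> 1}|\<nu>. x)"
    and \<gamma>\<^sub>a\<^sub>b\<^sub>s: "\<gamma>\<^sub>a\<^sub>b\<^sub>s = \<bar>\<gamma>\<^sub>0\<bar> + (LINT x|\<nu>. \<bar>x\<bar>)"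
  shows
    "(set_integrable \<nu> {x. \<bar>x\<bar> > 1} (\<lambda>x. x\<^sup>2) \<and>
      \<gamma> + (LINT x:{x. \<bar>x\<bar> > 1}|\<nu>. x) = 0 \<longrightarrow>
        theta_lex_weakly_dependent M Y \<and>
        (c \<le> 1 \<and> m = 1 \<longrightarrow>
          (\<forall>h>0. theta_lex M Y h \<le> ennreal (2 * sqrt (
             c * \<Sigma>\<^sub>\<Lambda> * \<beta> powr \<alpha> / (2 * Gamma \<alpha>) *
             (Gamma (\<alpha> - 2) / (2 * \<psi> h + \<beta>) powr (\<alpha> - 2) +
              2 * \<psi> h * Gamma (\<alpha> - 1) / (2 * \<psi> h + \<beta>) powr (\<alpha> - 1)))))) \<and>
        (c \<le> 1 \<and> m \<ge> 2 \<longrightarrow>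
          (\<forall>h>0. theta_lex M Y h \<le> ennreal (2 * sqrt (
             V * (fact m * \<Sigma>\<^sub>\<Lambda> * \<beta> powr \<alpha> / 2 ^ (m + 1)) *
             (\<Sum>k=0..m. (2 * \<psi> h) ^ k /
                (fact k * (2 * \<psi> h + \<beta>) powr (\<alpha> - real m - 1 + real k)) *
                (Gamma (\<alpha> - real m - 1 + real k) / Gamma \<alpha>)))))) \<and>
        (c > 1 \<longrightarrow>
          (\<forall>h>0. theta_lex M Y h \<le> ennreal (2 * sqrt (
             V * (fact m * \<Sigma>\<^sub>\<Lambda> * \<beta> powr \<alpha> / 2 ^ (m + 1)) *
             (\<Sum>k=0..m. (2 * \<psi> h / c) ^ k /
                (fact k * (2 * \<psi> h / c + \<beta>) powr (\<alpha> - real m - 1 + real k)) *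
                (Gamma (\<alpha> - real m - 1 + real k) / Gamma \<alpha>)))))) \<and>
        (\<lambda>h. enn2real (theta_lex M Y h)) \<in> O(\<lambda>h. h powr ((real m + 1 - \<alpha>) / 2)))
     \<and>
     (integrable \<nu> (\<lambda>x. \<bar>x\<bar>) \<and> \<Sigma> = 0 \<longrightarrow>
        theta_lex_weakly_dependent M Y \<and>
        (c \<le> 1 \<longrightarrow>
          (\<forall>h>0. theta_lex M Y h \<le> ennreal (
             2 * V * fact m * \<beta> powr \<alpha> * \<gamma>\<^sub>a\<^sub>b\<^sub>s *
             (\<Sum>k=0..m. \<psi> h ^ k /
                (fact k * (\<psi> h + \<beta>) powr (\<alpha> - real m - 1 + real k)) *
                (Gamma (\<alpha> - real m - 1 + real k) / Gamma \<alpha>))))) \<and>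
        (c > 1 \<longrightarrow>
          (\<forall>h>0. theta_lex M Y h \<le> ennreal (
             2 * V * fact m * \<beta> powr \<alpha> * \<gamma>\<^sub>a\<^sub>b\<^sub>s *
             (\<Sum>k=0..m. (\<psi> h / c) ^ k /
                (fact k * (\<psi> h / c + \<beta>) powr (\<alpha> - real m - 1 + real k)) *
                (Gamma (\<alpha> - real m - 1 + real k) / Gamma \<alpha>))))) \<and>
        (\<lambda>h. enn2real (theta_lex M Y h)) \<in> O(\<lambda>h. h powr (real m + 1 - \<alpha>)))"
proof -
  have m1: "1 \<le> m" unfolding m by simp
  from Y have lb: "levy_basis M \<Lambda> \<gamma> \<Sigma> \<nu> \<pi>" and tail: "set_integrable \<nu> {x. \<bar>x\<bar> > 1} (\<lambda>x. x\<^sup>2)"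
    and Yp: "\<And>p. has_levy_integral M \<Lambda> \<pi> levy_space (mstou_kernel c p) (Y p)"
    by (auto simp: c_class_MSTOU_def)
  interpret L: square_integrable_levy_basis M \<Lambda> \<gamma> \<Sigma> \<nu> \<pi>
  proof -
    interpret prob_space M using lb by (simp add: levy_basis_def)
    show "square_integrable_levy_basis M \<Lambda> \<gamma> \<Sigma> \<nu> \<pi>" by unfold_locales (fact lb, fact tail)
  qed
  note basis = L.square_integrable_levy_basis_axioms
  have V0: "0 \<le> V" by (simp add: V)
  define r where "r h = (if c \<le> 1 then \<psi> h else \<psi> h / c)" for h
  define \<rho> where "\<rho> = (if c \<le> 1 then 1 else 1 / c) * (1 / sqrt (c\<^sup>2 + 1) * (1 / sqrt (real m + 1)))"
  have \<rho>: "0 < \<rho>" using c by (simp add: \<rho>_def add_nonneg_pos)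
  have r_eq: "r h = \<rho> * h" for h by (simp add: r_def \<rho>_def \<psi>)
  have r: "0 < r h" "r h \<le> h" "2 * c * r h \<le> h" if h: "0 < h" for h
  proof -
    note * = truncation_radius[OF c m1 h]
    have \<psi>h: "0 < \<psi> h" "\<psi> h \<le> h" "c \<le> 1 \<Longrightarrow> 2 * c * \<psi> h \<le> h" "1 < c \<Longrightarrow> 2 * \<psi> h \<le> h"
      unfolding \<psi> by (fact *)+
    show "0 < r h" "2 * c * r h \<le> h" using \<psi>h c by (auto simp: r_def)
    have "\<psi> h / c \<le> \<psi> h" if "1 < c" using that \<psi>h(1) by (simp add: divide_le_eq)
    then show "r h \<le> h" using \<psi>h(2) by (auto simp: r_def)
  qed
  have \<alpha>': "\<alpha> > real CARD('m) + 1" using \<alpha> by (simp add: m)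
  have theta: "theta_lex M Y h \<le> ennreal (2 * K)"
    if "L.moment_bound k a" "0 < h" "0 \<le> K" "a * (V * far_mass m \<alpha> \<beta> k (r h)) \<le> K ^ k" for k a h K
    using theta_lex_le[OF basis that(1) Yp \<pi> c \<alpha>' \<beta> less_imp_le[OF r(1)[OF that(2)]] r(2,3)[OF that(2)] that(3)] that(4)
    unfolding V m by blast
  have fm0: "0 \<le> far_mass m \<alpha> \<beta> k (r h)" if "0 < h" for k h
    using far_mass_nonneg[OF \<alpha> \<beta> less_imp_le[OF r(1)[OF that]]] .
  define e where "e = real m + 1 - \<alpha>"
  have e: "e < 0" using \<alpha> by (simp add: e_def)
  have decay: "\<exists>D\<ge>0. \<forall>h>0. far_mass m \<alpha> \<beta> k (r h) \<le> D * h powr e" if k: "0 < k" for k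
  proof -
    obtain D where D: "0 \<le> D" "\<And>r. 0 < r \<Longrightarrow> far_mass m \<alpha> \<beta> k r \<le> D * r powr e"
      using far_mass_decay[OF \<alpha> \<beta> k] unfolding e_def by blast
    have "far_mass m \<alpha> \<beta> k (r h) \<le> (D * \<rho> powr e) * h powr e" if h: "0 < h" for h
      using D(2)[OF r(1)[OF h]] \<rho> h by (simp add: r_eq powr_mult mult.assoc)
    then show ?thesis using D(1) by (intro exI[of _ "D * \<rho> powr e"]) auto
  qed
  have far_mass_2: "\<Sigma>\<^sub>\<Lambda> * (V * far_mass m \<alpha> \<beta> 2 x) = V * (fact m * \<Sigma>\<^sub>\<Lambda> * \<beta> powr \<alpha> / 2 ^ (m + 1)) *
       (\<Sum>k=0..m. (2 * x) ^ k / (fact k * (2 * x + \<beta>) powr (\<alpha> - real m - 1 + real k)) *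
          (Gamma (\<alpha> - real m - 1 + real k) / Gamma \<alpha>))" for x
    by (simp add: far_mass_def)
  \<comment> \<open>in dimension one the ball of radius \<open>c\<close> has length \<open>2 * c\<close>\<close>
  have far_mass_2_plane: "\<Sigma>\<^sub>\<Lambda> * (V * far_mass m \<alpha> \<beta> 2 x) = c * \<Sigma>\<^sub>\<Lambda> * \<beta> powr \<alpha> / (2 * Gamma \<alpha>) *
       (Gamma (\<alpha> - 2) / (2 * x + \<beta>) powr (\<alpha> - 2) + 2 * x * Gamma (\<alpha> - 1) / (2 * x + \<beta>) powr (\<alpha> - 1))"
    if "m = 1" for x
  proof -
    have "V = unit_ball_vol (real m) * c ^ m" unfolding V using c by (subst content_cball) (auto simp: m)
    then have "V = 2 * c" using that by simp
    then show ?thesis using that by (simp add: far_mass_def diff_diff_eq algebra_simps)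
  qed
  have far_mass_1: "2 * (\<gamma>\<^sub>a\<^sub>b\<^sub>s * (V * far_mass m \<alpha> \<beta> 1 x)) = 2 * V * fact m * \<beta> powr \<alpha> * \<gamma>\<^sub>a\<^sub>b\<^sub>s *
       (\<Sum>k=0..m. x ^ k / (fact k * (x + \<beta>) powr (\<alpha> - real m - 1 + real k)) *
          (Gamma (\<alpha> - real m - 1 + real k) / Gamma \<alpha>))" for x
    by (simp add: far_mass_def)
  have r_le: "c \<le> 1 \<Longrightarrow> r h = \<psi> h" and r_gt: "1 < c \<Longrightarrow> r h = \<psi> h / c" for h
    by (simp_all add: r_def)
  have r_gt_2: "2 * (\<psi> h / c) = 2 * \<psi> h / c" for h by simp
  have centered: "theta_lex M Y h \<le> ennreal (2 * sqrt (\<Sigma>\<^sub>\<Lambda> * (V * far_mass m \<alpha> \<beta> 2 (r h))))"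
    if \<gamma>: "\<gamma> + (LINT x:{x. \<bar>x\<bar> > 1}|\<nu>. x) = 0" and h: "0 < h" for h
  proof -
    have mb: "L.moment_bound 2 \<Sigma>\<^sub>\<Lambda>"
      using L.moment_bound_centered[OF \<gamma>] by (simp add: \<Sigma>\<^sub>\<Lambda>)
    then have "0 \<le> \<Sigma>\<^sub>\<Lambda>" by (simp add: L.moment_bound_def)
    then show ?thesis using V0 fm0[OF h] by (intro theta[OF mb h]) auto
  qed
  have S0: "0 \<le> \<Sigma>\<^sub>\<Lambda>" unfolding \<Sigma>\<^sub>\<Lambda> using L.Sigma_nonneg by simp
  obtain D2 where D2: "0 \<le> D2" "\<And>h. 0 < h \<Longrightarrow> far_mass m \<alpha> \<beta> 2 (r h) \<le> D2 * h powr e"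
    using decay[of 2] by auto
  have centered_decay: "theta_lex M Y h \<le> ennreal (2 * sqrt (\<Sigma>\<^sub>\<Lambda> * (V * D2)) * h powr (e / 2))"
    if \<gamma>: "\<gamma> + (LINT x:{x. \<bar>x\<bar> > 1}|\<nu>. x) = 0" and h: "0 < h" for h
  proof -
    have "sqrt (\<Sigma>\<^sub>\<Lambda> * (V * far_mass m \<alpha> \<beta> 2 (r h))) \<le> sqrt (\<Sigma>\<^sub>\<Lambda> * (V * (D2 * h powr e)))"
      using D2(2)[OF h] S0 V0 by (intro real_sqrt_le_mono mult_left_mono) auto
    also have "\<dots> = sqrt (\<Sigma>\<^sub>\<Lambda> * (V * D2)) * sqrt (h powr e)"
      by (simp add: real_sqrt_mult mult.assoc)
    also have "sqrt (h powr e) = h powr (e / 2)"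
      by (simp add: powr_half_sqrt[symmetric] powr_powr)
    finally show ?thesis
      using centered[OF \<gamma> h] by (elim order_trans) (intro ennreal_leI, simp)
  qed
  have g0: "0 \<le> \<gamma>\<^sub>a\<^sub>b\<^sub>s" by (simp add: \<gamma>\<^sub>a\<^sub>b\<^sub>s)
  have fv: "theta_lex M Y h \<le> ennreal (2 * (\<gamma>\<^sub>a\<^sub>b\<^sub>s * (V * far_mass m \<alpha> \<beta> 1 (r h))))"
    if \<nu>: "integrable \<nu> (\<lambda>x. \<bar>x\<bar>)" "\<Sigma> = 0" and h: "0 < h" for h
  proof -
    interpret FV: finite_variation_levy_basis M \<Lambda> \<gamma> \<Sigma> \<nu> \<pi> by unfold_locales (fact \<nu>)+
    have mb: "L.moment_bound 1 \<gamma>\<^sub>a\<^sub>b\<^sub>s"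
      using FV.moment_bound_finite_variation by (simp add: \<gamma>\<^sub>a\<^sub>b\<^sub>s \<gamma>\<^sub>0 FV.drift_def FV.jump_mean_def)
    show ?thesis using g0 V0 fm0[OF h] by (intro theta[OF mb h]) auto
  qed
  obtain D1 where D1: "0 \<le> D1" "\<And>h. 0 < h \<Longrightarrow> far_mass m \<alpha> \<beta> 1 (r h) \<le> D1 * h powr e"
    using decay[of 1] by auto
  have fv_decay: "theta_lex M Y h \<le> ennreal (2 * (\<gamma>\<^sub>a\<^sub>b\<^sub>s * (V * D1)) * h powr e)"
    if \<nu>: "integrable \<nu> (\<lambda>x. \<bar>x\<bar>)" "\<Sigma> = 0" and h: "0 < h" for h
  proof -
    have "\<gamma>\<^sub>a\<^sub>b\<^sub>s * (V * far_mass m \<alpha> \<beta> 1 (r h)) \<le> \<gamma>\<^sub>a\<^sub>b\<^sub>s * (V * (D1 * h powr e))"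
      using D1(2)[OF h] g0 V0 by (intro mult_left_mono) auto
    then show ?thesis
      using fv[OF \<nu> h] by (elim order_trans) (intro ennreal_leI, simp add: mult.assoc)
  qed
  show ?thesis
  proof ((intro conjI impI allI; elim conjE), goal_cases)
    case 1
    then show ?case using theta_decay(1)[OF centered_decay] e by simp
  next
    case (2 h)
    then have "theta_lex M Y h \<le> ennreal (2 * sqrt (\<Sigma>\<^sub>\<Lambda> * (V * far_mass m \<alpha> \<beta> 2 (\<psi> h))))"
      using centered[of h] by (simp add: r_le)
    then show ?case by (simp only: far_mass_2_plane[OF \<open>m = 1\<close>])
  next
    case (3 h)
    then show ?case using centered[of h] by (simp only: far_mass_2 r_le)
  next
    case (4 h)
    then show ?case using centered[of h] by (simp only: far_mass_2 r_gt r_gt_2)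
  next
    case 5
    then show ?case using theta_decay(2)[OF centered_decay] e by (simp add: e_def)
  next
    case 6
    then show ?case using theta_decay(1)[OF fv_decay] e by simp
  next
    case (7 h)
    then show ?case using fv[of h] by (simp only: far_mass_1 r_le)
  next
    case (8 h)
    then show ?case using fv[of h] by (simp only: far_mass_1 r_gt)
  next
    case 9
    then show ?case using theta_decay(2)[OF fv_decay] e by (simp add: e_def)
  qed
qed

end
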